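(* Let $X$ be an open subset of $\mathbb{C}^n$ and $D\subset X$ a divisor (hypersurface) with reduced global equation $f:X\to\mathbb{C}$. If $\dim X=2$ (i.e. $n=2$) and $D$ satisfies property $(\mathrm{GCL})$, then $D$ is of commutative linear type.
   Context: $\mathcal{O}_X$ is the sheaf of holomorphic functions on $X$, $x_1,\dots,x_n$ are the coordinates of $\mathbb{C}^n$, and $f'_{x_i}=\partial f/\partial x_i$. Let $J=\mathcal{O}_X(f,f'_{x_1},\dots,f'_{x_n})$ be the Jacobian ideal of $D$ and $\mathcal{R}(J)=\bigoplus_{d\ge0}J^dt^d\subset\mathcal{O}_X[t]$ its Rees algebra. Let $\varphi:\mathcal{O}_X[s,\xi_1,\dots,\xi_n]\to\mathcal{R}(J)$ be the surjective graded morphism of $\mathcal{O}_X$-algebras given by $\varphi(F)=F(f,f'_{x_1},\dots,f'_{x_n})\,t^d$ for each homogeneous polynomial $F(s,\xi_1,\dots,\xi_n)$ of degree $d$. Let $\ker^{(1)}\varphi$ be the ideal of $\mathcal{O}_X[s,\xi_1,\dots,\xi_n]$ generated by the homogeneous part of degree $1$ of $\ker\varphi$. Property $(\mathrm{GCL})$: there is an integer $N\ge0$ such that $s^N\ker\varphi\subset\ker^{(1)}\varphi$. (This does not depend on the choice of the reduced equation $f$.) An ideal $I$ of a commutative ring $A$ is of linear type if the canonical surjection $\mathrm{Sym}_A(I)\to\mathcal{R}(I)=\bigoplus_{d\ge 0}I^dt^d$ from the symmetric algebra to the Rees algebra is an isomorphism. $D$ is of commutative linear type if at each $p\in D$ the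 stalk $J_p\subset\mathcal{O}_{X,p}$ is an ideal of linear type; equivalently, $\ker\varphi=\ker^{(1)}\varphi$. *)

theory Defs
  imports
    "HOL-Analysis.Analysis"
    "HOL-Computational_Algebra.Polynomial"
    "HOL-Library.Poly_Mapping"
    "HOL-Algebra.QuotRing"
    "HOL-Algebra.Ideal_Product"
begin

section \<open>Holomorphic functions of several variables and their germs\<close>

text \<open>On open sets: complex differentiability in the sense of Frechet, the differential being
  the complex linear form with coefficient vector \<open>c\<close>.\<close>

definition mholomorphic_on :: "(complex ^ 'n \<Rightarrow> complex) \<Rightarrow> (complex ^ 'n) set \<Rightarrow> bool"
    (infix "mholomorphic'_on" 50) where
  "f mholomorphic_on U \<longleftrightarrow>
     (\<forall>z\<in>U. \<exists>c :: complex ^ 'n. (f has_derivative (\<lambda>h. \<Sum>i\<in>UNIV. c $ i * h $ i)) (at z))"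

definition holomorphic_near :: "complex ^ 'n \<Rightarrow> (complex ^ 'n \<Rightarrow> complex) \<Rightarrow> bool" where
  "holomorphic_near p f \<longleftrightarrow> (\<exists>U. open U \<and> p \<in> U \<and> f mholomorphic_on U)"

definition partial_deriv :: "'n \<Rightarrow> (complex ^ 'n \<Rightarrow> complex) \<Rightarrow> complex ^ 'n \<Rightarrow> complex" where
  "partial_deriv i f z = deriv (\<lambda>w. f (\<chi> j. if j = i then w else z $ j)) (z $ i)"

lemma mholomorphic_on_const: "(\<lambda>_. k) mholomorphic_on U"
  unfolding mholomorphic_on_def by (auto intro!: exI[of _ 0])

lemma mholomorphic_on_add:
  assumes "f mholomorphic_on U" "g mholomorphic_on U"
  shows "(\<lambda>z. f z + g z) mholomorphic_on U"
  unfolding mholomorphic_on_def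
proof
  fix z assume "z \<in> U"
  then obtain c d :: "complex ^ 'a"
    where "(f has_derivative (\<lambda>h. \<Sum>i\<in>UNIV. c $ i * h $ i)) (at z)"
      and "(g has_derivative (\<lambda>h. \<Sum>i\<in>UNIV. d $ i * h $ i)) (at z)"
    using assms unfolding mholomorphic_on_def by blast
  from has_derivative_add[OF this]
  show "\<exists>c. ((\<lambda>z. f z + g z) has_derivative (\<lambda>h. \<Sum>i\<in>UNIV. c $ i * h $ i)) (at z)"
    by (intro exI[of _ "c + d"]) (simp add: sum.distrib[symmetric] algebra_simps)
qed

lemma mholomorphic_on_mult:
  assumes "f mholomorphic_on U" "g mholomorphic_on U"
  shows "(\<lambda>z. f z * g z) mholomorphic_on U"
  unfolding mholomorphic_on_def
proof
  fix z assume "z \<in> U"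
  then obtain c d :: "complex ^ 'a"
    where "(f has_derivative (\<lambda>h. \<Sum>i\<in>UNIV. c $ i * h $ i)) (at z)"
      and "(g has_derivative (\<lambda>h. \<Sum>i\<in>UNIV. d $ i * h $ i)) (at z)"
    using assms unfolding mholomorphic_on_def by blast
  from has_derivative_mult[OF this]
  show "\<exists>c. ((\<lambda>z. f z * g z) has_derivative (\<lambda>h. \<Sum>i\<in>UNIV. c $ i * h $ i)) (at z)"
    by (intro exI[of _ "\<chi> i. f z * d $ i + c $ i * g z"])
       (simp add: sum.distrib sum_distrib_left sum_distrib_right algebra_simps)
qed

lemma mholomorphic_on_subset: "f mholomorphic_on U \<Longrightarrow> V \<subseteq> U \<Longrightarrow> f mholomorphic_on V"
  unfolding mholomorphic_on_def by blast

lemma holomorphic_near_const: "holomorphic_near p (\<lambda>_. k)"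
  unfolding holomorphic_near_def using mholomorphic_on_const by blast

lemma holomorphic_near_binop:
  assumes "holomorphic_near p f" "holomorphic_near p g"
    and "\<And>U. f mholomorphic_on U \<Longrightarrow> g mholomorphic_on U \<Longrightarrow> h mholomorphic_on U"
  shows "holomorphic_near p h"
proof -
  obtain U V where "open U" "p \<in> U" "f mholomorphic_on U" "open V" "p \<in> V" "g mholomorphic_on V"
    using assms(1,2) unfolding holomorphic_near_def by blast
  moreover from this have "h mholomorphic_on U \<inter> V"
    by (intro assms(3)) (auto intro: mholomorphic_on_subset)
  ultimately have "open (U \<inter> V)" "p \<in> U \<inter> V" "h mholomorphic_on U \<inter> V"
    by auto
  then show ?thesis unfolding holomorphic_near_def by blast
qed

lemma holomorphic_near_add:
  "holomorphic_near p f \<Longrightarrow> holomorphic_near p g \<Longrightarrow> holomorphic_near p (\<lambda>z. f z + g z)"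
  by (rule holomorphic_near_binop[OF _ _ mholomorphic_on_add])

lemma holomorphic_near_mult:
  "holomorphic_near p f \<Longrightarrow> holomorphic_near p g \<Longrightarrow> holomorphic_near p (\<lambda>z. f z * g z)"
  by (rule holomorphic_near_binop[OF _ _ mholomorphic_on_mult])

lemma holomorphic_near_uminus: "holomorphic_near p f \<Longrightarrow> holomorphic_near p (\<lambda>z. - f z)"
  using holomorphic_near_mult[OF holomorphic_near_const[of p "-1"]] by fastforce

definition germ_rel :: "(complex ^ 'n \<Rightarrow> complex) \<Rightarrow> (complex ^ 'n \<Rightarrow> complex) \<Rightarrow> bool" where
  "germ_rel f g \<longleftrightarrow> holomorphic_near 0 f \<and> holomorphic_near 0 g \<and> (\<forall>\<^sub>F z in nhds 0. f z = g z)"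

text \<open>The local ring of germs at the origin. The stalk at a point \<open>p\<close> is identified with it by
  the translation \<open>z \<mapsto> p + z\<close>, see \<open>germ_at\<close> below; a single type then carries the ring
  structure of all stalks.\<close>

quotient_type 'n germ = "complex ^ 'n \<Rightarrow> complex" / partial: germ_rel
proof (rule part_equivpI)
  show "\<exists>f :: complex ^ 'n \<Rightarrow> complex. germ_rel f f"
    unfolding germ_rel_def using holomorphic_near_const by (intro exI[of _ "\<lambda>_. 0"]) auto
  show "symp (germ_rel :: (complex ^ 'n \<Rightarrow> complex) \<Rightarrow> _)"
    unfolding germ_rel_def symp_def by (auto elim: eventually_mono)
  show "transp (germ_rel :: (complex ^ 'n \<Rightarrow> complex) \<Rightarrow> _)"
    unfolding germ_rel_def transp_def by (auto elim: eventually_elim2)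
qed

instantiation germ :: (finite) comm_ring_1
begin

lift_definition zero_germ :: "'a germ" is "\<lambda>_. 0"
  by (simp add: germ_rel_def holomorphic_near_const)
lift_definition one_germ :: "'a germ" is "\<lambda>_. 1"
  by (simp add: germ_rel_def holomorphic_near_const)
lift_definition plus_germ :: "'a germ \<Rightarrow> 'a germ \<Rightarrow> 'a germ" is "\<lambda>f g z. f z + g z"
  by (auto simp: germ_rel_def intro: holomorphic_near_add elim: eventually_elim2)
lift_definition times_germ :: "'a germ \<Rightarrow> 'a germ \<Rightarrow> 'a germ" is "\<lambda>f g z. f z * g z"
  by (auto simp: germ_rel_def intro: holomorphic_near_mult elim: eventually_elim2)
lift_definition uminus_germ :: "'a germ \<Rightarrow> 'a germ" is "\<lambda>f z. - f z"
  by (auto simp: germ_rel_def intro: holomorphic_near_uminus elim: eventually_mono)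
definition minus_germ :: "'a germ \<Rightarrow> 'a germ \<Rightarrow> 'a germ" where
  "minus_germ a b = a + (- b)"

instance
proof
  fix a b c :: "'a germ"
  show "a + b + c = a + (b + c)" "a + b = b + a" "0 + a = a" "- a + a = 0"
    "a * b * c = a * (b * c)" "a * b = b * a" "1 * a = a" "(a + b) * c = a * c + b * c"
    by (transfer, auto simp: germ_rel_def algebra_simps
          intro!: holomorphic_near_add holomorphic_near_mult holomorphic_near_uminus
            holomorphic_near_const)+
  show "a - b = a + - b" by (rule minus_germ_def)
  show "(0 :: 'a germ) \<noteq> 1"
    by transfer (auto simp: germ_rel_def dest: eventually_nhds_x_imp_x)
qed

end

text \<open>Only meaningful if \<open>f\<close> is holomorphic near \<open>p\<close>.\<close>

definition germ_at :: "complex ^ 'n \<Rightarrow> (complex ^ 'n \<Rightarrow> complex) \<Rightarrow> 'n::finite germ" where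
  "germ_at p f = abs_germ (\<lambda>z. f (p + z))"


section \<open>Rees algebra, symmetric algebra, ideals of linear type\<close>

definition ring_on :: "'a::comm_ring_1 set \<Rightarrow> 'a ring" where
  "ring_on S = \<lparr>carrier = S, mult = (*), one = 1, zero = 0, add = (+)\<rparr>"

lemma cring_ring_on_UNIV: "cring (ring_on (UNIV :: 'a::comm_ring_1 set))"
proof -
  have "\<exists>y :: 'a. y + x = 0" for x by (intro exI[of _ "- x"]) simp
  then show ?thesis
    by (intro cringI abelian_groupI comm_monoidI) (simp_all add: ring_on_def algebra_simps)
qed

abbreviation ideal_gen :: "'a::comm_ring_1 set \<Rightarrow> 'a set" where
  "ideal_gen S \<equiv> Idl\<^bsub>ring_on UNIV\<^esub> S"

primrec ideal_power :: "'a::comm_ring_1 set \<Rightarrow> nat \<Rightarrow> 'a set" where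
  "ideal_power I 0 = UNIV"
| "ideal_power I (Suc d) = ideal_prod (ring_on UNIV) I (ideal_power I d)"

text \<open>Polynomials with coefficients in \<open>'a\<close> and variables indexed by \<open>'v\<close>.\<close>

type_synonym ('v, 'a) mpoly = "('v \<Rightarrow>\<^sub>0 nat) \<Rightarrow>\<^sub>0 'a"

definition mvar :: "'v \<Rightarrow> ('v, 'a::comm_ring_1) mpoly" where
  "mvar v = Poly_Mapping.single (Poly_Mapping.single v 1) 1"

definition mconst :: "'a::comm_ring_1 \<Rightarrow> ('v, 'a) mpoly" where
  "mconst c = Poly_Mapping.single 0 c"

definition mdeg :: "('v \<Rightarrow>\<^sub>0 nat) \<Rightarrow> nat" where
  "mdeg m = (\<Sum>v\<in>Poly_Mapping.keys m. Poly_Mapping.lookup m v)"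

definition homogeneous :: "nat \<Rightarrow> ('v, 'a::comm_ring_1) mpoly \<Rightarrow> bool" where
  "homogeneous d F \<longleftrightarrow> (\<forall>m\<in>Poly_Mapping.keys F. mdeg m = d)"

text \<open>The additive map to \<open>A[t]\<close> sending \<open>F\<close> to \<open>F(g) t^d\<close> for \<open>F\<close> homogeneous of degree \<open>d\<close>.\<close>

definition rees_map :: "('v \<Rightarrow> 'a) \<Rightarrow> ('v, 'a::comm_ring_1) mpoly \<Rightarrow> 'a poly" where
  "rees_map g F = (\<Sum>m\<in>Poly_Mapping.keys F.
     monom (Poly_Mapping.lookup F m *
            (\<Prod>v\<in>Poly_Mapping.keys m. g v ^ Poly_Mapping.lookup m v)) (mdeg m))"

definition rees_algebra :: "'a::comm_ring_1 set \<Rightarrow> 'a poly ring" where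
  "rees_algebra I = ring_on {P. \<forall>d. coeff P d \<in> ideal_power I d}"

text \<open>\<open>Sym(I)\<close> is the polynomial ring with one variable for each element of \<open>I\<close>, modulo the
  relations making \<open>I \<rightarrow> Sym(I)\<close> linear. Its canonical map to the Rees algebra is induced by
  sending the variable of \<open>a \<in> I\<close> to \<open>a t\<close>.\<close>

definition sym_free :: "'a::comm_ring_1 set \<Rightarrow> ('a, 'a) mpoly ring" where
  "sym_free I = ring_on {F. \<forall>m\<in>Poly_Mapping.keys F. Poly_Mapping.keys m \<subseteq> I}"

definition sym_relations :: "'a::comm_ring_1 set \<Rightarrow> ('a, 'a) mpoly set" where
  "sym_relations I =
     {mvar (a + b) - mvar a - mvar b | a b. a \<in> I \<and> b \<in> I} \<union>
     {mvar (r * a) - mconst r * mvar a | r a. a \<in> I}"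

definition sym_algebra :: "'a::comm_ring_1 set \<Rightarrow> ('a, 'a) mpoly set ring" where
  "sym_algebra I = sym_free I Quot (Idl\<^bsub>sym_free I\<^esub> (sym_relations I))"

definition sym_to_rees :: "('a::comm_ring_1, 'a) mpoly set \<Rightarrow> 'a poly" where
  "sym_to_rees C = the_elem (rees_map (\<lambda>a. a) ` C)"

definition linear_type :: "'a::comm_ring_1 set \<Rightarrow> bool" where
  "linear_type I \<longleftrightarrow> sym_to_rees \<in> ring_iso (sym_algebra I) (rees_algebra I)"


section \<open>Divisors and their Jacobian ideals\<close>

definition vanishing_germs :: "(complex ^ 'n) set \<Rightarrow> complex ^ 'n \<Rightarrow> 'n::finite germ set" where
  "vanishing_germs D p =
     {germ_at p h | h. holomorphic_near p h \<and> (\<forall>\<^sub>F z in nhds p. z \<in> D \<longrightarrow> h z = 0)}"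

text \<open>\<open>f\<close> is nowhere locally zero, \<open>D\<close> is its zero set, and \<open>f\<close> generates the (radical) ideal
  sheaf of \<open>D\<close>.\<close>

definition reduced_equation ::
    "(complex ^ 'n) set \<Rightarrow> (complex ^ 'n) set \<Rightarrow> (complex ^ 'n::finite \<Rightarrow> complex) \<Rightarrow> bool" where
  "reduced_equation X D f \<longleftrightarrow>
     f mholomorphic_on X \<and> D = {z \<in> X. f z = 0} \<and>
     (\<forall>p\<in>D. germ_at p f \<noteq> 0 \<and> vanishing_germs D p = ideal_gen {germ_at p f})"

text \<open>The variables \<open>s\<close> and \<open>\<xi>\<^sub>i\<close>.\<close>

datatype 'n jvar = SVar | XiVar 'n

primrec jac_gen ::
    "(complex ^ 'n \<Rightarrow> complex) \<Rightarrow> complex ^ 'n \<Rightarrow> 'n jvar \<Rightarrow> 'n::finite germ" where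
  "jac_gen f p SVar = germ_at p f"
| "jac_gen f p (XiVar i) = germ_at p (partial_deriv i f)"

definition jacobian_ideal ::
    "(complex ^ 'n \<Rightarrow> complex) \<Rightarrow> complex ^ 'n \<Rightarrow> 'n::finite germ set" where
  "jacobian_ideal f p = ideal_gen (range (jac_gen f p))"

text \<open>The stalks at \<open>p\<close> of \<open>ker \<phi>\<close> and of the ideal generated by its degree one part.\<close>

definition ker_phi ::
    "(complex ^ 'n \<Rightarrow> complex) \<Rightarrow> complex ^ 'n \<Rightarrow> ('n jvar, 'n::finite germ) mpoly set" where
  "ker_phi f p = {F. rees_map (jac_gen f p) F = 0}"

definition ker1_phi ::
    "(complex ^ 'n \<Rightarrow> complex) \<Rightarrow> complex ^ 'n \<Rightarrow> ('n jvar, 'n::finite germ) mpoly set" where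
  "ker1_phi f p = ideal_gen {F \<in> ker_phi f p. homogeneous 1 F}"

text \<open>The inclusion of ideal sheaves is tested on stalks; the exponent is uniform on \<open>X\<close>.\<close>

definition GCL :: "(complex ^ 'n) set \<Rightarrow> (complex ^ 'n::finite \<Rightarrow> complex) \<Rightarrow> bool" where
  "GCL X f \<longleftrightarrow> (\<exists>N. \<forall>p\<in>X. \<forall>F\<in>ker_phi f p. mvar SVar ^ N * F \<in> ker1_phi f p)"

definition commutative_linear_type ::
    "(complex ^ 'n) set \<Rightarrow> (complex ^ 'n::finite \<Rightarrow> complex) \<Rightarrow> bool" where
  "commutative_linear_type D f \<longleftrightarrow> (\<forall>p\<in>D. linear_type (jacobian_ideal f p))"

end

theory Submission
  imports Defs "HOL-Complex_Analysis.Complex_Analysis"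
begin

text \<open>Let \<open>O\<close> be the ring of germs at a point of \<open>D\<close>, with coordinates \<open>x\<close> and \<open>y\<close>, and let
  \<open>g1 = f\<close>, \<open>g2\<close>, \<open>g3\<close> be the germs of \<open>f\<close> and its two partial derivatives. The part of degree one
  of \<open>ker \<phi>\<close> is the module \<open>Z\<close> of syzygies of \<open>(g1, g2, g3)\<close>, read as linear forms in \<open>s\<close> and the
  \<open>\<xi>\<^sub>i\<close>.

  The heart of the proof is that (GCL) produces a syzygy one of whose entries is a unit. Suppose
  there is none. Since \<open>O\<close> is regular of dimension two, \<open>Z\<close> is free on two linear forms \<open>L1\<close>, \<open>L2\<close>
  (\<open>syzygies_basis\<close>), and their coefficients lie in the maximal ideal: \<open>L1 = x P1 + y Q1\<close>,
  \<open>L2 = x P2 + y Q2\<close>. By Cramer's rule the determinant \<open>\<Delta> = P1 Q2 - P2 Q1\<close> satisfies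
  \<open>x \<Delta> \<in> (L1, L2)\<close>, so \<open>\<Delta>\<close> lies in \<open>ker \<phi>\<close>, as \<open>O\<close> is a domain. By (GCL),
  \<open>s^N \<Delta> \<in> (L1, L2)\<close>. Now specialise \<open>s\<close> to 1 and the \<open>\<xi>\<^sub>i\<close> to elements of \<open>O\<close> for which the values
  \<open>l1\<close>, \<open>l2\<close> of \<open>L1\<close>, \<open>L2\<close> have no common prime factor (\<open>coprime_specialization\<close>). Then \<open>l1\<close>, \<open>l2\<close> is
  a regular sequence in the ideal \<open>(x, y)\<close>, and the determinant of a matrix expressing a regular
  sequence in terms of generators \<open>x\<close>, \<open>y\<close> of the maximal ideal never lies in the ideal generated by
  the sequence (\<open>quadratic_relation_outside_linear\<close>). This is a contradiction
  (\<open>torsion_kernel_imp_unit_syzygy\<close>).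

  Hence the Jacobian ideal is generated by two germs \<open>a\<close>, \<open>b\<close>. As \<open>O\<close> is factorial, they can be
  written \<open>a = l a'\<close>, \<open>b = l b'\<close> with \<open>a'\<close>, \<open>b'\<close> coprime. If a form of degree \<open>n\<close> vanishes at \<open>(a, b)\<close>,
  then \<open>b'\<close> divides its coefficient at the \<open>n\<close>-th power of the first variable \<open>U\<close>; subtracting a
  multiple of \<open>b' U - a' V\<close> makes the form divisible by \<open>V\<close> and lowers the degree
  (\<open>form_in_linear_ideal\<close>). So all relations between \<open>a\<close> and \<open>b\<close> come from linear ones, which is
  linear type (\<open>linear_type_two_generated\<close>).

  The properties of \<open>O\<close> on which this rests are collected in the locale \<open>plane_local_ring\<close>, from
  which factoriality and the freeness of \<open>Z\<close> follow by approximation modulo powers of \<open>x\<close>. That germs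
  have these properties is elementary, except that a principal ideal \<open>(g)\<close> with \<open>g\<close> not divisible by
  \<open>x\<close> is closed in the \<open>x\<close>-adic topology. This uses the quotient of Weierstrass division, written as
  a Cauchy integral (\<open>weierstrass_remainder\<close>).\<close>

section \<open>Local rings resembling the convergent power series in two variables\<close>

text \<open>Only the Koszul relations hold between \<open>a\<close> and \<open>b\<close>. For germs not both zero this says that they
  have no common prime factor; it forces \<open>a\<close> to be a unit when \<open>b = 0\<close>.\<close>

definition regular_pair :: "'a::comm_ring_1 \<Rightarrow> 'a \<Rightarrow> bool" where
  "regular_pair a b \<longleftrightarrow> (\<forall>c d. c * a = d * b \<longrightarrow> (\<exists>e. c = e * b \<and> d = e * a))"

lemma regular_pairD:
  "regular_pair a b \<Longrightarrow> c * a = d * b \<Longrightarrow> \<exists>e. c = e * b \<and> d = e * a"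
  by (auto simp: regular_pair_def)

lemma regular_pair_dvd_power:
  assumes "regular_pair a b" "b dvd c * a ^ n"
  shows "b dvd c"
  using assms(2)
proof (induction n)
  case (Suc n)
  then obtain k where "c * a ^ n * a = k * b" by (auto simp: dvd_def algebra_simps)
  then have "b dvd c * a ^ n" using regular_pairD[OF assms(1)] by fastforce
  then show ?case by (rule Suc.IH)
qed simp

lemma prime_elem_dvd_prod_list:
  "prime_elem t \<Longrightarrow> t dvd prod_list ps \<Longrightarrow> \<exists>p\<in>set ps. t dvd p"
  by (induction ps) (auto simp: prime_elem_dvd_mult_iff dest: prime_elem_not_unit)

definition syzygies :: "'a::comm_ring_1 \<Rightarrow> 'a \<Rightarrow> 'a \<Rightarrow> ('a \<times> 'a \<times> 'a) set" where
  "syzygies g1 g2 g3 = {(a, b, c). a * g1 + b * g2 + c * g3 = 0}"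

definition dot3 :: "'a::comm_ring_1 \<times> 'a \<times> 'a \<Rightarrow> 'a \<times> 'a \<times> 'a \<Rightarrow> 'a" where
  "dot3 = (\<lambda>(a, b, c) (u, v, w). a * u + b * v + c * w)"

lemma dot3_simp [simp]: "dot3 (a, b, c) (u, v, w) = a * u + b * v + c * w"
  by (simp add: dot3_def)

lemma syzygies_iff [simp]:
  "(a, b, c) \<in> syzygies g1 g2 g3 \<longleftrightarrow> a * g1 + b * g2 + c * g3 = 0"
  by (simp add: syzygies_def)

text \<open>The model is the ring of convergent power series in \<open>x\<close> and \<open>y\<close>. The third assumption says that
  the quotient by \<open>x\<close> is a discrete valuation ring with uniformiser \<open>y\<close>. The last two replace the
  noetherian property: they are the consequences of Krull's intersection theorem that the proof needs.\<close>

locale plane_local_ring =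
  fixes x y :: "'a::idom"
  assumes x_prime: "prime_elem x"
    and nonunit_iff: "\<not> (a dvd 1) \<longleftrightarrow> (\<exists>b c. a = x * b + y * c)"
    and leading_term: "\<not> x dvd a \<Longrightarrow> \<exists>u m b. (u dvd 1) \<and> a = u * y ^ m + x * b"
    and x_adically_closed: "\<not> x dvd g \<Longrightarrow> (\<And>k. \<exists>u v. h = g * u + x ^ k * v) \<Longrightarrow> g dvd h"
    and bounded_factorization: "(a :: 'a) \<noteq> 0 \<Longrightarrow>
      \<exists>n. \<forall>ps. (\<forall>p\<in>set ps. \<not> (p dvd 1)) \<longrightarrow> prod_list ps dvd a \<longrightarrow> length ps < n"
begin

lemma x_nonzero: "x \<noteq> 0" using x_prime by auto

lemma x_power_not_dvd:
  fixes a :: 'a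
  assumes "a \<noteq> 0"
  shows "\<exists>k. \<not> x ^ k dvd a"
proof -
  obtain n where n: "\<And>ps. (\<forall>p\<in>set ps. \<not> (p dvd 1)) \<Longrightarrow> prod_list ps dvd a \<Longrightarrow> length ps < n"
    using bounded_factorization[OF assms] by blast
  have "\<not> x ^ n dvd a"
    using n[of "replicate n x"] prime_elem_not_unit[OF x_prime] by (auto simp: prod_list_replicate)
  then show ?thesis ..
qed

text \<open>In a discrete valuation ring, an element of least order divides all others. Here \<open>v0\<close> has least
  \<open>x\<close>-order in \<open>V\<close> and, among those, a leading coefficient of least \<open>y\<close>-order; thus it divides all
  elements of \<open>V\<close> up to one further power of \<open>x\<close>. The set \<open>V\<close> need not be an ideal: it will consist
  of values of linear or bilinear functions on a module.\<close>

lemma least_leading_term: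
  assumes "v \<in> V" "v \<noteq> 0"
  obtains v0 k c where "v0 \<in> V" "v0 = x ^ k * c" "\<not> x dvd c"
    and "\<And>w. w \<in> V \<Longrightarrow> x ^ k dvd w"
    and "\<And>w. w \<in> V \<Longrightarrow> \<exists>e. x ^ Suc k dvd w - e * v0"
proof -
  define k where "k = (LEAST k. \<exists>v\<in>V. \<not> x ^ Suc k dvd v)"
  obtain j where "\<not> x ^ j dvd v" using x_power_not_dvd[OF assms(2)] by blast
  then have "\<not> x ^ Suc j dvd v" by (meson dvd_trans le_imp_power_dvd le_SucI order_refl)
  then have ex: "\<exists>k. \<exists>v\<in>V. \<not> x ^ Suc k dvd v" using assms(1) by blast
  have k: "\<exists>v\<in>V. \<not> x ^ Suc k dvd v" unfolding k_def using ex by (rule LeastI_ex)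
  have xk: "x ^ k dvd w" if "w \<in> V" for w
  proof (cases k)
    case (Suc k')
    then have "\<not> (\<exists>v\<in>V. \<not> x ^ Suc k' dvd v)" unfolding k_def by (intro not_less_Least) simp
    then show ?thesis using that Suc by auto
  qed simp
  define lead where "lead m w \<longleftrightarrow> (\<exists>u b. (u dvd 1) \<and> w = x ^ k * (u * y ^ m + x * b))" for m w
  have lead: "\<exists>m. lead m w" if w: "w \<in> V" "\<not> x ^ Suc k dvd w" for w
  proof -
    obtain c where c: "w = x ^ k * c" using xk[OF w(1)] by (auto simp: dvd_def)
    then have "\<not> x dvd c" using w(2) by (auto simp: mult.commute mult_dvd_mono)
    from leading_term[OF this] show ?thesis using c by (auto simp: lead_def)
  qed
  define m where "m = (LEAST m. \<exists>w\<in>V. \<not> x ^ Suc k dvd w \<and> lead m w)"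
  have "\<exists>m. \<exists>w\<in>V. \<not> x ^ Suc k dvd w \<and> lead m w" using k lead by blast
  then have "\<exists>w\<in>V. \<not> x ^ Suc k dvd w \<and> lead m w" unfolding m_def by (rule LeastI_ex)
  then obtain v0 where v0: "v0 \<in> V" "\<not> x ^ Suc k dvd v0" "lead m v0" by blast
  obtain u b where u: "(u dvd 1)" "v0 = x ^ k * (u * y ^ m + x * b)"
    using v0(3) by (auto simp: lead_def)
  have nd: "\<not> x dvd u * y ^ m + x * b"
  proof
    assume "x dvd u * y ^ m + x * b"
    then have "x ^ k * x dvd v0" using u(2) by (metis mult_dvd_mono dvd_refl)
    then show False using v0(2) by (simp add: mult.commute)
  qed
  have "\<exists>e. x ^ Suc k dvd w - e * v0" if w: "w \<in> V" for w
  proof (cases "x ^ Suc k dvd w")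
    case True
    then show ?thesis by (intro exI[of _ 0]) simp
  next
    case False
    then obtain n where n: "lead n w" using lead w by blast
    have "m \<le> n" unfolding m_def by (rule Least_le) (use w False n in blast)
    obtain u' b' where u': "w = x ^ k * (u' * y ^ n + x * b')" using n by (auto simp: lead_def)
    obtain i where i: "u * i = 1" using u(1) by (auto simp: dvd_def)
    have "w - u' * i * y ^ (n - m) * v0 = 
        x ^ k * (u' * y ^ n - (u * i) * u' * (y ^ (n - m) * y ^ m) + x * (b' - u' * i * y ^ (n - m) * b))"
      unfolding u' u(2) by (simp add: algebra_simps)
    also have "\<dots> = x ^ Suc k * (b' - u' * i * y ^ (n - m) * b)"
      using \<open>m \<le> n\<close> i by (simp add: power_add[symmetric])
    finally show ?thesis by (metis dvd_triv_left)
  qed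
  then show ?thesis using that[OF v0(1) u(2) nd xk] by blast
qed

lemma dvd_of_x_adic_approximation:
  assumes "\<not> x dvd c" and approx: "\<And>j. \<exists>e. x ^ (k + j) dvd h - e * (x ^ k * c)"
  shows "x ^ k * c dvd h"
proof -
  obtain e0 w0 where e0: "h - e0 * (x ^ k * c) = x ^ k * w0"
    using approx[of 0] by (auto simp: dvd_def)
  define h' where "h' = w0 + e0 * c"
  have h: "h = x ^ k * h'" using e0 unfolding h'_def by (simp add: algebra_simps)
  have "\<exists>u v. h' = c * u + x ^ j * v" for j
  proof -
    obtain e w where "h - e * (x ^ k * c) = x ^ (k + j) * w" using approx[of j] by (auto simp: dvd_def)
    then have "x ^ k * (h' - e * c) = x ^ k * (x ^ j * w)"
      unfolding h by (simp add: algebra_simps power_add)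
    then have "h' - e * c = x ^ j * w" using x_nonzero by simp
    then have "h' = c * e + x ^ j * w" by (simp add: algebra_simps)
    then show ?thesis by blast
  qed
  from x_adically_closed[OF assms(1) this] show ?thesis unfolding h by (simp add: mult_dvd_mono)
qed

lemma x_dvd_of_mult:
  assumes "v0 = x ^ k * c" "\<not> x dvd c" "x ^ Suc k dvd v0 * w"
  shows "x dvd w"
proof -
  obtain z where "x ^ k * (c * w) = x ^ k * (x * z)"
    using assms by (auto simp: dvd_def algebra_simps)
  then have "x dvd c * w" using x_nonzero by auto
  then show ?thesis using x_prime assms(2) by (simp add: prime_elem_dvd_mult_iff)
qed

text \<open>The pairs \<open>(w, d)\<close> with \<open>w a = d b\<close> form a module of rank one, and a pair \<open>(c0, d0)\<close> for which \<open>c0\<close>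
  has least leading term generates it: a multiple of the generator approximates any pair modulo \<open>x\<close>,
  the error divided by \<open>x\<close> is again in the module, and closedness turns the resulting approximations
  modulo all powers of \<open>x\<close> into an equality. The generator is the quotient of \<open>b\<close> by \<open>a\<close> in lowest
  terms.\<close>

lemma gcd_decomposition:
  fixes a b :: 'a
  assumes "a \<noteq> 0 \<or> b \<noteq> 0"
  obtains l a' b' where "a = l * a'" "b = l * b'" "regular_pair a' b'"
proof (cases "a = 0 \<or> b = 0")
  case True
  then show ?thesis
  proof
    assume "a = 0"
    then show ?thesis by (intro that[of b 0 1]) (auto simp: regular_pair_def)
  next
    assume "b = 0"
    then show ?thesis by (intro that[of a 1 0]) (auto simp: regular_pair_def)
  qed
next
  case False
  then have nz: "a \<noteq> 0" "b \<noteq> 0" by auto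
  define V where "V = {c. \<exists>d. c * a = d * b}"
  have "b \<in> V" by (auto simp: V_def mult.commute)
  then obtain c0 k c where c0: "c0 \<in> V" "c0 = x ^ k * c" "\<not> x dvd c"
    and xk: "\<And>w. w \<in> V \<Longrightarrow> x ^ k dvd w"
    and approx: "\<And>w. w \<in> V \<Longrightarrow> \<exists>e. x ^ Suc k dvd w - e * c0"
    using least_leading_term[of b V] nz by metis
  obtain d0 where d0: "c0 * a = d0 * b" using c0(1) by (auto simp: V_def)
  have c0nz: "c0 \<noteq> 0" using c0 x_nonzero by auto
  have step: "\<exists>e. \<exists>w'\<in>V. w - e * c0 = x * w'" if w: "w \<in> V" for w
  proof -
    obtain e z where e: "w - e * c0 = x ^ Suc k * z" using approx[OF w] by (auto simp: dvd_def)
    obtain d where d: "w * a = d * b" using w by (auto simp: V_def)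
    have "(c0 * d) * b = (w * d0) * b" using d d0 by (metis mult.assoc mult.commute)
    then have "c0 * d = w * d0" using nz by simp
    then have "c0 * (d - e * d0) = d0 * (x ^ Suc k * z)" using e by (simp add: algebra_simps)
    then have "x dvd d - e * d0"
      by (intro x_dvd_of_mult[OF c0(2,3)]) (metis dvd_triv_left dvd_mult)
    then obtain d' where d': "d - e * d0 = x * d'" by (auto simp: dvd_def)
    have "(w - e * c0) * a = (d - e * d0) * b" using d d0 by (simp add: algebra_simps)
    then have "x * ((x ^ k * z) * a) = x * (d' * b)" unfolding e d' by (simp add: algebra_simps)
    then have "(x ^ k * z) * a = d' * b" using x_nonzero by simp
    then have "x ^ k * z \<in> V" by (auto simp: V_def)
    moreover have "w - e * c0 = x * (x ^ k * z)" using e by simp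
    ultimately show ?thesis by blast
  qed
  have iter: "\<exists>e. \<exists>w'\<in>V. w - e * c0 = x ^ j * w'" if w: "w \<in> V" for w j
  proof (induction j)
    case 0
    show ?case using w by (intro exI[of _ 0]) auto
  next
    case (Suc j)
    then obtain e w' where e: "w' \<in> V" "w - e * c0 = x ^ j * w'" by blast
    obtain e' w'' where e': "w'' \<in> V" "w' - e' * c0 = x * w''" using step[OF e(1)] by blast
    have "w' = e' * c0 + x * w''" using e'(2) by (simp add: algebra_simps)
    then have "w - (e + x ^ j * e') * c0 = x ^ Suc j * w''" using e(2) by (simp add: algebra_simps)
    then show ?case using e'(1) by blast
  qed
  have dvd: "c0 dvd w" if w: "w \<in> V" for w
    unfolding c0(2)
  proof (rule dvd_of_x_adic_approximation[OF c0(3)])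
    fix j
    obtain e w' where e: "w' \<in> V" "w - e * c0 = x ^ j * w'" using iter[OF w] by blast
    have "x ^ (j + k) dvd x ^ j * w'" unfolding power_add using xk[OF e(1)] by (rule mult_dvd_mono[OF dvd_refl])
    then show "\<exists>e. x ^ (k + j) dvd w - e * (x ^ k * c)" using e(2) c0(2) by (metis add.commute)
  qed
  obtain l where l: "b = l * c0" using dvd[OF \<open>b \<in> V\<close>] by (auto simp: dvd_def mult.commute)
  have "c0 * a = c0 * (l * d0)" using d0 l by (simp add: algebra_simps)
  then have a: "a = l * d0" using c0nz by simp
  have "l \<noteq> 0" using l nz by auto
  have "regular_pair d0 c0"
    unfolding regular_pair_def
  proof (intro allI impI)
    fix w d
    assume eq: "w * d0 = d * c0"
    then have "w * a = d * b" unfolding a l by (metis mult.left_commute)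
    then have "c0 dvd w" by (intro dvd) (auto simp: V_def)
    then obtain e where e: "w = e * c0" by (auto simp: dvd_def mult.commute)
    then have "c0 * d = c0 * (e * d0)" using eq by (metis mult.assoc mult.commute)
    then have "d = e * d0" by (simp only: mult_left_cancel[OF c0nz])
    then show "\<exists>e. w = e * c0 \<and> d = e * d0" using e by blast
  qed
  then show ?thesis using that a l by blast
qed

lemma irreducible_imp_prime_elem:
  fixes t :: 'a
  assumes t: "irreducible t"
  shows "prime_elem t"
proof (rule prime_elemI)
  show "t \<noteq> 0" "\<not> (t dvd 1)" using t by (auto simp: irreducible_def)
next
  fix a b
  assume ab: "t dvd a * b"
  have "t \<noteq> 0" using t by auto
  then obtain l t' a' where l: "t = l * t'" "a = l * a'" and reg: "regular_pair t' a'"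
    using gcd_decomposition[of t a] by blast
  have "(l dvd 1) \<or> (t' dvd 1)" using t l(1) by (auto simp: irreducible_def)
  then show "t dvd a \<or> t dvd b"
  proof
    assume "(t' dvd 1)"
    then obtain i where "t' * i = 1" by (auto simp: dvd_def)
    then have "l = t * i" using l(1) by (simp add: mult.assoc)
    then have "t dvd l" by simp
    then show ?thesis using l(2) by (auto intro: dvd_mult2)
  next
    assume u: "(l dvd 1)"
    obtain c where "a * b = t * c" using ab by (auto simp: dvd_def)
    then have "l * (b * a') = l * (c * t')" using l by (simp add: algebra_simps)
    then have "c * t' = b * a'" using l(1) \<open>t \<noteq> 0\<close> by auto
    then have "t' dvd b" using regular_pairD[OF reg] by (metis dvd_triv_right)
    moreover obtain i where "l * i = 1" using u by (auto simp: dvd_def)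
    then have "t' = t * i" using l(1) by (simp add: algebra_simps)
    ultimately show ?thesis by (metis dvd_trans dvd_triv_left)
  qed
qed

text \<open>A factorization into the largest possible number of nonunits has irreducible factors.\<close>

lemma prime_factorization_exists:
  fixes w :: 'a
  assumes "w \<noteq> 0"
  obtains u ps where "(u dvd 1)" "\<forall>p\<in>set ps. prime_elem p" "w = u * prod_list ps"
proof -
  define nonunits where "nonunits ps \<longleftrightarrow> (\<forall>p\<in>set ps. \<not> (p dvd 1)) \<and> prod_list ps dvd w" for ps
  obtain n where n: "\<And>ps. nonunits ps \<Longrightarrow> length ps < n"
    using bounded_factorization[OF assms] by (auto simp: nonunits_def)
  have "nonunits []" by (simp add: nonunits_def)
  then obtain ps where ps: "nonunits ps" and max: "\<And>qs. nonunits qs \<Longrightarrow> length qs \<le> length ps"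
    using ex_has_greatest_nat[of nonunits "[]" length n] n by (metis less_imp_le)
  obtain u where u: "w = prod_list ps * u" using ps by (auto simp: nonunits_def dvd_def)
  have "(u dvd 1)"
  proof (rule ccontr)
    assume "\<not> (u dvd 1)"
    then have "nonunits (u # ps)" using ps u by (auto simp: nonunits_def mult.commute)
    then show False using max by fastforce
  qed
  moreover have "prime_elem p" if p: "p \<in> set ps" for p
  proof (rule irreducible_imp_prime_elem, rule irreducibleI)
    obtain xs ys where split: "ps = xs @ p # ys" using p by (meson split_list)
    show "p \<noteq> 0" using u assms p by (auto simp: prod_list_zero_iff)
    show "\<not> (p dvd 1)" using p ps by (auto simp: nonunits_def)
    fix a b
    assume ab: "p = a * b"
    show "(a dvd 1) \<or> (b dvd 1)"
    proof (rule ccontr)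
      assume "\<not> ((a dvd 1) \<or> (b dvd 1))"
      then have "nonunits (xs @ a # b # ys)"
        using ps unfolding nonunits_def split ab by (auto simp: mult.assoc)
      then show False using max split by fastforce
    qed
  qed
  ultimately show ?thesis using u that by (metis mult.commute)
qed

text \<open>The two syzygies are chosen so that the minor of their last two coordinates has least leading
  term among all such minors. For three syzygies Cramer's rule holds with these minors in the last
  two coordinates, and in the first one as well because \<open>g1\<close> is cancellable. It converts
  approximations of minors into an approximation of the syzygy modulo \<open>x\<close>, and the error divided by
  \<open>x\<close> is again a syzygy. Iteration and closedness then show that the minor divides the numerators in
  Cramer's rule.\<close>

lemma syzygies_basis:
  fixes g1 g2 g3 :: 'a
  assumes "g1 \<noteq> 0"
  obtains a1 b1 c1 a2 b2 c2 where
    "(a1, b1, c1) \<in> syzygies g1 g2 g3" "(a2, b2, c2) \<in> syzygies g1 g2 g3"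
    "b1 * c2 - c1 * b2 \<noteq> 0"
    "\<And>a b c. (a, b, c) \<in> syzygies g1 g2 g3 \<Longrightarrow>
       \<exists>e1 e2. a = e1 * a1 + e2 * a2 \<and> b = e1 * b1 + e2 * b2 \<and> c = e1 * c1 + e2 * c2"
proof -
  let ?Z = "syzygies g1 g2 g3"
  define V where "V = {b * c' - c * b' | a b c a' b' c'. (a, b, c) \<in> ?Z \<and> (a', b', c') \<in> ?Z}"
  \<comment> \<open>the minor of the Koszul syzygies \<open>(-g2, g1, 0)\<close> and \<open>(-g3, 0, g1)\<close>\<close>
  have "g1 * g1 - 0 * 0 \<in> V"
    unfolding V_def mem_Collect_eq
    by (rule exI[of _ "- g2"], rule exI[of _ g1], rule exI[of _ 0], rule exI[of _ "- g3"],
        rule exI[of _ 0], rule exI[of _ g1]) (simp add: algebra_simps)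
  moreover have "g1 * g1 - 0 * 0 \<noteq> 0" using assms by simp
  ultimately obtain D k d where D: "D \<in> V" "D = x ^ k * d" "\<not> x dvd d"
    and xk: "\<And>w. w \<in> V \<Longrightarrow> x ^ k dvd w"
    and approx: "\<And>w. w \<in> V \<Longrightarrow> \<exists>e. x ^ Suc k dvd w - e * D"
    using least_leading_term[of _ V] by metis
  from D(1) obtain a1 b1 c1 a2 b2 c2 where
    z1: "(a1, b1, c1) \<in> ?Z" and z2: "(a2, b2, c2) \<in> ?Z" and D_eq: "D = b1 * c2 - c1 * b2"
    unfolding V_def by blast
  have Dnz: "D \<noteq> 0" using D x_nonzero by auto
  have Vl: "b * c2 - c * b2 \<in> V" if "(a, b, c) \<in> ?Z" for a b c
    unfolding V_def using that z2 by blast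
  have Vr: "b1 * c - c1 * b \<in> V" if "(a, b, c) \<in> ?Z" for a b c
    unfolding V_def using that z1 by blast
  have cramer: "D * a = (b * c2 - c * b2) * a1 + (b1 * c - c1 * b) * a2"
      "D * b = (b * c2 - c * b2) * b1 + (b1 * c - c1 * b) * b2"
      "D * c = (b * c2 - c * b2) * c1 + (b1 * c - c1 * b) * c2"
    if z: "(a, b, c) \<in> ?Z" for a b c
  proof -
    show b: "D * b = (b * c2 - c * b2) * b1 + (b1 * c - c1 * b) * b2"
     and c: "D * c = (b * c2 - c * b2) * c1 + (b1 * c - c1 * b) * c2"
      unfolding D_eq by Groebner_Basis.algebra+
    have g: "a * g1 = - (b * g2 + c * g3)" "a1 * g1 = - (b1 * g2 + c1 * g3)"
       "a2 * g1 = - (b2 * g2 + c2 * g3)"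
      using z z1 z2 by (simp_all only: syzygies_iff eq_neg_iff_add_eq_0 add.assoc)
    have "g1 * (D * a) = D * (a * g1)" by (simp add: mult_ac)
    also have "\<dots> = - ((D * b) * g2 + (D * c) * g3)" unfolding g(1) by (simp add: algebra_simps)
    also have "\<dots> = (b * c2 - c * b2) * - (b1 * g2 + c1 * g3) + (b1 * c - c1 * b) * - (b2 * g2 + c2 * g3)"
      unfolding b c by (simp add: algebra_simps)
    also have "\<dots> = g1 * ((b * c2 - c * b2) * a1 + (b1 * c - c1 * b) * a2)"
      unfolding g(2,3)[symmetric] by (simp add: algebra_simps)
    finally have "g1 * (D * a) = g1 * ((b * c2 - c * b2) * a1 + (b1 * c - c1 * b) * a2)" .
    then show "D * a = (b * c2 - c * b2) * a1 + (b1 * c - c1 * b) * a2" using assms by simp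
  qed
  have step: "\<exists>e1 e2 a' b' c'. (a', b', c') \<in> ?Z \<and> a = e1 * a1 + e2 * a2 + x * a'
      \<and> b = e1 * b1 + e2 * b2 + x * b' \<and> c = e1 * c1 + e2 * c2 + x * c'"
    if z: "(a, b, c) \<in> ?Z" for a b c
  proof -
    obtain e1 where e1: "x ^ Suc k dvd (b * c2 - c * b2) - e1 * D" using approx[OF Vl[OF z]] by blast
    obtain e2 where e2: "x ^ Suc k dvd (b1 * c - c1 * b) - e2 * D" using approx[OF Vr[OF z]] by blast
    define r s t where "r = a - e1 * a1 - e2 * a2" "s = b - e1 * b1 - e2 * b2" "t = c - e1 * c1 - e2 * c2"
    have w: "(r, s, t) \<in> ?Z"
    proof -
      have "r * g1 + s * g2 + t * g3 = (a * g1 + b * g2 + c * g3) - e1 * (a1 * g1 + b1 * g2 + c1 * g3)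
          - e2 * (a2 * g1 + b2 * g2 + c2 * g3)"
        unfolding r_s_t_def by Groebner_Basis.algebra
      then show ?thesis using z z1 z2 by simp
    qed
    have "s * c2 - t * b2 = (b * c2 - c * b2) - e1 * D" "b1 * t - c1 * s = (b1 * c - c1 * b) - e2 * D"
      unfolding r_s_t_def D_eq by Groebner_Basis.algebra+
    then have "x ^ Suc k dvd s * c2 - t * b2" "x ^ Suc k dvd b1 * t - c1 * s" using e1 e2 by simp_all
    then have "x ^ Suc k dvd D * r" "x ^ Suc k dvd D * s" "x ^ Suc k dvd D * t"
      unfolding cramer[OF w] by (auto intro!: dvd_add dvd_mult2)
    then have "x dvd r" "x dvd s" "x dvd t" using x_dvd_of_mult[OF D(2,3)] by blast+
    then obtain r' s' t' where r': "r = x * r'" "s = x * s'" "t = x * t'" by (auto simp: dvd_def)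
    have "x * (r' * g1 + s' * g2 + t' * g3) = r * g1 + s * g2 + t * g3"
      unfolding r' by (simp add: algebra_simps)
    also have "\<dots> = 0" using w by simp
    finally have "(r', s', t') \<in> ?Z" using x_nonzero by simp
    moreover have "a = e1 * a1 + e2 * a2 + x * r'" "b = e1 * b1 + e2 * b2 + x * s'"
        "c = e1 * c1 + e2 * c2 + x * t'"
      using r' unfolding r_s_t_def by (simp_all add: algebra_simps)
    ultimately show ?thesis by blast
  qed
  have iter: "\<exists>e1 e2 a' b' c'. (a', b', c') \<in> ?Z \<and> a = e1 * a1 + e2 * a2 + x ^ j * a'
      \<and> b = e1 * b1 + e2 * b2 + x ^ j * b' \<and> c = e1 * c1 + e2 * c2 + x ^ j * c'"
    if z: "(a, b, c) \<in> ?Z" for a b c j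
  proof (induction j)
    case 0
    show ?case using z by (intro exI[of _ 0] exI[of _ a] exI[of _ b] exI[of _ c]) auto
  next
    case (Suc j)
    then obtain e1 e2 a' b' c' where 1: "(a', b', c') \<in> ?Z" "a = e1 * a1 + e2 * a2 + x ^ j * a'"
      "b = e1 * b1 + e2 * b2 + x ^ j * b'" "c = e1 * c1 + e2 * c2 + x ^ j * c'" by blast
    obtain f1 f2 a'' b'' c'' where 2: "(a'', b'', c'') \<in> ?Z" "a' = f1 * a1 + f2 * a2 + x * a''"
      "b' = f1 * b1 + f2 * b2 + x * b''" "c' = f1 * c1 + f2 * c2 + x * c''" using step[OF 1(1)] by blast
    show ?case
      by (rule exI[of _ "e1 + x ^ j * f1"], rule exI[of _ "e2 + x ^ j * f2"], rule exI[of _ a''],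
          rule exI[of _ b''], rule exI[of _ c''])
         (use 1 2 in \<open>simp add: algebra_simps\<close>)
  qed
  have span: "\<exists>e1 e2. a = e1 * a1 + e2 * a2 \<and> b = e1 * b1 + e2 * b2 \<and> c = e1 * c1 + e2 * c2"
    if z: "(a, b, c) \<in> ?Z" for a b c
  proof -
    have "D dvd b * c2 - c * b2"
      unfolding D(2)
    proof (rule dvd_of_x_adic_approximation[OF D(3)])
      fix j
      obtain e1 e2 a' b' c' where 1: "(a', b', c') \<in> ?Z" 
        "b = e1 * b1 + e2 * b2 + x ^ j * b'" "c = e1 * c1 + e2 * c2 + x ^ j * c'"
        using iter[OF z] by blast
      have "b * c2 - c * b2 - e1 * (x ^ k * d) = x ^ j * (b' * c2 - c' * b2)"
        unfolding D(2)[symmetric] D_eq 1(2,3) by Groebner_Basis.algebra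
      moreover have "x ^ (j + k) dvd x ^ j * (b' * c2 - c' * b2)"
        unfolding power_add using xk[OF Vl[OF 1(1)]] by (rule mult_dvd_mono[OF dvd_refl])
      ultimately show "\<exists>e. x ^ (k + j) dvd b * c2 - c * b2 - e * (x ^ k * d)" by (metis add.commute)
    qed
    moreover have "D dvd b1 * c - c1 * b"
      unfolding D(2)
    proof (rule dvd_of_x_adic_approximation[OF D(3)])
      fix j
      obtain e1 e2 a' b' c' where 1: "(a', b', c') \<in> ?Z" 
        "b = e1 * b1 + e2 * b2 + x ^ j * b'" "c = e1 * c1 + e2 * c2 + x ^ j * c'"
        using iter[OF z] by blast
      have "b1 * c - c1 * b - e2 * (x ^ k * d) = x ^ j * (b1 * c' - c1 * b')"
        unfolding D(2)[symmetric] D_eq 1(2,3) by Groebner_Basis.algebra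
      moreover have "x ^ (j + k) dvd x ^ j * (b1 * c' - c1 * b')"
        unfolding power_add using xk[OF Vr[OF 1(1)]] by (rule mult_dvd_mono[OF dvd_refl])
      ultimately show "\<exists>e. x ^ (k + j) dvd b1 * c - c1 * b - e * (x ^ k * d)" by (metis add.commute)
    qed
    ultimately obtain e1 e2 where e: "b * c2 - c * b2 = D * e1" "b1 * c - c1 * b = D * e2"
      by (auto simp: dvd_def)
    have "D * a = D * (e1 * a1 + e2 * a2)" "D * b = D * (e1 * b1 + e2 * b2)" "D * c = D * (e1 * c1 + e2 * c2)"
      unfolding cramer[OF z] e by (simp_all add: algebra_simps)
    then show ?thesis using Dnz by auto
  qed
  show ?thesis using that[OF z1 z2 _ span] Dnz D_eq by blast
qed

lemma regular_pairI:
  fixes a b :: 'a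
  assumes "a \<noteq> 0 \<or> b \<noteq> 0" and no_prime: "\<And>t. prime_elem t \<Longrightarrow> t dvd a \<Longrightarrow> t dvd b \<Longrightarrow> False"
  shows "regular_pair a b"
proof -
  obtain l a' b' where l: "a = l * a'" "b = l * b'" and reg: "regular_pair a' b'"
    using gcd_decomposition[OF assms(1)] by blast
  have "l \<noteq> 0" using l assms(1) by auto
  then obtain u ps where ps: "(u dvd 1)" "\<forall>p\<in>set ps. prime_elem p" "l = u * prod_list ps"
    using prime_factorization_exists by blast
  have "ps = []"
  proof (rule ccontr)
    assume "ps \<noteq> []"
    then obtain t qs where "ps = t # qs" by (cases ps) auto
    then show False using no_prime[of t] ps(2,3) l by simp
  qed
  then obtain i where i: "l * i = 1" using ps by (auto simp: dvd_def)
  show ?thesis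
    unfolding regular_pair_def
  proof (intro allI impI)
    fix c d
    assume "c * a = d * b"
    then have "l * (c * a') = l * (d * b')" unfolding l by (simp add: algebra_simps)
    then have "c * a' = d * b'" using \<open>l \<noteq> 0\<close> by simp
    then obtain e where e: "c = e * b'" "d = e * a'" using regular_pairD[OF reg] by blast
    have "c = (l * i) * c" "d = (l * i) * d" using i by simp_all
    then have "c = (e * i) * b \<and> d = (e * i) * a" unfolding e l by (simp add: algebra_simps)
    then show "\<exists>e. c = e * b \<and> d = e * a" by blast
  qed
qed

text \<open>Let \<open>d1\<close>, \<open>d2\<close>, \<open>d3\<close> be the entries of the cross product of the two basis vectors. They have no
  common prime factor, since modulo such a factor the basis vectors would be dependent, and a
  dependence modulo \<open>t\<close> can be divided by \<open>t\<close>. A common prime factor of the two values at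
  \<open>(1, \<xi>2, \<xi>3)\<close> divides the cross product of that vector with \<open>(d1, d2, d3)\<close>, in particular
  \<open>w = d2 - \<xi>2 d1\<close> and \<open>d3 - \<xi>3 d1\<close>. Prime avoidance excludes this: \<open>\<xi>2\<close> only has to make \<open>w\<close> nonzero,
  and \<open>\<xi>3\<close> is the product of the prime factors of \<open>w\<close> that do not divide \<open>d3\<close>.\<close>

lemma coprime_specialization:
  fixes g1 g2 g3 :: 'a
  assumes "g1 \<noteq> 0"
  obtains a1 b1 c1 a2 b2 c2 \<xi>2 \<xi>3 where
    "(a1, b1, c1) \<in> syzygies g1 g2 g3" "(a2, b2, c2) \<in> syzygies g1 g2 g3"
    "\<And>a b c. (a, b, c) \<in> syzygies g1 g2 g3 \<Longrightarrow>
       \<exists>e1 e2. a = e1 * a1 + e2 * a2 \<and> b = e1 * b1 + e2 * b2 \<and> c = e1 * c1 + e2 * c2"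
    "\<And>t. prime_elem t \<Longrightarrow> t dvd a1 + b1 * \<xi>2 + c1 * \<xi>3 \<Longrightarrow> t dvd a2 + b2 * \<xi>2 + c2 * \<xi>3 \<Longrightarrow> False"
    "a1 + b1 * \<xi>2 + c1 * \<xi>3 \<noteq> 0 \<or> a2 + b2 * \<xi>2 + c2 * \<xi>3 \<noteq> 0"
proof -
  let ?Z = "syzygies g1 g2 g3"
  obtain a1 b1 c1 a2 b2 c2 where z1: "(a1, b1, c1) \<in> ?Z" and z2: "(a2, b2, c2) \<in> ?Z"
    and D: "b1 * c2 - c1 * b2 \<noteq> 0" and span: "\<And>a b c. (a, b, c) \<in> ?Z \<Longrightarrow>
       \<exists>e1 e2. a = e1 * a1 + e2 * a2 \<and> b = e1 * b1 + e2 * b2 \<and> c = e1 * c1 + e2 * c2"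
    by (rule syzygies_basis[OF assms, where ?g2.0=g2 and ?g3.0=g3]) (rule that, assumption+)
  define d1 d2 d3 where "d1 = b1 * c2 - c1 * b2" "d2 = c1 * a2 - a1 * c2" "d3 = a1 * b2 - b1 * a2"
  note d_defs = d1_d2_d3_def
  \<comment> \<open>a combination of the basis divisible by \<open>t\<close> has coefficients divisible by \<open>t\<close>: its quotient by \<open>t\<close> is a syzygy\<close>
  have coeffs_dvd: "t dvd r \<and> t dvd s"
    if t: "t \<noteq> 0" and dvd: "t dvd r * a1 + s * a2" "t dvd r * b1 + s * b2" "t dvd r * c1 + s * c2"
    for t r s
  proof -
    obtain a b c where abc: "r * a1 + s * a2 = t * a" "r * b1 + s * b2 = t * b" "r * c1 + s * c2 = t * c"
      using dvd by (auto simp: dvd_def)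
    have "t * (a * g1 + b * g2 + c * g3) = (r * a1 + s * a2) * g1 + (r * b1 + s * b2) * g2 + (r * c1 + s * c2) * g3"
      unfolding abc by (simp add: algebra_simps)
    also have "\<dots> = r * (a1 * g1 + b1 * g2 + c1 * g3) + s * (a2 * g1 + b2 * g2 + c2 * g3)"
      by (simp add: algebra_simps)
    also have "\<dots> = 0" using z1 z2 by simp
    finally have "(a, b, c) \<in> ?Z" using t by simp
    then obtain e1 e2 where e: "b = e1 * b1 + e2 * b2" "c = e1 * c1 + e2 * c2" using span by blast
    have "d1 * r = c2 * (r * b1 + s * b2) - b2 * (r * c1 + s * c2)"
      "d1 * s = b1 * (r * c1 + s * c2) - c1 * (r * b1 + s * b2)"
      unfolding d_defs by Groebner_Basis.algebra+
    then have "d1 * r = d1 * (t * e1)" "d1 * s = d1 * (t * e2)"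
      unfolding abc e d_defs by (simp_all add: algebra_simps)
    then have "r = t * e1" "s = t * e2" using D unfolding d_defs by auto
    then show ?thesis by simp
  qed
  have primitive: False if t: "prime_elem t" and d: "t dvd d1" "t dvd d2" "t dvd d3" for t
  proof -
    have tnz: "t \<noteq> 0" using t by auto
    have eqs: "c2 * a1 + (- c1) * a2 = - d2" "c2 * b1 + (- c1) * b2 = d1" "c2 * c1 + (- c1) * c2 = 0"
      "b2 * a1 + (- b1) * a2 = d3" "b2 * b1 + (- b1) * b2 = 0" "b2 * c1 + (- b1) * c2 = - d1"
      "a2 * a1 + (- a1) * a2 = 0" "a2 * b1 + (- a1) * b2 = - d3" "a2 * c1 + (- a1) * c2 = d2"
      unfolding d_defs by (simp_all add: algebra_simps)
    have "t dvd c2 \<and> t dvd - c1" by (intro coeffs_dvd[OF tnz]; unfold eqs) (use d in auto)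
    moreover have "t dvd b2 \<and> t dvd - b1" by (intro coeffs_dvd[OF tnz]; unfold eqs) (use d in auto)
    moreover have "t dvd a2 \<and> t dvd - a1" by (intro coeffs_dvd[OF tnz]; unfold eqs) (use d in auto)
    ultimately have "t dvd 1 \<and> t dvd (0::'a)" by (intro coeffs_dvd[OF tnz]) auto
    then show False using prime_elem_not_unit[OF t] by simp
  qed
  define \<xi>2 :: 'a where "\<xi>2 = (if d2 = 0 then 1 else 0)"
  define w where "w = d2 - \<xi>2 * d1"
  have "w \<noteq> 0" using D unfolding w_def \<xi>2_def d_defs(1) by auto
  then obtain u ps where u: "(u dvd 1)" and ps: "\<forall>p\<in>set ps. prime_elem p" and w: "w = u * prod_list ps"
    using prime_factorization_exists by blast
  define \<xi>3 where "\<xi>3 = prod_list (filter (\<lambda>p. \<not> p dvd d3) ps)"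
  define l1 l2 where "l1 = a1 + b1 * \<xi>2 + c1 * \<xi>3" "l2 = a2 + b2 * \<xi>2 + c2 * \<xi>3"
  have w_eq: "w = c1 * l2 - c2 * l1" and w'_eq: "d3 - \<xi>3 * d1 = b2 * l1 - b1 * l2"
    unfolding w_def d_defs l1_l2_def by Groebner_Basis.algebra+
  have no_prime: False if t: "prime_elem t" and dvd: "t dvd l1" "t dvd l2" for t
  proof -
    have tw: "t dvd w" unfolding w_eq using dvd by (auto intro!: dvd_diff dvd_mult)
    have tw': "t dvd d3 - \<xi>3 * d1" unfolding w'_eq using dvd by (auto intro!: dvd_diff dvd_mult)
    have nu: "\<not> t dvd u" using u t by (meson dvd_trans prime_elem_not_unit)
    have "t dvd prod_list ps" using tw w nu t by (simp add: prime_elem_dvd_mult_iff)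
    have \<xi>3_dvd: "\<not> t dvd d3" if "t dvd \<xi>3"
    proof -
      from that obtain p where p: "p \<in> set ps" "\<not> p dvd d3" "t dvd p"
        using prime_elem_dvd_prod_list[OF t] unfolding \<xi>3_def by fastforce
      obtain q where q: "p = t * q" using p(3) by (auto simp: dvd_def)
      have pp: "prime_elem p" using ps p(1) by simp
      have "p dvd t"
      proof (rule ccontr)
        assume "\<not> p dvd t"
        then have "p dvd q" using prime_elem_dvd_multD[OF pp, of t q] q by auto
        then obtain k where k: "q = p * k" by (auto simp: dvd_def)
        then have "p * 1 = p * (t * k)" using q by (metis mult.left_commute mult.right_neutral)
        moreover have "p \<noteq> 0" using pp by auto
        ultimately have "1 = t * k" by (simp only: mult_left_cancel[of p] simp_thms)
        then show False using prime_elem_not_unit[OF t] by (metis dvd_triv_left)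
      qed
      then show ?thesis using p(2) by (meson dvd_trans)
    qed
    show False
    proof (cases "t dvd d3")
      case True
      then have "t dvd \<xi>3 * d1" using tw' by (metis dvd_diffD1 dvd_diff_right_iff)
      then have "t dvd d1" using \<xi>3_dvd True t by (auto simp: prime_elem_dvd_mult_iff)
      moreover from this have "t dvd d2" using tw unfolding w_def by (metis diff_add_cancel dvd_add dvd_mult)
      ultimately show False using primitive t True by blast
    next
      case False
      obtain p where p: "p \<in> set ps" "t dvd p"
        using prime_elem_dvd_prod_list[OF t \<open>t dvd prod_list ps\<close>] by blast
      then have "\<not> p dvd d3" using False by (meson dvd_trans)
      then have "p dvd \<xi>3" unfolding \<xi>3_def using p(1) by (auto intro: prod_list_dvd)
      then have "t dvd \<xi>3" using p(2) by (rule dvd_trans[rotated])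
      then have "t dvd d3" using tw' by (metis diff_add_cancel dvd_add dvd_mult2)
      then show False using False by simp
    qed
  qed
  have "l1 \<noteq> 0 \<or> l2 \<noteq> 0" using \<open>w \<noteq> 0\<close> unfolding w_eq by auto
  then show ?thesis using that[OF z1 z2 span, of \<xi>2 \<xi>3] no_prime unfolding l1_l2_def by blast
qed

text \<open>The triples \<open>p\<close>, \<open>q\<close>, \<open>p'\<close>, \<open>q'\<close> are the coefficients of linear forms \<open>P1\<close>, \<open>Q1\<close>, \<open>P2\<close>, \<open>Q2\<close> with \<open>L1 = x P1 + y Q1\<close> and
  \<open>L2 = x P2 + y Q2\<close> for a basis \<open>L1\<close>, \<open>L2\<close> of the syzygies. If the value of \<open>\<Delta> = P1 Q2 - P2 Q1\<close> at the
  chosen point were \<open>e1 l1 + e2 l2\<close>, then \<open>x \<Delta> = Q2 l1 - Q1 l2\<close> would give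
  \<open>(Q2 - x e1) l1 = (Q1 + x e2) l2\<close>. As \<open>l1\<close>, \<open>l2\<close> is a regular pair, both factors are multiples of \<open>l2\<close>
  and \<open>l1\<close> by the same element \<open>e\<close>, and modulo \<open>x\<close> this reads \<open>(1 - e y) Q1 = 0 = (1 - e y) Q2\<close>. Since
  \<open>1 - e y\<close> is a unit, \<open>x\<close> divides \<open>Q1\<close>, \<open>Q2\<close> and hence \<open>l1\<close>, \<open>l2\<close>, which have no common prime factor.\<close>

lemma quadratic_relation_outside_linear:
  fixes g1 g2 g3 :: 'a
  assumes "g1 \<noteq> 0"
    and nonunits: "\<And>a b c. (a, b, c) \<in> syzygies g1 g2 g3 \<Longrightarrow> \<not> (a dvd 1) \<and> \<not> (b dvd 1) \<and> \<not> (c dvd 1)"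
  obtains p q p' q' \<xi>2 \<xi>3 where
    "dot3 p (g1, g2, g3) * dot3 q' (g1, g2, g3) = dot3 p' (g1, g2, g3) * dot3 q (g1, g2, g3)"
    "\<And>z. z \<in> syzygies g1 g2 g3 \<Longrightarrow>
       dot3 p (1, \<xi>2, \<xi>3) * dot3 q' (1, \<xi>2, \<xi>3) - dot3 p' (1, \<xi>2, \<xi>3) * dot3 q (1, \<xi>2, \<xi>3) \<noteq> dot3 z (1, \<xi>2, \<xi>3)"
proof -
  let ?Z = "syzygies g1 g2 g3"
  obtain a1 b1 c1 a2 b2 c2 \<xi>2 \<xi>3 where z1: "(a1, b1, c1) \<in> ?Z" and z2: "(a2, b2, c2) \<in> ?Z"
    and span: "\<And>a b c. (a, b, c) \<in> ?Z \<Longrightarrow>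
       \<exists>e1 e2. a = e1 * a1 + e2 * a2 \<and> b = e1 * b1 + e2 * b2 \<and> c = e1 * c1 + e2 * c2"
    and no_prime: "\<And>t. prime_elem t \<Longrightarrow> t dvd a1 + b1 * \<xi>2 + c1 * \<xi>3 \<Longrightarrow>
        t dvd a2 + b2 * \<xi>2 + c2 * \<xi>3 \<Longrightarrow> False"
    and l_nz: "a1 + b1 * \<xi>2 + c1 * \<xi>3 \<noteq> 0 \<or> a2 + b2 * \<xi>2 + c2 * \<xi>3 \<noteq> 0"
    by (rule coprime_specialization[OF assms(1), where ?g2.0=g2 and ?g3.0=g3]) (rule that, assumption+)
  obtain pa qa pb qb pc qc where 1: "a1 = x * pa + y * qa" "b1 = x * pb + y * qb" "c1 = x * pc + y * qc"
    using nonunits[OF z1] by (auto simp: nonunit_iff)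
  obtain pa' qa' pb' qb' pc' qc' where 2: "a2 = x * pa' + y * qa'" "b2 = x * pb' + y * qb'" "c2 = x * pc' + y * qc'"
    using nonunits[OF z2] by (auto simp: nonunit_iff)
  let ?p = "(pa, pb, pc)" and ?q = "(qa, qb, qc)" and ?p' = "(pa', pb', pc')" and ?q' = "(qa', qb', qc')"
  let ?D = "\<lambda>X. dot3 ?p X * dot3 ?q' X - dot3 ?p' X * dot3 ?q X"
  have L1: "dot3 (a1, b1, c1) (r, s, t) = x * dot3 ?p (r, s, t) + y * dot3 ?q (r, s, t)"
    and L2: "dot3 (a2, b2, c2) (r, s, t) = x * dot3 ?p' (r, s, t) + y * dot3 ?q' (r, s, t)" for r s t
    unfolding 1 2 by (simp_all add: algebra_simps)
  have xD: "x * ?D (r, s, t) = dot3 ?q' (r, s, t) * dot3 (a1, b1, c1) (r, s, t)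
      - dot3 ?q (r, s, t) * dot3 (a2, b2, c2) (r, s, t)" for r s t
    unfolding L1 L2 by Groebner_Basis.algebra
  have "x * ?D (g1, g2, g3) = 0" unfolding xD using z1 z2 by simp
  then have Dg: "?D (g1, g2, g3) = 0" using x_nonzero by simp
  define \<xi> :: "'a \<times> 'a \<times> 'a" where "\<xi> = (1, \<xi>2, \<xi>3)"
  define l1 l2 where "l1 = dot3 (a1, b1, c1) \<xi>" "l2 = dot3 (a2, b2, c2) \<xi>"
  have l_eq: "l1 = a1 + b1 * \<xi>2 + c1 * \<xi>3" "l2 = a2 + b2 * \<xi>2 + c2 * \<xi>3"
    by (simp_all add: l1_l2_def \<xi>_def)
  have reg: "regular_pair l1 l2"
    unfolding l_eq by (rule regular_pairI[OF l_nz no_prime])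
  have ne: "?D \<xi> \<noteq> dot3 z \<xi>" if z: "z \<in> ?Z" for z
  proof
    assume eq: "?D \<xi> = dot3 z \<xi>"
    obtain a b c where abc: "z = (a, b, c)" by (cases z)
    obtain e1 e2 where e: "a = e1 * a1 + e2 * a2" "b = e1 * b1 + e2 * b2" "c = e1 * c1 + e2 * c2"
      using span z unfolding abc by blast
    have "dot3 z \<xi> = e1 * l1 + e2 * l2"
      unfolding l1_l2_def abc e \<xi>_def by (simp add: algebra_simps)
    then have Dz: "?D \<xi> = e1 * l1 + e2 * l2" using eq by (rule trans[rotated])
    have xD\<xi>: "x * ?D \<xi> = dot3 ?q' \<xi> * l1 - dot3 ?q \<xi> * l2"
      unfolding l1_l2_def \<xi>_def by (rule xD)
    have "(dot3 ?q' \<xi> - x * e1) * l1 = (dot3 ?q \<xi> + x * e2) * l2"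
      using xD\<xi> unfolding Dz by (simp only: distrib_left left_diff_distrib distrib_right mult.assoc) (simp add: algebra_simps)
    then obtain e where e: "dot3 ?q' \<xi> - x * e1 = e * l2" "dot3 ?q \<xi> + x * e2 = e * l1"
      using regular_pairD[OF reg] by blast
    have l: "l1 = x * dot3 ?p \<xi> + y * dot3 ?q \<xi>" "l2 = x * dot3 ?p' \<xi> + y * dot3 ?q' \<xi>"
      unfolding l1_l2_def \<xi>_def by (rule L1 L2)+
    have nd: "\<not> x dvd 1 - e * y"
    proof
      assume "x dvd 1 - e * y"
      then obtain r where "1 - e * y = x * r" by (auto simp: dvd_def)
      then have "1 = x * r + y * e" by (simp add: algebra_simps)
      then show False using nonunit_iff[of 1] by auto
    qed
    have "(1 - e * y) * Q = (Q + x * r) - e * (x * P + y * Q) + x * (e * P - r)" for P Q r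
      by (simp add: algebra_simps)
    from this[of "dot3 ?q \<xi>" e2 "dot3 ?p \<xi>"]
    have "(1 - e * y) * dot3 ?q \<xi> = x * (e * dot3 ?p \<xi> - e2)" unfolding e(2) l(1)[symmetric] by simp
    then have xq: "x dvd dot3 ?q \<xi>" using nd x_prime by (metis dvd_triv_left prime_elem_dvd_mult_iff)
    have "(1 - e * y) * Q = (Q - x * r) - e * (x * P + y * Q) + x * (e * P + r)" for P Q r
      by (simp add: algebra_simps)
    from this[of "dot3 ?q' \<xi>" e1 "dot3 ?p' \<xi>"]
    have "(1 - e * y) * dot3 ?q' \<xi> = x * (e * dot3 ?p' \<xi> + e1)" unfolding e(1) l(2)[symmetric] by simp
    then have xq': "x dvd dot3 ?q' \<xi>" using nd x_prime by (metis dvd_triv_left prime_elem_dvd_mult_iff)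
    have "x dvd l1" "x dvd l2" unfolding l using xq xq' by auto
    then show False using no_prime[OF x_prime] unfolding l1_l2_def \<xi>_def by simp
  qed
  show ?thesis
    by (rule that[of ?p ?q' ?p' ?q \<xi>2 \<xi>3])
      (use Dg in simp, rule ne[unfolded \<xi>_def])
qed

end

text \<open>Since \<open>b\<close> divides all terms but the leading one, it divides \<open>c n\<close>, say \<open>c n = e b\<close>. Replacing the
  leading term by means of the linear relation \<open>b U - a V\<close> leaves \<open>V\<close> times a form of degree \<open>n - 1\<close>
  that again vanishes at \<open>(a, b)\<close>. The coefficients are embedded by \<open>\<kappa>\<close>, and \<open>K\<close> is only required
  to absorb products with \<open>T\<close>, because the lemma is applied to an ideal of a subring of a ring of
  polynomials.\<close>

lemma form_in_linear_ideal:
  fixes a b :: "'a::idom" and U V :: "'b::comm_ring_1"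
  assumes reg: "regular_pair a b" and "b \<noteq> 0"
    and hom: "\<And>c d. \<kappa> (c + d) = \<kappa> c + \<kappa> d" "\<And>c d. \<kappa> (c * d) = \<kappa> c * \<kappa> d"
    and T: "\<And>c. \<kappa> c \<in> T" "U \<in> T" "V \<in> T" "1 \<in> T" "\<And>s t. s \<in> T \<Longrightarrow> t \<in> T \<Longrightarrow> s * t \<in> T"
    and K: "\<And>s t. s \<in> K \<Longrightarrow> t \<in> K \<Longrightarrow> s + t \<in> K" "\<And>s t. s \<in> T \<Longrightarrow> t \<in> K \<Longrightarrow> s * t \<in> K"
    and lin: "\<And>c d. c * a + d * b = 0 \<Longrightarrow> \<kappa> c * U + \<kappa> d * V \<in> K"
    and "(\<Sum>i\<le>n. c i * a ^ i * b ^ (n - i)) = 0"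
  shows "(\<Sum>i\<le>n. \<kappa> (c i) * U ^ i * V ^ (n - i)) \<in> K"
  using assms(13)
proof (induction n arbitrary: c)
  case 0
  have "\<kappa> 0 * U + \<kappa> 0 * V \<in> K" by (rule lin) simp
  moreover have "\<kappa> 0 = 0" using hom(1)[of 0 0] by simp
  ultimately show ?case using 0 by simp
next
  case (Suc n)
  have Tpow: "U ^ k \<in> T" for k by (induction k) (use T in auto)
  have shift: "(\<Sum>i\<le>n. f i * B ^ (Suc n - i)) = B * (\<Sum>i\<le>n. f i * B ^ (n - i))"
    for f :: "nat \<Rightarrow> 'c::comm_ring_1" and B
    unfolding sum_distrib_left by (intro sum.cong) (auto simp: Suc_diff_le algebra_simps)
  have eq: "b * (\<Sum>i\<le>n. c i * a ^ i * b ^ (n - i)) + c (Suc n) * a ^ Suc n = 0"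
    using Suc.prems shift[of "\<lambda>i. c i * a ^ i" b] by simp
  then have "c (Suc n) * a ^ Suc n = b * - (\<Sum>i\<le>n. c i * a ^ i * b ^ (n - i))"
    by (simp add: add_eq_0_iff)
  then have "b dvd c (Suc n) * a ^ Suc n" by simp
  then have "b dvd c (Suc n)" by (rule regular_pair_dvd_power[OF reg])
  then obtain e where e: "c (Suc n) = e * b" by (auto simp: dvd_def mult.commute)
  \<comment> \<open>the coefficients that remain after replacing \<open>e b U\<close> in the leading term by \<open>e a V\<close>\<close>
  define c' where "c' = c(n := c n + e * a)"
  have split: "(\<Sum>i\<le>n. f (c' i) i) = (\<Sum>i\<le>n. f (c i) i) + (f (c n + e * a) n - f (c n) n)"
    for f :: "'a \<Rightarrow> nat \<Rightarrow> 'c::comm_ring_1"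
  proof -
    have "(\<Sum>i\<le>n. f (c' i) i) = (\<Sum>i\<in>{..<n}. f (c' i) i) + f (c' n) n"
      "(\<Sum>i\<le>n. f (c i) i) = (\<Sum>i\<in>{..<n}. f (c i) i) + f (c n) n"
      by (simp_all add: lessThan_Suc_atMost[symmetric])
    moreover have "(\<Sum>i\<in>{..<n}. f (c' i) i) = (\<Sum>i\<in>{..<n}. f (c i) i)"
      by (intro sum.cong) (auto simp: c'_def)
    ultimately show ?thesis by (simp add: c'_def)
  qed
  have "b * (\<Sum>i\<le>n. c' i * a ^ i * b ^ (n - i)) = 0"
    using eq unfolding split[of "\<lambda>r i. r * a ^ i * b ^ (n - i)"] e by (simp add: algebra_simps)
  then have "(\<Sum>i\<le>n. c' i * a ^ i * b ^ (n - i)) = 0" using \<open>b \<noteq> 0\<close> by simp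
  then have IH: "(\<Sum>i\<le>n. \<kappa> (c' i) * U ^ i * V ^ (n - i)) \<in> K" by (rule Suc.IH)
  have neg: "\<kappa> (- r) = - \<kappa> r" for r
    using hom(1)[of r "- r"] hom(1)[of 0 0] by (simp add: add_eq_0_iff)
  have "\<kappa> b * U + \<kappa> (- a) * V \<in> K" by (rule lin) (simp add: algebra_simps)
  then have "(\<kappa> e * U ^ n) * (\<kappa> b * U + \<kappa> (- a) * V) + V * (\<Sum>i\<le>n. \<kappa> (c' i) * U ^ i * V ^ (n - i)) \<in> K"
    using IH T Tpow K by simp
  also have "(\<kappa> e * U ^ n) * (\<kappa> b * U + \<kappa> (- a) * V) + V * (\<Sum>i\<le>n. \<kappa> (c' i) * U ^ i * V ^ (n - i))
     = (\<Sum>i\<le>Suc n. \<kappa> (c i) * U ^ i * V ^ (Suc n - i))"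
    using shift[of "\<lambda>i. \<kappa> (c i) * U ^ i" V]
    unfolding split[of "\<lambda>r i. \<kappa> r * U ^ i * V ^ (n - i)"] by (simp add: e hom neg algebra_simps)
  finally show ?case .
qed

section \<open>Functions on a bidisc and Weierstrass division\<close>

lemma continuous_on_compose_pair:
  assumes "continuous_on T (\<lambda>(a, b). f a b)" "continuous_on S p" "continuous_on S q"
    and "\<And>x. x \<in> S \<Longrightarrow> (p x, q x) \<in> T"
  shows "continuous_on S (\<lambda>x. f (p x) (q x))"
proof -
  have "continuous_on S (\<lambda>x. case (p x, q x) of (a, b) \<Rightarrow> f a b)"
    by (rule continuous_on_compose2[OF assms(1) continuous_on_Pair[OF assms(2,3)]]) (use assms(4) in auto)
  then show ?thesis by simp
qed

lemma contour_integral_circlepath_eq_integral: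
  "contour_integral (circlepath z r) f =
     integral (cbox 0 1) (\<lambda>t. f (circlepath z r t) * (2 * pi * \<i> * r * exp (2 * of_real pi * \<i> * t)))"
  by (simp add: contour_integral_integral vector_derivative_circlepath)

lemma circlepath_in_sphere: "0 < r \<Longrightarrow> circlepath z r t \<in> sphere z r"
  by (simp add: circlepath dist_norm norm_mult)

lemma continuous_on_circlepath_compose:
  fixes K :: "'p::topological_space \<Rightarrow> complex \<Rightarrow> complex"
  assumes "0 < r" "continuous_on (S \<times> sphere z r) (\<lambda>(p, w). K p w)"
  shows "continuous_on (S \<times> cbox 0 1) (\<lambda>(p, t).
     K p (circlepath z r t) * (2 * pi * \<i> * r * exp (2 * of_real pi * \<i> * of_real t)))"
proof -
  have "continuous_on (S \<times> cbox 0 (1::real)) (\<lambda>q. circlepath z r (snd q))"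
    unfolding circlepath by (intro continuous_intros)
  then have "continuous_on (S \<times> cbox 0 1) (\<lambda>q. K (fst q) (circlepath z r (snd q)))"
    by (rule continuous_on_compose_pair[OF assms(2) continuous_on_fst[OF continuous_on_id]])
       (use circlepath_in_sphere[OF assms(1)] in auto)
  then show ?thesis unfolding case_prod_unfold fst_conv snd_conv by (intro continuous_intros)
qed

lemma continuous_on_contour_integral_circlepath:
  fixes K :: "'p::topological_space \<Rightarrow> complex \<Rightarrow> complex"
  assumes "0 < r" "continuous_on (S \<times> sphere z r) (\<lambda>(p, w). K p w)"
  shows "continuous_on S (\<lambda>p. contour_integral (circlepath z r) (K p))"
  unfolding contour_integral_circlepath_eq_integral
  using continuous_on_circlepath_compose[OF assms] by (rule integral_continuous_on_param)

text \<open>Cauchy's formula writes the derivative as an integral of \<open>K\<close>, which depends continuously on the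
  parameters.\<close>

lemma continuous_on_deriv_parameter:
  fixes K :: "complex \<Rightarrow> 'p::metric_space \<Rightarrow> complex"
  assumes V: "open V" and cont: "continuous_on (V \<times> M) (\<lambda>(v, p). K v p)"
    and hol: "\<And>p. p \<in> M \<Longrightarrow> (\<lambda>v. K v p) holomorphic_on V"
  shows "continuous_on (V \<times> M) (\<lambda>(v, p). deriv (\<lambda>v. K v p) v)"
  unfolding continuous_on_eq_continuous_within
proof safe
  fix v0 p0
  assume v0: "v0 \<in> V" and p0: "p0 \<in> M"
  obtain d where d: "d > 0" "cball v0 d \<subseteq> V" using V v0 open_contains_cball by blast
  define I where "I v p = 1 / (2 * of_real pi * \<i>) * contour_integral (circlepath v0 d) (\<lambda>s. K s p / (s - v)^2)"
    for v p
  have eq: "deriv (\<lambda>v. K v p) v = I v p" if "v \<in> ball v0 d" "p \<in> M" for v p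
  proof (rule DERIV_imp_deriv, unfold I_def, rule Cauchy_derivative_integral_circlepath)
    show "continuous_on (cball v0 d) (\<lambda>v. K v p)"
      using hol[OF that(2)] d(2) by (meson holomorphic_on_imp_continuous_on continuous_on_subset)
    show "(\<lambda>v. K v p) holomorphic_on ball v0 d"
      using hol[OF that(2)] d(2) ball_subset_cball by (meson holomorphic_on_subset order_trans)
  qed (rule that)
  have "continuous_on ((ball v0 d \<times> M) \<times> sphere v0 d) (\<lambda>q. K (snd q) (snd (fst q)))"
    by (rule continuous_on_compose_pair[OF cont]) (use d(2) in \<open>auto intro!: continuous_intros\<close>)
  then have "continuous_on ((ball v0 d \<times> M) \<times> sphere v0 d)
      (\<lambda>(q, s). K s (snd q) / (s - fst q)^2)"
    unfolding case_prod_unfold by (intro continuous_intros) (auto simp: dist_norm)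
  from continuous_on_contour_integral_circlepath[OF d(1) this]
  have "continuous_on (ball v0 d \<times> M) (\<lambda>q. I (fst q) (snd q))"
    unfolding I_def by (intro continuous_intros)
  then have "continuous_on (ball v0 d \<times> M) (\<lambda>q. deriv (\<lambda>v. K v (snd q)) (fst q))"
    by (rule continuous_on_eq) (auto simp: eq)
  then have "continuous (at (v0, p0) within ball v0 d \<times> M) (\<lambda>(v, p). deriv (\<lambda>v. K v p) v)"
    using p0 d(1) by (auto simp: continuous_on_eq_continuous_within case_prod_unfold)
  moreover have "at (v0, p0) within ball v0 d \<times> M = at (v0, p0) within V \<times> M"
    by (rule at_within_nhd[of _ "ball v0 d \<times> UNIV"]) (use d in \<open>auto simp: open_Times dist_norm subset_iff\<close>)
  ultimately show "continuous (at (v0, p0) within V \<times> M) (\<lambda>(v, p). deriv (\<lambda>v. K v p) v)" by simp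
qed

lemma holomorphic_on_contour_integral_circlepath:
  fixes K :: "complex \<Rightarrow> complex \<Rightarrow> complex"
  assumes r: "0 < r" and V: "open V" and cont: "continuous_on (V \<times> sphere z r) (\<lambda>(v, w). K v w)"
    and hol: "\<And>w. w \<in> sphere z r \<Longrightarrow> (\<lambda>v. K v w) holomorphic_on V"
  shows "(\<lambda>v. contour_integral (circlepath z r) (K v)) holomorphic_on V"
proof -
  define c :: "real \<Rightarrow> complex" where "c t = 2 * pi * \<i> * r * exp (2 * of_real pi * \<i> * t)" for t
  define L where "L v t = K v (circlepath z r t) * c t" for v t
  define L' where "L' v t = deriv (\<lambda>v. K v (circlepath z r t)) v * c t" for v t
  have contL: "continuous_on (V \<times> cbox 0 1) (\<lambda>(v, t). L v t)"
    unfolding L_def c_def by (rule continuous_on_circlepath_compose[OF r cont])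
  have int: "L v integrable_on cbox 0 1" if "v \<in> V" for v
  proof (rule integrable_continuous)
    have "continuous_on (cbox 0 1) (\<lambda>t. case (v, t) of (v, t) \<Rightarrow> L v t)"
      by (rule continuous_on_compose2[OF contL]) (use that in \<open>auto intro!: continuous_intros\<close>)
    then show "continuous_on (cbox 0 1) (L v)" by simp
  qed
  have cont': "continuous_on (V \<times> cbox 0 1) (\<lambda>(v, t). L' v t)"
    unfolding L'_def c_def
    by (rule continuous_on_circlepath_compose[OF r continuous_on_deriv_parameter[OF V cont hol]])
  show ?thesis
    unfolding holomorphic_on_open[OF V]
  proof
    fix v0
    assume "v0 \<in> V"
    then obtain d where d: "d > 0" "ball v0 d \<subseteq> V" using V open_contains_ball by blast
    have "((\<lambda>v. integral (cbox 0 1) (L v)) has_field_derivative integral (cbox 0 1) (L' v0)) (at v0 within ball v0 d)"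
    proof (rule leibniz_rule_field_derivative)
      fix v and t :: real
      assume "v \<in> ball v0 d"
      then have "v \<in> V" using d by blast
      have "((\<lambda>v. K v (circlepath z r t)) has_field_derivative deriv (\<lambda>v. K v (circlepath z r t)) v) (at v)"
        using hol[OF circlepath_in_sphere[OF r]] V \<open>v \<in> V\<close> by (rule holomorphic_derivI)
      then show "((\<lambda>v. L v t) has_field_derivative L' v t) (at v within ball v0 d)"
        unfolding L_def L'_def by (intro DERIV_cmult_right) (rule has_field_derivative_at_within)
    next
      show "continuous_on (ball v0 d \<times> cbox 0 1) (\<lambda>(v, t). L' v t)"
        using cont' by (rule continuous_on_subset) (use d in auto)
    qed (use d int in auto)
    moreover have "at v0 within ball v0 d = at v0" using d(1) by (intro at_within_open) auto
    ultimately have "((\<lambda>v. integral (cbox 0 1) (L v)) has_field_derivative integral (cbox 0 1) (L' v0)) (at v0)"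
      by metis
    moreover have "(\<lambda>v. contour_integral (circlepath z r) (K v)) = (\<lambda>v. integral (cbox 0 1) (L v))"
      unfolding contour_integral_circlepath_eq_integral L_def c_def by (rule refl)
    ultimately show "\<exists>f'. ((\<lambda>v. contour_integral (circlepath z r) (K v)) has_field_derivative f') (at v0)"
      by metis
  qed
qed

text \<open>Joint continuity with holomorphy in each variable is easily checked for integrals, and implies
  complex differentiability in the sense of Frechet by Osgood's lemma below.\<close>

definition holomorphic_on_bidisc :: "real \<Rightarrow> (complex \<Rightarrow> complex \<Rightarrow> complex) \<Rightarrow> bool" where
  "holomorphic_on_bidisc r F \<longleftrightarrow>
     continuous_on (ball 0 r \<times> ball 0 r) (\<lambda>(u, v). F u v) \<and>
     (\<forall>v\<in>ball 0 r. (\<lambda>u. F u v) holomorphic_on ball 0 r) \<and>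
     (\<forall>u\<in>ball 0 r. F u holomorphic_on ball 0 r)"

lemma holomorphic_on_bidisc_mono:
  assumes F: "holomorphic_on_bidisc r F" and "s \<le> r"
  shows "holomorphic_on_bidisc s F"
proof -
  have sub: "ball (0::complex) s \<subseteq> ball 0 r" using assms(2) by (rule subset_ball)
  then have "ball (0::complex) s \<times> ball (0::complex) s \<subseteq> ball 0 r \<times> ball 0 r" by blast
  then show ?thesis
    using F sub unfolding holomorphic_on_bidisc_def
    by (meson continuous_on_subset holomorphic_on_subset subsetD)
qed

lemma holomorphic_on_bidisc_diff:
  "holomorphic_on_bidisc r F \<Longrightarrow> holomorphic_on_bidisc r G \<Longrightarrow>
   holomorphic_on_bidisc r (\<lambda>u v. F u v - G u v)"
  unfolding holomorphic_on_bidisc_def case_prod_unfold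
  by (auto intro!: continuous_intros holomorphic_intros)

lemma holomorphic_on_bidisc_mult:
  "holomorphic_on_bidisc r F \<Longrightarrow> holomorphic_on_bidisc r G \<Longrightarrow>
   holomorphic_on_bidisc r (\<lambda>u v. F u v * G u v)"
  unfolding holomorphic_on_bidisc_def case_prod_unfold
  by (auto intro!: continuous_intros holomorphic_intros)

lemma bidisc_swap:
  assumes "holomorphic_on_bidisc r F"
  shows "holomorphic_on_bidisc r (\<lambda>u v. F v u)"
proof -
  have "continuous_on (ball 0 r \<times> ball 0 r) (\<lambda>(u, v). F u v)"
    using assms by (simp add: holomorphic_on_bidisc_def)
  then have "continuous_on (ball 0 r \<times> ball 0 r) (\<lambda>q. F (snd q) (fst q))"
    by (rule continuous_on_compose_pair) (auto intro!: continuous_intros)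
  then show ?thesis using assms by (auto simp: holomorphic_on_bidisc_def case_prod_unfold)
qed

text \<open>Osgood's lemma in two variables: differentiability follows once one of the partial derivatives is
  jointly continuous.\<close>

lemma bidisc_has_derivative:
  assumes F: "holomorphic_on_bidisc r F" and u: "u \<in> ball 0 r" and v: "v \<in> ball 0 r"
  shows "\<exists>a b. ((\<lambda>(u, v). F u v) has_derivative (\<lambda>(s, t). a * s + b * t)) (at (u, v))"
proof -
  let ?B = "ball (0::complex) r"
  have "continuous_on (?B \<times> ?B) (\<lambda>(v, u). deriv (\<lambda>v. F u v) v)"
    by (rule continuous_on_deriv_parameter)
       (use bidisc_swap[OF F] F in \<open>auto simp: holomorphic_on_bidisc_def\<close>)
  then have "continuous_on (?B \<times> ?B) (\<lambda>q. deriv (F (fst q)) (snd q))"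
    by (rule continuous_on_compose_pair) (auto intro!: continuous_intros)
  then have cont: "continuous_on (?B \<times> ?B) (\<lambda>(u, v). blinfun_mult_right (deriv (F u) v))"
    unfolding case_prod_unfold by (rule bounded_linear.continuous_on[OF bounded_linear_blinfun_mult_right])
  have "((\<lambda>(u, v). F u v) has_derivative (\<lambda>(s, t). deriv (\<lambda>u. F u v) u * s +
      blinfun_apply (blinfun_mult_right (deriv (F u) v)) t)) (at (u, v) within ?B \<times> ?B)"
  proof (rule has_derivative_partialsI)
    have "((\<lambda>u. F u v) has_field_derivative deriv (\<lambda>u. F u v) u) (at u)"
      by (rule holomorphic_derivI[of _ ?B]) (use F u v in \<open>auto simp: holomorphic_on_bidisc_def\<close>)
    then show "((\<lambda>u. F u v) has_derivative (*) (deriv (\<lambda>u. F u v) u)) (at u within ?B)"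
      by (simp add: has_field_derivative_def has_derivative_at_withinI)
  next
    fix u' v'
    assume "u' \<in> ?B" "v' \<in> ?B"
    then have "(F u' has_field_derivative deriv (F u') v') (at v')"
      by (intro holomorphic_derivI[of _ ?B]) (use F in \<open>auto simp: holomorphic_on_bidisc_def\<close>)
    then show "(F u' has_derivative blinfun_apply (blinfun_mult_right (deriv (F u') v'))) (at v' within ?B)"
      by (simp add: has_field_derivative_def has_derivative_at_withinI)
  next
    show "continuous (at (u, v) within ?B \<times> ?B) (\<lambda>(u, v). blinfun_mult_right (deriv (F u) v))"
      using cont u v by (simp add: continuous_on_eq_continuous_within)
  qed (use v in auto)
  moreover have "at (u, v) within ?B \<times> ?B = at (u, v)"
    by (rule at_within_open) (use u v in \<open>auto simp: open_Times\<close>)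
  ultimately have "((\<lambda>(u, v). F u v) has_derivative
      (\<lambda>(s, t). deriv (\<lambda>u. F u v) u * s + deriv (F u) v * t)) (at (u, v))" by simp
  then show ?thesis by blast
qed

text \<open>For \<open>N = H / G\<close> this is the quotient of \<open>H\<close> by \<open>G\<close> in Weierstrass division with respect to the
  second variable; for \<open>N\<close> holomorphic inside the circle it returns \<open>N\<close>.\<close>

definition cauchy_transform :: "real \<Rightarrow> (complex \<Rightarrow> complex \<Rightarrow> complex) \<Rightarrow> complex \<Rightarrow> complex \<Rightarrow> complex" where
  "cauchy_transform \<rho> N u v = 1 / (2 * of_real pi * \<i>) * contour_integral (circlepath 0 \<rho>) (\<lambda>w. N u w / (w - v))"

lemma cauchy_transform_on_bidisc:
  assumes \<rho>: "0 < \<rho>" and cont: "continuous_on (ball 0 \<epsilon> \<times> sphere 0 \<rho>) (\<lambda>(u, w). N u w)"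
    and hol: "\<And>w. w \<in> sphere 0 \<rho> \<Longrightarrow> (\<lambda>u. N u w) holomorphic_on ball 0 \<epsilon>"
    and r: "r \<le> \<epsilon>" "r \<le> \<rho>"
  shows "holomorphic_on_bidisc r (cauchy_transform \<rho> N)"
proof -
  let ?B = "ball (0::complex) r"
  have "continuous_on ((?B \<times> ?B) \<times> sphere 0 \<rho>) (\<lambda>q. N (fst (fst q)) (snd q))"
    by (rule continuous_on_compose_pair[OF cont]) (use r in \<open>auto intro!: continuous_intros\<close>)
  then have K: "continuous_on ((?B \<times> ?B) \<times> sphere 0 \<rho>) (\<lambda>(q, w). N (fst q) w / (w - snd q))"
    unfolding case_prod_unfold by (intro continuous_intros) (use r in auto)
  have "continuous_on (?B \<times> ?B) (\<lambda>(u, v). cauchy_transform \<rho> N u v)"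
    unfolding cauchy_transform_def case_prod_unfold
    by (intro continuous_intros continuous_on_contour_integral_circlepath[OF \<rho> K])
  moreover have "(\<lambda>u. cauchy_transform \<rho> N u v) holomorphic_on ?B" if v: "v \<in> ?B" for v
    unfolding cauchy_transform_def
  proof (intro holomorphic_intros holomorphic_on_contour_integral_circlepath[OF \<rho>])
    show "continuous_on (?B \<times> sphere 0 \<rho>) (\<lambda>(u, w). N u w / (w - v))"
    proof -
      have "continuous_on (?B \<times> sphere 0 \<rho>) (\<lambda>q. N (fst (fst q, v)) (snd q) / (snd q - snd (fst q, v)))"
        by (rule continuous_on_compose_pair[OF K]) (use v in \<open>auto intro!: continuous_intros\<close>)
      then show ?thesis by (simp add: case_prod_unfold)
    qed
    show "(\<lambda>u. N u w) holomorphic_on ?B" if "w \<in> sphere 0 \<rho>" for w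
      using hol[OF that] by (rule holomorphic_on_subset) (use r in auto)
    show "w - v \<noteq> 0" if "w \<in> sphere 0 \<rho>" for w using that v r by auto
  qed auto
  moreover have "cauchy_transform \<rho> N u holomorphic_on ?B" if u: "u \<in> ?B" for u
    unfolding cauchy_transform_def
  proof (intro holomorphic_intros holomorphic_on_contour_integral_circlepath[OF \<rho>])
    show "continuous_on (?B \<times> sphere 0 \<rho>) (\<lambda>(v, w). N u w / (w - v))"
    proof -
      have "continuous_on (?B \<times> sphere 0 \<rho>) (\<lambda>q. N (fst (u, fst q)) (snd q) / (snd q - snd (u, fst q)))"
        by (rule continuous_on_compose_pair[OF K]) (use u in \<open>auto intro!: continuous_intros\<close>)
      then show ?thesis by (simp add: case_prod_unfold)
    qed
    show "w - v \<noteq> 0" if "w \<in> sphere 0 \<rho>" "v \<in> ?B" for v w using that r by auto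
  qed auto
  ultimately show ?thesis unfolding holomorphic_on_bidisc_def by auto
qed

lemma cauchy_transform_reproduces:
  assumes "f holomorphic_on ball 0 r" "0 < \<rho>" "\<rho> < r" "v \<in> ball 0 \<rho>"
    and "\<And>w. w \<in> sphere 0 \<rho> \<Longrightarrow> N u w = f w"
  shows "cauchy_transform \<rho> N u v = f v"
proof -
  have "((\<lambda>w. f w / (w - v)) has_contour_integral (2 * of_real pi * \<i> * f v)) (circlepath 0 \<rho>)"
  proof (rule Cauchy_integral_circlepath)
    show "continuous_on (cball 0 \<rho>) f"
      using assms(1,3) by (auto intro!: holomorphic_on_imp_continuous_on elim!: holomorphic_on_subset)
    show "f holomorphic_on ball 0 \<rho>" using assms(1,3) by (auto elim!: holomorphic_on_subset)
  qed (use assms in auto)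
  moreover have "contour_integral (circlepath 0 \<rho>) (\<lambda>w. N u w / (w - v)) =
      contour_integral (circlepath 0 \<rho>) (\<lambda>w. f w / (w - v))"
    by (rule contour_integral_eq) (use assms in auto)
  ultimately show ?thesis by (simp add: cauchy_transform_def contour_integral_unique)
qed

text \<open>For fixed \<open>u\<close> the quotient \<open>F u v / v\<close> extends holomorphically to \<open>v = 0\<close>, so it is its own Cauchy
  transform; the latter is holomorphic in both variables.\<close>

lemma bidisc_division:
  assumes F: "holomorphic_on_bidisc r F" and "0 < r" and zero: "\<And>u. u \<in> ball 0 r \<Longrightarrow> F u 0 = 0"
  shows "\<exists>Q. holomorphic_on_bidisc (r / 2) Q \<and> (\<forall>u\<in>ball 0 (r/2). \<forall>v\<in>ball 0 (r/2). F u v = v * Q u v)"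
proof -
  define \<rho> where "\<rho> = r / 2"
  have \<rho>: "0 < \<rho>" "\<rho> < r" using assms(2) by (auto simp: \<rho>_def)
  define Q where "Q = cauchy_transform \<rho> (\<lambda>u w. F u w / w)"
  have "continuous_on (ball 0 r \<times> sphere 0 \<rho>) (\<lambda>q. F (fst q) (snd q))"
    using F unfolding holomorphic_on_bidisc_def case_prod_unfold
    by (auto elim!: continuous_on_subset simp: \<rho>)
  then have "continuous_on (ball 0 r \<times> sphere 0 \<rho>) (\<lambda>(u, w). F u w / w)"
    unfolding case_prod_unfold by (intro continuous_intros) (use \<rho> in auto)
  moreover have "(\<lambda>u. F u w / w) holomorphic_on ball 0 r" if "w \<in> sphere 0 \<rho>" for w
    by (intro holomorphic_intros) (use F \<rho> that in \<open>auto simp: holomorphic_on_bidisc_def\<close>)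
  ultimately have "holomorphic_on_bidisc \<rho> Q"
    unfolding Q_def by (rule cauchy_transform_on_bidisc[OF \<rho>(1)]) (use \<rho> in auto)
  moreover have "F u v = v * Q u v" if u: "u \<in> ball 0 \<rho>" and v: "v \<in> ball 0 \<rho>" for u v
  proof -
    have hol: "F u holomorphic_on ball 0 r" using F u \<rho> by (auto simp: holomorphic_on_bidisc_def)
    \<comment> \<open>the divided difference, with its removable singularity filled in\<close>
    define q where "q w = (if w = 0 then deriv (F u) 0 else F u w / w)" for w
    have "(\<lambda>w. if w = 0 then deriv (F u) 0 else (F u w - F u 0) / (w - 0)) holomorphic_on ball 0 r"
      by (rule pole_lemma_open[OF hol open_ball])
    moreover have "(\<lambda>w. if w = 0 then deriv (F u) 0 else (F u w - F u 0) / (w - 0)) = q"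
      using zero[of u] u \<rho> by (auto simp: q_def fun_eq_iff)
    ultimately have "q holomorphic_on ball 0 r" by simp
    then have "Q u v = q v"
      unfolding Q_def by (rule cauchy_transform_reproduces[OF _ \<rho> v]) (use \<rho> in \<open>auto simp: q_def\<close>)
    then show ?thesis using zero[of u] u \<rho> by (auto simp: q_def)
  qed
  ultimately show ?thesis unfolding \<rho>_def by blast
qed

lemma nonvanishing_tube:
  assumes G: "holomorphic_on_bidisc r G" and A: "compact A" "A \<subseteq> ball 0 r"
    and nz: "\<And>w. w \<in> A \<Longrightarrow> G 0 w \<noteq> 0" and r: "0 < r"
  shows "\<exists>\<epsilon>>0. \<epsilon> \<le> r \<and> (\<forall>u\<in>ball 0 \<epsilon>. \<forall>w\<in>A. G u w \<noteq> 0)"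
proof -
  have sub: "cball 0 (r/2) \<times> A \<subseteq> ball (0::complex) r \<times> ball 0 r" using r A(2) by auto
  have cont: "continuous_on (cball 0 (r/2) \<times> A) (\<lambda>q. G (fst q) (snd q))"
    using G continuous_on_subset[OF _ sub] unfolding holomorphic_on_bidisc_def case_prod_unfold by blast
  have cpt: "compact (cball (0::complex) (r/2) \<times> A)" using A(1) by (rule compact_Times[OF compact_cball])
  have "closed ((cball 0 (r/2) \<times> A) \<inter> (\<lambda>q. G (fst q) (snd q)) -` {0})"
    by (rule continuous_closed_preimage[OF cont compact_imp_closed[OF cpt] closed_singleton])
  from compact_Int_closed[OF cpt this]
  have "compact ((cball 0 (r/2) \<times> A) \<inter> (\<lambda>q. G (fst q) (snd q)) -` {0})"
    by (simp only: Int_left_absorb)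
  then have "compact (fst ` ((cball 0 (r/2) \<times> A) \<inter> (\<lambda>q. G (fst q) (snd q)) -` {0}))"
    by (rule compact_continuous_image[rotated]) (rule continuous_on_fst[OF continuous_on_id])
  moreover define Z where "Z = fst ` ((cball 0 (r/2) \<times> A) \<inter> (\<lambda>q. G (fst q) (snd q)) -` {0})"
  ultimately have "open (- Z)" using compact_imp_closed by blast
  have Z: "u \<in> Z \<longleftrightarrow> u \<in> cball 0 (r/2) \<and> (\<exists>w\<in>A. G u w = 0)" for u
    unfolding Z_def by (force simp: image_iff)
  have "0 \<in> - Z" using nz by (auto simp: Z)
  then obtain e where e: "e > 0" "ball 0 e \<subseteq> - Z"
    using \<open>open (- Z)\<close> open_contains_ball by blast
  have "G u w \<noteq> 0" if "u \<in> ball 0 (min e (r/2))" "w \<in> A" for u w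
    using e(2) that Z[of u] by fastforce
  then show ?thesis using e(1) r by (intro exI[of _ "min e (r/2)"]) auto
qed

lemma contour_integral_circlepath_annulus:
  assumes "open S" "f holomorphic_on S" "0 < r" "r \<le> s" "\<And>w. r \<le> norm w \<Longrightarrow> norm w \<le> s \<Longrightarrow> w \<in> S"
  shows "contour_integral (circlepath 0 s) f = contour_integral (circlepath 0 r) f"
proof (rule Cauchy_theorem_homotopic_loops)
  show "homotopic_loops S (circlepath 0 s) (circlepath 0 r)"
  proof (rule homotopic_loops_linear)
    fix t :: real
    show "closed_segment (circlepath 0 s t) (circlepath 0 r t) \<subseteq> S"
    proof
      fix w
      assume "w \<in> closed_segment (circlepath 0 s t) (circlepath 0 r t)"
      then obtain c where c: "0 \<le> c" "c \<le> 1" "w = (1 - c) *\<^sub>R circlepath 0 s t + c *\<^sub>R circlepath 0 r t"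
        by (auto simp: closed_segment_def)
      then have "w = of_real ((1 - c) * s + c * r) * exp (2 * of_real pi * \<i> * t)"
        by (simp add: circlepath scaleR_conv_of_real algebra_simps)
      then have "norm w = \<bar>(1 - c) * s + c * r\<bar>" by (simp add: norm_mult del: of_real_add of_real_mult)
      moreover have "r \<le> (1 - c) * s + c * r"
        using c assms mult_left_mono[of r s "1 - c"] by (simp add: algebra_simps)
      moreover have "(1 - c) * s + c * r \<le> s"
        using c assms mult_left_mono[of r s c] by (simp add: algebra_simps)
      ultimately show "w \<in> S" using assms by auto
    qed
  qed auto
qed (use assms in auto)

text \<open>The quotient \<open>Q\<close> of \<open>H\<close> by \<open>G\<close> is the Cauchy transform of \<open>H / G\<close> over a fixed circle. It is linear in
  \<open>H\<close>, equals \<open>U\<close> if \<open>H = G U\<close>, and commutes with multiplication by powers of the first variable.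
  Hence the remainder \<open>H - G Q\<close> of \<open>H = G U + u^k V\<close> is \<open>u^k\<close> times the remainder of \<open>V\<close>. As \<open>U\<close> and \<open>V\<close>
  may be defined on a much smaller bidisc, the circle of integration has first to be shrunk; the
  annulus in between contains no zero of \<open>G u\<close> for small \<open>u\<close>.\<close>

lemma weierstrass_remainder:
  assumes G: "holomorphic_on_bidisc r G" and H: "holomorphic_on_bidisc r H" and "0 < r"
    and nz: "\<And>w. w \<noteq> 0 \<Longrightarrow> w \<in> ball 0 r \<Longrightarrow> G 0 w \<noteq> 0"
  shows "\<exists>Q s. 0 < s \<and> s \<le> r \<and> holomorphic_on_bidisc s Q \<and>
    (\<forall>k U V t. 0 < t \<longrightarrow> holomorphic_on_bidisc t U \<longrightarrow> holomorphic_on_bidisc t V \<longrightarrow>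
       (\<forall>u\<in>ball 0 t. \<forall>v\<in>ball 0 t. H u v = G u v * U u v + u ^ k * V u v) \<longrightarrow>
       (\<exists>d>0. \<exists>W. holomorphic_on_bidisc d W \<and>
         (\<forall>u\<in>ball 0 d. \<forall>v\<in>ball 0 d. H u v - G u v * Q u v = u ^ k * W u v)))"
proof -
  have Gcont: "continuous_on (ball 0 r \<times> ball 0 r) (\<lambda>q. G (fst q) (snd q))"
    and Hcont: "continuous_on (ball 0 r \<times> ball 0 r) (\<lambda>q. H (fst q) (snd q))"
    using G H by (auto simp: holomorphic_on_bidisc_def case_prod_unfold)
  have Ghol: "(\<lambda>u. G u w) holomorphic_on ball 0 r" "G w holomorphic_on ball 0 r"
    and Hhol: "(\<lambda>u. H u w) holomorphic_on ball 0 r" "H w holomorphic_on ball 0 r" if "w \<in> ball 0 r" for w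
    using G H that by (auto simp: holomorphic_on_bidisc_def)
  define \<rho> where "\<rho> = r / 2"
  have \<rho>: "0 < \<rho>" "\<rho> < r" using assms(3) by (auto simp: \<rho>_def)
  have cpt: "compact {w :: complex. a \<le> norm w \<and> norm w \<le> b}" for a b
  proof -
    have "{w :: complex. a \<le> norm w \<and> norm w \<le> b} = cball 0 b - ball 0 a" by auto
    then show ?thesis by (simp add: compact_diff)
  qed
  obtain \<epsilon> where \<epsilon>: "0 < \<epsilon>" "\<epsilon> \<le> r" "\<And>u w. u \<in> ball 0 \<epsilon> \<Longrightarrow> w \<in> sphere 0 \<rho> \<Longrightarrow> G u w \<noteq> 0"
    using nonvanishing_tube[OF G, of "sphere 0 \<rho>"] nz \<rho> assms(3) by (metis compact_sphere
        dist_0_norm less_irrefl mem_ball mem_sphere norm_zero subsetI)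
  define Q where "Q = cauchy_transform \<rho> (\<lambda>u w. H u w / G u w)"
  define s where "s = min \<epsilon> \<rho>"
  have sub: "ball 0 \<epsilon> \<times> sphere 0 \<rho> \<subseteq> ball (0::complex) r \<times> ball (0::complex) r" using \<epsilon> \<rho> by auto
  have Q: "holomorphic_on_bidisc s Q"
    unfolding Q_def
  proof (rule cauchy_transform_on_bidisc[OF \<rho>(1)])
    show "continuous_on (ball 0 \<epsilon> \<times> sphere 0 \<rho>) (\<lambda>(u, w). H u w / G u w)"
      unfolding case_prod_unfold
      by (intro continuous_intros continuous_on_subset[OF Gcont sub] continuous_on_subset[OF Hcont sub])
         (use \<epsilon> in auto)
    show "(\<lambda>u. H u w / G u w) holomorphic_on ball 0 \<epsilon>" if "w \<in> sphere 0 \<rho>" for w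
      by (intro holomorphic_intros holomorphic_on_subset[OF Ghol(1)] holomorphic_on_subset[OF Hhol(1)])
         (use that \<rho> \<epsilon> in auto)
  qed (auto simp: s_def)
  have rem: "\<exists>d>0. \<exists>W. holomorphic_on_bidisc d W \<and>
         (\<forall>u\<in>ball 0 d. \<forall>v\<in>ball 0 d. H u v - G u v * Q u v = u ^ k * W u v)"
    if t: "0 < t" and U: "holomorphic_on_bidisc t U" and V: "holomorphic_on_bidisc t V"
      and eq: "\<And>u v. u \<in> ball 0 t \<Longrightarrow> v \<in> ball 0 t \<Longrightarrow> H u v = G u v * U u v + u ^ k * V u v"
    for k U V t
  proof -
    define \<sigma> where "\<sigma> = min (t / 2) \<rho>"
    have \<sigma>: "0 < \<sigma>" "\<sigma> < t" "\<sigma> \<le> \<rho>" using t \<rho> by (auto simp: \<sigma>_def)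
    let ?A = "{w :: complex. \<sigma> \<le> norm w \<and> norm w \<le> \<rho>}"
    obtain \<delta> where \<delta>: "0 < \<delta>" "\<delta> \<le> r" "\<And>u w. u \<in> ball 0 \<delta> \<Longrightarrow> w \<in> ?A \<Longrightarrow> G u w \<noteq> 0"
    proof -
      have "\<exists>\<epsilon>>0. \<epsilon> \<le> r \<and> (\<forall>u\<in>ball 0 \<epsilon>. \<forall>w\<in>?A. G u w \<noteq> 0)"
      proof (rule nonvanishing_tube[OF G cpt _ _ assms(3)])
        fix w :: complex
        assume w: "w \<in> ?A"
        then have "w \<noteq> 0" using \<sigma> by auto
        then show "G 0 w \<noteq> 0" using nz[of w] w \<rho> by auto
      qed (use \<rho> in auto)
      then show ?thesis using that by blast
    qed
    define e where "e = min \<delta> (min t \<sigma>)"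
    have e: "0 < e" "e \<le> \<delta>" "e \<le> t" "e \<le> \<sigma>" using \<delta> t \<sigma> by (auto simp: e_def)
    define Q1 where "Q1 = cauchy_transform \<sigma> (\<lambda>u w. V u w / G u w)"
    have Vcont: "continuous_on (ball 0 t \<times> ball 0 t) (\<lambda>q. V (fst q) (snd q))"
      using V by (auto simp: holomorphic_on_bidisc_def case_prod_unfold)
    have Vhol: "(\<lambda>u. V u w) holomorphic_on ball 0 t" "V w holomorphic_on ball 0 t"
        and Uhol: "U w holomorphic_on ball 0 t" if "w \<in> ball 0 t" for w
      using U V that by (auto simp: holomorphic_on_bidisc_def)
    have sub1: "ball 0 e \<times> sphere 0 \<sigma> \<subseteq> ball (0::complex) r \<times> ball (0::complex) r"
      and sub2: "ball 0 e \<times> sphere 0 \<sigma> \<subseteq> ball (0::complex) t \<times> ball (0::complex) t"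
      using e \<delta> \<sigma> \<rho> by auto
    have Q1: "holomorphic_on_bidisc e Q1"
      unfolding Q1_def
    proof (rule cauchy_transform_on_bidisc[OF \<sigma>(1)])
      show "continuous_on (ball 0 e \<times> sphere 0 \<sigma>) (\<lambda>(u, w). V u w / G u w)"
        unfolding case_prod_unfold
        by (intro continuous_intros continuous_on_subset[OF Gcont sub1] continuous_on_subset[OF Vcont sub2])
           (use \<delta> e \<sigma> in auto)
      show "(\<lambda>u. V u w / G u w) holomorphic_on ball 0 e" if "w \<in> sphere 0 \<sigma>" for w
        by (intro holomorphic_intros holomorphic_on_subset[OF Ghol(1)] holomorphic_on_subset[OF Vhol(1)])
           (use that \<rho> \<sigma> e \<delta> in auto)
    qed (use e in auto)
    define W where "W u v = V u v - G u v * Q1 u v" for u v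
    have W: "holomorphic_on_bidisc e W"
      unfolding W_def
      by (intro holomorphic_on_bidisc_diff holomorphic_on_bidisc_mult Q1
            holomorphic_on_bidisc_mono[OF G] holomorphic_on_bidisc_mono[OF V]) (use e \<delta> in auto)
    have "H u v - G u v * Q u v = u ^ k * W u v" if u: "u \<in> ball 0 e" and v: "v \<in> ball 0 e" for u v
    proof -
      have ut: "u \<in> ball 0 t" "u \<in> ball 0 r" "u \<in> ball 0 \<delta>" and vt: "v \<in> ball 0 t" "v \<in> ball 0 \<sigma>"
        using u v e \<delta> by auto
      let ?f = "\<lambda>w. H u w / G u w / (w - v)"
      define S where "S = {w \<in> ball 0 r. G u w \<noteq> 0} - {v}"
      have "open {w \<in> ball 0 r. G u w \<in> - {0}}"
        using holomorphic_on_imp_continuous_on[OF Ghol(2)[OF ut(2)]]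
          continuous_open_preimage[of "ball 0 r" "G u" "- {0}"] by (auto simp: vimage_def Int_def)
      then have "open S" unfolding S_def by (intro open_Diff) auto
      moreover have "?f holomorphic_on S"
        by (intro holomorphic_intros holomorphic_on_subset[OF Ghol(2)[OF ut(2)]]
              holomorphic_on_subset[OF Hhol(2)[OF ut(2)]]) (auto simp: S_def)
      ultimately have "contour_integral (circlepath 0 \<rho>) ?f = contour_integral (circlepath 0 \<sigma>) ?f"
        by (rule contour_integral_circlepath_annulus) (use \<sigma> \<rho> \<delta> ut vt in \<open>auto simp: S_def\<close>)
      also have "\<dots> = contour_integral (circlepath 0 \<sigma>) (\<lambda>w. U u w / (w - v) + u ^ k * (V u w / G u w / (w - v)))"
      proof (rule contour_integral_eq)
        fix w
        assume "w \<in> path_image (circlepath 0 \<sigma>)"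
        then have w: "norm w = \<sigma>" using \<sigma> by auto
        have "G u w \<noteq> 0" using \<delta>(3)[OF ut(3)] w \<sigma> by auto
        moreover have "w - v \<noteq> 0" using w vt by auto
        moreover have "H u w = G u w * U u w + u ^ k * V u w" using eq[OF ut(1)] w \<sigma> by auto
        ultimately show "?f w = U u w / (w - v) + u ^ k * (V u w / G u w / (w - v))"
          by (simp add: add_divide_distrib)
      qed
      also have "\<dots> = contour_integral (circlepath 0 \<sigma>) (\<lambda>w. U u w / (w - v)) +
          u ^ k * contour_integral (circlepath 0 \<sigma>) (\<lambda>w. V u w / G u w / (w - v))"
      proof -
        have int: "g contour_integrable_on circlepath 0 \<sigma>" if "continuous_on (sphere 0 \<sigma>) g" for g
          by (rule contour_integrable_continuous_circlepath) (use that \<sigma> in auto)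
        have "continuous_on (sphere 0 \<sigma>) (\<lambda>w. U u w / (w - v))"
          by (intro continuous_intros continuous_on_subset[OF holomorphic_on_imp_continuous_on[OF Uhol[OF ut(1)]]])
             (use vt \<sigma> in auto)
        moreover have "continuous_on (sphere 0 \<sigma>) (\<lambda>w. V u w / G u w / (w - v))"
          by (intro continuous_intros continuous_on_subset[OF holomorphic_on_imp_continuous_on[OF Vhol(2)[OF ut(1)]]]
              continuous_on_subset[OF holomorphic_on_imp_continuous_on[OF Ghol(2)[OF ut(2)]]])
             (use vt \<sigma> \<rho> \<delta>(3)[OF ut(3)] in auto)
        ultimately have "(\<lambda>w. U u w / (w - v)) contour_integrable_on circlepath 0 \<sigma> \<and>
            (\<lambda>w. V u w / G u w / (w - v)) contour_integrable_on circlepath 0 \<sigma>" by (intro conjI int)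
        then show ?thesis
          by (simp only: contour_integral_add contour_integral_lmul contour_integrable_lmul)
      qed
      finally have "Q u v = cauchy_transform \<sigma> U u v + u ^ k * Q1 u v"
        unfolding Q_def Q1_def cauchy_transform_def by (simp add: algebra_simps)
      also have "cauchy_transform \<sigma> U u v = U u v"
        by (rule cauchy_transform_reproduces[OF Uhol[OF ut(1)] \<sigma>(1,2) vt(2)]) auto
      finally show ?thesis unfolding W_def eq[OF ut(1) vt(1)] by (simp add: algebra_simps)
    qed
    then show ?thesis using W e(1) by blast
  qed
  have "0 < s" "s \<le> r" using \<epsilon> \<rho> by (auto simp: s_def)
  moreover have "\<exists>d>0. \<exists>W. holomorphic_on_bidisc d W \<and>
         (\<forall>u\<in>ball 0 d. \<forall>v\<in>ball 0 d. H u v - G u v * Q u v = u ^ k * W u v)"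
    if "0 < t" "holomorphic_on_bidisc t U" "holomorphic_on_bidisc t V"
      "\<forall>u\<in>ball 0 t. \<forall>v\<in>ball 0 t. H u v = G u v * U u v + u ^ k * V u v" for k U V t
    by (rule rem[OF that(1-3)]) (use that(4) in blast)
  ultimately show ?thesis using Q by blast
qed

section \<open>Germs and their Taylor series along lines\<close>

lemma germ_relI: "holomorphic_near 0 f \<Longrightarrow> germ_rel f f"
  by (simp add: germ_rel_def)

lemma germ_cases:
  obtains f r where "0 < r" "f mholomorphic_on ball 0 r" "a = abs_germ f"
proof -
  have "germ_rel (rep_germ a) (rep_germ a)" by (rule Quotient3_rep_reflp[OF Quotient3_germ])
  then obtain U where "open U" "0 \<in> U" "rep_germ a mholomorphic_on U"
    by (auto simp: germ_rel_def holomorphic_near_def)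
  moreover from this obtain r where "0 < r" "ball 0 r \<subseteq> U" using open_contains_ball by blast
  moreover have "a = abs_germ (rep_germ a)" by (simp add: Quotient3_abs_rep[OF Quotient3_germ])
  ultimately show ?thesis using that mholomorphic_on_subset by blast
qed

lemma holomorphic_nearI: "0 < r \<Longrightarrow> f mholomorphic_on ball 0 r \<Longrightarrow> holomorphic_near 0 f"
  unfolding holomorphic_near_def by (intro exI[of _ "ball 0 r"]) auto

lemma abs_germ_eq_iff:
  assumes "holomorphic_near 0 f" "holomorphic_near 0 g"
  shows "abs_germ f = abs_germ g \<longleftrightarrow> (\<forall>\<^sub>F z in nhds 0. f z = g z)"
  using Quotient3_rel[OF Quotient3_germ, of f g] assms by (auto simp: germ_rel_def)

lemma abs_germ_plus:
  "holomorphic_near 0 f \<Longrightarrow> holomorphic_near 0 g \<Longrightarrow> abs_germ f + abs_germ g = abs_germ (\<lambda>z. f z + g z)"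
  by (intro plus_germ.abs_eq germ_relI)

lemma abs_germ_times:
  "holomorphic_near 0 f \<Longrightarrow> holomorphic_near 0 g \<Longrightarrow> abs_germ f * abs_germ g = abs_germ (\<lambda>z. f z * g z)"
  by (intro times_germ.abs_eq germ_relI)

lemma mholomorphic_on_inverse:
  assumes f: "f mholomorphic_on U" and nz: "\<And>z. z \<in> U \<Longrightarrow> f z \<noteq> 0"
  shows "(\<lambda>z. inverse (f z)) mholomorphic_on U"
  unfolding mholomorphic_on_def
proof
  fix z
  assume z: "z \<in> U"
  then obtain c where c: "(f has_derivative (\<lambda>h. \<Sum>i\<in>UNIV. c $ i * h $ i)) (at z)"
    using f unfolding mholomorphic_on_def by blast
  from Deriv.has_derivative_inverse[OF nz[OF z] c]
  have "((\<lambda>z. inverse (f z)) has_derivative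
      (\<lambda>h. - (inverse (f z) * (\<Sum>i\<in>UNIV. c $ i * h $ i) * inverse (f z)))) (at z)" .
  also have "(\<lambda>h. - (inverse (f z) * (\<Sum>i\<in>UNIV. c $ i * h $ i) * inverse (f z))) =
      (\<lambda>h. \<Sum>i\<in>UNIV. (\<chi> i. - (inverse (f z) * c $ i * inverse (f z))) $ i * h $ i)"
    by (simp add: sum_distrib_left sum_distrib_right sum_negf mult_ac)
  finally show "\<exists>c. ((\<lambda>z. inverse (f z)) has_derivative (\<lambda>h. \<Sum>i\<in>UNIV. c $ i * h $ i)) (at z)" by blast
qed

lemma mholomorphic_on_imp_continuous_on: "f mholomorphic_on U \<Longrightarrow> continuous_on U f"
  unfolding mholomorphic_on_def
  by (meson continuous_at_imp_continuous_on has_derivative_continuous)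

lemma bounded_linear_line: "bounded_linear (\<lambda>w :: complex. w *s (v :: complex ^ 'n))"
proof -
  have "linear (\<lambda>w :: complex. w *s v)"
    by (rule linearI) (simp_all add: vec_eq_iff algebra_simps)
  then show ?thesis by (simp add: linear_conv_bounded_linear)
qed

lemma mholomorphic_on_line:
  assumes f: "f mholomorphic_on U" and "p + w *s v \<in> U"
  shows "(\<lambda>w. f (p + w *s v)) field_differentiable (at w)"
proof -
  obtain c where c: "(f has_derivative (\<lambda>h. \<Sum>i\<in>UNIV. c $ i * h $ i)) (at (p + w *s v))"
    using f \<open>p + w *s v \<in> U\<close> unfolding mholomorphic_on_def by blast
  have "((\<lambda>w. p + w *s v) has_derivative (\<lambda>h. h *s v)) (at w)"
    by (auto intro!: derivative_eq_intros bounded_linear_imp_has_derivative bounded_linear_line)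
  from has_derivative_compose[OF this c]
  have "((\<lambda>w. f (p + w *s v)) has_derivative (\<lambda>h. \<Sum>i\<in>UNIV. c $ i * (h *s v) $ i)) (at w)" .
  also have "(\<lambda>h. \<Sum>i\<in>UNIV. c $ i * (h *s v) $ i) = (*) (\<Sum>i\<in>UNIV. c $ i * v $ i)"
    by (simp add: fun_eq_iff sum_distrib_left mult_ac)
  finally show ?thesis unfolding field_differentiable_def has_field_derivative_def by blast
qed

lemma holomorphic_on_line:
  assumes f: "f mholomorphic_on U" and S: "\<And>w. w \<in> S \<Longrightarrow> p + w *s v \<in> U"
  shows "(\<lambda>w. f (p + w *s v)) holomorphic_on S"
  unfolding holomorphic_on_def
  using mholomorphic_on_line[OF f S] field_differentiable_at_within by blast

lemma continuous_line: "continuous_on S (\<lambda>w :: complex. p + w *s (v :: complex ^ 'n))"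
  by (intro continuous_intros linear_continuous_on bounded_linear_line)

lemma tendsto_line: "filterlim (\<lambda>w :: complex. p + w *s (v :: complex ^ 'n)) (nhds p) (nhds 0)"
proof -
  have "isCont (\<lambda>w. p + w *s v) 0"
    using continuous_line[of UNIV p v] by (simp add: continuous_on_eq_continuous_at)
  then have "filterlim (\<lambda>w. p + w *s v) (nhds (p + 0 *s v)) (nhds 0)"
    unfolding isCont_def by (rule tendsto_at_iff_tendsto_nhds[of "\<lambda>w. p + w *s v" 0, THEN iffD1])
  then show ?thesis by simp
qed

text \<open>The segment from \<open>p\<close> to \<open>p + v\<close> stays in the ball, which reduces the claim to the identity theorem
  in one variable.\<close>

lemma identity_along_line:
  fixes g :: "complex ^ 'n \<Rightarrow> complex"
  assumes g: "g mholomorphic_on ball 0 r" and p: "p \<in> ball 0 r" "p + v \<in> ball 0 r"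
    and zero: "\<forall>\<^sub>F w in nhds 0. g (p + w *s v) = 0"
  shows "g (p + v) = 0"
proof -
  define S where "S = {w. p + w *s v \<in> ball 0 r}"
  have "open S"
    unfolding S_def using open_vimage[OF open_ball[of 0 r] continuous_line[of UNIV p v]]
    by (simp only: vimage_def)
  have "convex S"
  proof (rule convexI)
    fix a b :: complex and s t :: real
    assume ab: "a \<in> S" "b \<in> S" and st: "0 \<le> s" "0 \<le> t" "s + t = 1"
    have "p + (s *\<^sub>R a + t *\<^sub>R b) *s v = s *\<^sub>R (p + a *s v) + t *\<^sub>R (p + b *s v)"
    proof -
      have "s *\<^sub>R p + t *\<^sub>R p = p" using st(3) by (metis scaleR_add_left scaleR_one)
      then have "s *\<^sub>R p $ i + t *\<^sub>R p $ i = p $ i" for i by (metis vector_add_component vector_scaleR_component)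
      then show ?thesis by (simp add: vec_eq_iff algebra_simps)
    qed
    then show "s *\<^sub>R a + t *\<^sub>R b \<in> S"
      using convexD[OF convex_ball, of "p + a *s v" 0 r "p + b *s v" s t] ab st by (simp add: S_def)
  qed
  then have "connected S" by (rule convex_connected)
  have S01: "0 \<in> S" "1 \<in> S" using p by (auto simp: S_def)
  obtain W where W: "open W" "0 \<in> W" "\<And>w. w \<in> W \<Longrightarrow> g (p + w *s v) = 0"
    using zero unfolding eventually_nhds by blast
  have "g (p + 1 *s v) = 0"
  proof (rule analytic_continuation_open[where s = "W \<inter> S" and s' = S and g = "\<lambda>_. 0" and f = "\<lambda>w. g (p + w *s v)"])
    show "(\<lambda>w. g (p + w *s v)) holomorphic_on S"
      by (rule holomorphic_on_line[OF g]) (simp add: S_def)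
  qed (use W S01 \<open>open S\<close> \<open>connected S\<close> in auto)
  then show ?thesis by simp
qed

text \<open>The Taylor series of a germ along the line through the origin in direction \<open>v\<close>. These ring
  homomorphisms to power series in one variable detect units and, taken together, the zero germ.\<close>

definition line_series :: "complex ^ 'n \<Rightarrow> 'n::finite germ \<Rightarrow> complex fps" where
  "line_series v a = fps_expansion (\<lambda>w. rep_germ a (w *s v)) 0"

lemma line_series_expansion:
  assumes "holomorphic_near 0 f"
  shows "(\<lambda>w. f (w *s v)) has_fps_expansion line_series v (abs_germ f)"
proof -
  define g where "g = rep_germ (abs_germ f)"
  have "germ_rel g f"
    unfolding g_def by (rule rep_abs_rsp_left[OF Quotient3_germ]) (rule germ_relI[OF assms])
  then have near: "holomorphic_near 0 g" and ev: "\<forall>\<^sub>F z in nhds 0. g z = f z" by (auto simp: germ_rel_def)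
  obtain U where U: "open U" "0 \<in> U" "g mholomorphic_on U"
    using near unfolding holomorphic_near_def by blast
  have "open {w. 0 + w *s v \<in> U}" using open_vimage[OF U(1) continuous_line[of UNIV 0 v]] by (simp only: vimage_def)
  moreover have "(\<lambda>w. g (0 + w *s v)) holomorphic_on {w. 0 + w *s v \<in> U}"
    by (rule holomorphic_on_line[OF U(3)]) simp
  ultimately have "(\<lambda>w. g (0 + w *s v)) has_fps_expansion fps_expansion (\<lambda>w. g (0 + w *s v)) 0"
    using U(2) by (intro has_fps_expansion_fps_expansion) auto
  then have "(\<lambda>w. g (w *s v)) has_fps_expansion line_series v (abs_germ f)"
    by (simp add: line_series_def g_def)
  moreover have "\<forall>\<^sub>F w in nhds 0. g (w *s v) = f (w *s v)"
    using eventually_compose_filterlim[OF ev tendsto_line[of 0 v]] by simp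
  ultimately show ?thesis by (simp add: has_fps_expansion_cong)
qed

lemma line_series_eqI:
  assumes "holomorphic_near 0 f" "(\<lambda>w. f (w *s v)) has_fps_expansion F"
  shows "line_series v (abs_germ f) = F"
  using line_series_expansion[OF assms(1)] assms(2) by (rule fps_expansion_unique_complex)

lemma line_series_add: "line_series v (a + b) = line_series v a + line_series v b"
proof -
  obtain f r where f: "0 < r" "f mholomorphic_on ball 0 r" "a = abs_germ f" by (rule germ_cases)
  obtain g s where g: "0 < s" "g mholomorphic_on ball 0 s" "b = abs_germ g" by (rule germ_cases)
  have near: "holomorphic_near 0 f" "holomorphic_near 0 g" using f g by (blast intro: holomorphic_nearI)+
  then show ?thesis
    unfolding f(3) g(3) abs_germ_plus[OF near]
    by (intro line_series_eqI holomorphic_near_add has_fps_expansion_add line_series_expansion)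
qed

lemma line_series_mult: "line_series v (a * b) = line_series v a * line_series v b"
proof -
  obtain f r where f: "0 < r" "f mholomorphic_on ball 0 r" "a = abs_germ f" by (rule germ_cases)
  obtain g s where g: "0 < s" "g mholomorphic_on ball 0 s" "b = abs_germ g" by (rule germ_cases)
  have near: "holomorphic_near 0 f" "holomorphic_near 0 g" using f g by (blast intro: holomorphic_nearI)+
  then show ?thesis
    unfolding f(3) g(3) abs_germ_times[OF near]
    by (intro line_series_eqI holomorphic_near_mult has_fps_expansion_mult line_series_expansion)
qed

lemma line_series_1: "line_series v 1 = 1"
  unfolding one_germ_def map_fun_def
  by (rule line_series_eqI) (auto intro: holomorphic_near_const has_fps_expansion_1)

lemma line_series_diff: "line_series v (a - b) = line_series v a - line_series v b"
  using line_series_add[of v "a - b" b] by simp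

lemma line_series_0: "line_series v 0 = 0"
  using line_series_diff[of v 0 0] by simp

lemma line_series_eq_0_imp:
  assumes f: "f mholomorphic_on ball 0 r" and v: "v \<in> ball 0 r" and "line_series v (abs_germ f) = 0"
  shows "f v = 0"
proof -
  have "0 < r" using v by (metis centre_in_ball dist_0_norm le_less_trans mem_ball norm_ge_zero)
  then have "(\<lambda>w. f (w *s v)) has_fps_expansion 0"
    using line_series_expansion[OF holomorphic_nearI[OF _ f], of v] assms(3) by simp
  then have "\<forall>\<^sub>F w in nhds 0. f (0 + w *s v) = 0"
    by (auto simp: has_fps_expansion_def elim: eventually_mono)
  from identity_along_line[OF f _ _ this] show ?thesis using v \<open>0 < r\<close> by simp
qed

lemma exists_line_series_nonzero:
  assumes "a \<noteq> 0"
  shows "\<exists>v. line_series v a \<noteq> 0"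
proof (rule ccontr)
  assume contra: "\<not> (\<exists>v. line_series v a \<noteq> 0)"
  obtain f r where f: "0 < r" "f mholomorphic_on ball 0 r" "a = abs_germ f" by (rule germ_cases)
  then have "f z = 0" if "z \<in> ball 0 r" for z
    using line_series_eq_0_imp[OF f(2) that] contra by blast
  then have "\<forall>\<^sub>F z in nhds 0. f z = (\<lambda>_. 0) z"
    using eventually_nhds_in_open[OF open_ball, of 0 0 r] f(1) by (auto elim: eventually_mono)
  then have "a = abs_germ (\<lambda>_. 0)"
    unfolding f(3) using holomorphic_nearI[OF f(1,2)] holomorphic_near_const by (subst abs_germ_eq_iff)
  then show False using assms by (simp add: zero_germ_def)
qed

text \<open>If \<open>f g = 0\<close> and \<open>f\<close> does not vanish at \<open>p\<close>, then \<open>g\<close> vanishes near \<open>p\<close>, hence along all lines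
  through \<open>p\<close>.\<close>

instance germ :: (finite) idom
proof
  fix a b :: "'a germ"
  assume ab: "a \<noteq> 0" "b \<noteq> 0"
  obtain f r where f: "0 < r" "f mholomorphic_on ball 0 r" "a = abs_germ f" by (rule germ_cases)
  obtain g s where g: "0 < s" "g mholomorphic_on ball 0 s" "b = abs_germ g" by (rule germ_cases)
  define t where "t = min r s"
  have t: "0 < t" "f mholomorphic_on ball 0 t" "g mholomorphic_on ball 0 t"
    using f g by (auto simp: t_def intro: mholomorphic_on_subset)
  have zero: "abs_germ h = 0" if "h mholomorphic_on ball 0 t" "\<And>z. z \<in> ball 0 t \<Longrightarrow> h z = 0" for h
  proof -
    have "\<forall>\<^sub>F z in nhds 0. h z = (\<lambda>_. 0) z"
      using eventually_nhds_in_open[OF open_ball, of 0 0 t] t(1) that(2) by (auto elim: eventually_mono)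
    then have "abs_germ h = abs_germ (\<lambda>_. 0)"
      using holomorphic_nearI[OF t(1) that(1)] holomorphic_near_const by (subst abs_germ_eq_iff)
    then show ?thesis by (simp add: zero_germ_def)
  qed
  show "a * b \<noteq> 0"
  proof
    assume "a * b = 0"
    then have "line_series v a = 0 \<or> line_series v b = 0" for v
      using line_series_mult[of v a b] by (simp add: line_series_0)
    then have fg: "f z * g z = 0" if "z \<in> ball 0 t" for z
      using line_series_eq_0_imp[OF t(2) that] line_series_eq_0_imp[OF t(3) that] f(3) g(3) by auto
    obtain p where p: "p \<in> ball 0 t" "f p \<noteq> 0" using zero[OF t(2)] ab f(3) by blast
    have "open {z \<in> ball 0 t. f z \<in> - {0}}"
      using continuous_open_preimage[OF mholomorphic_on_imp_continuous_on[OF t(2)] open_ball, of "- {0}"]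
      by (simp add: vimage_def Int_def open_Compl)
    then have "\<forall>\<^sub>F z in nhds p. z \<in> {z \<in> ball 0 t. f z \<in> - {0}}"
      using p by (intro eventually_nhds_in_open) auto
    then have ev: "\<forall>\<^sub>F z in nhds p. g z = 0" using fg by (auto elim!: eventually_mono)
    have "g z = 0" if z: "z \<in> ball 0 t" for z
    proof -
      have "\<forall>\<^sub>F w in nhds 0. g (p + w *s (z - p)) = 0"
        by (rule eventually_compose_filterlim[OF ev tendsto_line])
      from identity_along_line[OF t(3) p(1) _ this] show ?thesis using z by simp
    qed
    then show False using zero[OF t(3)] ab g(3) by blast
  qed
qed

lemma line_series_nth_0:
  assumes "holomorphic_near 0 f"
  shows "fps_nth (line_series v (abs_germ f)) 0 = f 0"
  using has_fps_expansion_imp_0_eq_fps_nth_0[OF line_series_expansion[OF assms, of v]] by simp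

lemma germ_dvd_1_iff:
  "a dvd 1 \<longleftrightarrow> fps_nth (line_series v a) 0 \<noteq> 0"
proof
  assume "a dvd 1"
  then obtain b where "1 = a * b" by (auto simp: dvd_def)
  then have "line_series v a * line_series v b = 1" by (metis line_series_mult line_series_1)
  then have "fps_nth (line_series v a * line_series v b) 0 = 1" by simp
  then show "fps_nth (line_series v a) 0 \<noteq> 0" by auto
next
  assume nz: "fps_nth (line_series v a) 0 \<noteq> 0"
  obtain f r where f: "0 < r" "f mholomorphic_on ball 0 r" "a = abs_germ f" by (rule germ_cases)
  have near: "holomorphic_near 0 f" by (rule holomorphic_nearI[OF f(1,2)])
  have "f 0 \<noteq> 0" using nz line_series_nth_0[OF near] f(3) by simp
  define U where "U = {z \<in> ball 0 r. f z \<in> - {0}}"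
  have "open U"
    unfolding U_def
    using continuous_open_preimage[OF mholomorphic_on_imp_continuous_on[OF f(2)] open_ball, of "- {0}"]
    by (simp add: vimage_def Int_def open_Compl)
  have "0 \<in> U" using \<open>f 0 \<noteq> 0\<close> f(1) by (simp add: U_def)
  have "(\<lambda>z. inverse (f z)) mholomorphic_on U"
    by (rule mholomorphic_on_inverse[OF mholomorphic_on_subset[OF f(2)]]) (auto simp: U_def)
  then have near': "holomorphic_near 0 (\<lambda>z. inverse (f z))"
    unfolding holomorphic_near_def using \<open>open U\<close> \<open>0 \<in> U\<close> by blast
  have "\<forall>\<^sub>F z in nhds 0. z \<in> U" using \<open>open U\<close> \<open>0 \<in> U\<close> by (rule eventually_nhds_in_open)
  then have "\<forall>\<^sub>F z in nhds 0. f z * inverse (f z) = (\<lambda>_. 1) z"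
    by (rule eventually_mono) (simp add: U_def)
  then have "abs_germ (\<lambda>z. f z * inverse (f z)) = abs_germ (\<lambda>_. 1)"
    using holomorphic_near_mult[OF near near'] holomorphic_near_const by (subst abs_germ_eq_iff)
  then have "a * abs_germ (\<lambda>z. inverse (f z)) = 1"
    unfolding f(3) abs_germ_times[OF near near'] by (simp add: one_germ_def)
  then show "a dvd 1" by (metis dvd_triv_left)
qed

text \<open>Along a line on which \<open>a\<close> does not vanish identically, every nonunit factor has positive order.\<close>

lemma germ_bounded_factorization:
  fixes a :: "'n::finite germ"
  assumes "a \<noteq> 0"
  shows "\<exists>n. \<forall>ps. (\<forall>p\<in>set ps. \<not> p dvd 1) \<longrightarrow> prod_list ps dvd a \<longrightarrow> length ps < n"
proof -
  obtain v where v: "line_series v a \<noteq> 0" using exists_line_series_nonzero[OF assms] by blast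
  have len: "length ps \<le> subdegree (line_series v (prod_list ps))"
    if "\<forall>p\<in>set ps. \<not> p dvd 1" "line_series v (prod_list ps) \<noteq> 0" for ps :: "'n germ list"
    using that
  proof (induction ps)
    case (Cons p ps)
    then have nz: "line_series v p \<noteq> 0" "line_series v (prod_list ps) \<noteq> 0"
      by (auto simp: line_series_mult)
    have "fps_nth (line_series v p) 0 = 0" using Cons.prems(1) germ_dvd_1_iff[of p v] by simp
    then have "subdegree (line_series v p) \<noteq> 0" using nz(1) by (simp add: subdegree_eq_0_iff)
    then show ?case using Cons nz by (simp add: line_series_mult)
  qed simp
  show ?thesis
  proof (intro exI allI impI)
    fix ps :: "'n germ list"
    assume ps: "\<forall>p\<in>set ps. \<not> p dvd 1" "prod_list ps dvd a"
    then obtain b where b: "a = prod_list ps * b" by (auto simp: dvd_def)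
    then have "line_series v (prod_list ps) \<noteq> 0" "line_series v b \<noteq> 0"
      using v by (auto simp: line_series_mult)
    then have "subdegree (line_series v (prod_list ps)) \<le> subdegree (line_series v a)"
      by (simp add: b line_series_mult)
    then show "length ps < Suc (subdegree (line_series v a))"
      using len[OF ps(1) \<open>line_series v (prod_list ps) \<noteq> 0\<close>] by simp
  qed
qed

section \<open>Germs in two variables\<close>

definition coordinate :: "'n \<Rightarrow> 'n::finite germ" where
  "coordinate i = abs_germ (\<lambda>z. z $ i)"

definition germ2 :: "'n \<Rightarrow> 'n \<Rightarrow> (complex \<Rightarrow> complex \<Rightarrow> complex) \<Rightarrow> 'n::finite germ" where
  "germ2 i j F = abs_germ (\<lambda>z. F (z $ i) (z $ j))"

lemma holomorphic_near_coordinate: "holomorphic_near p (\<lambda>z :: complex ^ 'n::finite. z $ i)"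
proof -
  have "((\<lambda>z :: complex ^ 'n. z $ i) has_derivative (\<lambda>h. \<Sum>k\<in>UNIV. axis i 1 $ k * h $ k)) (at z)" for z
  proof -
    have "(\<Sum>k\<in>UNIV. axis i 1 $ k * h $ k) = h $ i" for h :: "complex ^ 'n"
      by (simp add: axis_def if_distrib[of "\<lambda>a. a * _"] cong: if_cong)
    then show ?thesis by (simp add: bounded_linear_imp_has_derivative bounded_linear_vec_nth)
  qed
  then have "(\<lambda>z :: complex ^ 'n. z $ i) mholomorphic_on UNIV"
    unfolding mholomorphic_on_def by blast
  then show ?thesis unfolding holomorphic_near_def by (intro exI[of _ UNIV]) auto
qed

lemma line_series_coordinate: "line_series v (coordinate i) = fps_const (v $ i) * fps_X"
  unfolding coordinate_def
proof (rule line_series_eqI[OF holomorphic_near_coordinate])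
  have "(\<lambda>w. v $ i * w) has_fps_expansion fps_const (v $ i) * fps_X"
    by (intro fps_expansion_intros)
  then show "(\<lambda>w. (w *s v) $ i) has_fps_expansion fps_const (v $ i) * fps_X"
    by (simp add: mult.commute)
qed

locale two_coordinates =
  fixes i j :: "'n::finite"
  assumes i_neq_j: "i \<noteq> j" and UNIV_eq: "UNIV = {i, j}"
begin

lemma two_coordinates_swap: "two_coordinates j i"
  using i_neq_j UNIV_eq by unfold_locales auto

lemma germ2_holomorphic:
  assumes F: "holomorphic_on_bidisc r F" and "0 < r"
  shows "holomorphic_near 0 (\<lambda>z. F (z $ i) (z $ j))"
proof -
  have "(\<lambda>z. F (z $ i) (z $ j)) mholomorphic_on ball 0 r"
    unfolding mholomorphic_on_def
  proof
    fix z :: "complex ^ 'n"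
    assume z: "z \<in> ball 0 r"
    have "norm (z $ k) < r" for k using z Finite_Cartesian_Product.norm_nth_le[of z k] by simp
    then obtain a b where ab: "((\<lambda>(u, v). F u v) has_derivative (\<lambda>(s, t). a * s + b * t)) (at (z $ i, z $ j))"
      using bidisc_has_derivative[OF F, of "z $ i" "z $ j"] by auto
    have "((\<lambda>z. (z $ i, z $ j)) has_derivative (\<lambda>h. (h $ i, h $ j))) (at z)"
      by (intro has_derivative_Pair bounded_linear_imp_has_derivative bounded_linear_vec_nth)
    from has_derivative_compose[OF this ab]
    have "((\<lambda>z. F (z $ i) (z $ j)) has_derivative (\<lambda>h. a * h $ i + b * h $ j)) (at z)" by simp
    moreover have "a * h $ i + b * h $ j = (\<Sum>k\<in>UNIV. (\<chi> k. if k = i then a else b) $ k * h $ k)"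
      for h :: "complex ^ 'n"
      unfolding UNIV_eq using i_neq_j by simp
    ultimately show "\<exists>c. ((\<lambda>z. F (z $ i) (z $ j)) has_derivative (\<lambda>h. \<Sum>k\<in>UNIV. c $ k * h $ k)) (at z)"
      by (intro exI[of _ "\<chi> k. if k = i then a else b"]) simp
  qed
  then show ?thesis using \<open>0 < r\<close> by (rule holomorphic_nearI[rotated])
qed

lemma germ2_cases:
  obtains F r where "0 < r" "holomorphic_on_bidisc r F" "a = germ2 i j F"
proof -
  obtain f r where f: "0 < r" "f mholomorphic_on ball 0 r" "a = abs_germ f" by (rule germ_cases)
  define V :: "complex \<Rightarrow> complex \<Rightarrow> complex ^ 'n" where "V u v = (\<chi> k. if k = i then u else v)" for u v
  define F where "F u v = f (V u v)" for u v
  define s where "s = r / 2"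
  have VB: "V u v \<in> ball 0 r" if "u \<in> ball 0 s" "v \<in> ball 0 s" for u v
  proof -
    have "norm (V u v) \<le> (\<Sum>k\<in>UNIV. norm (V u v $ k))"
      unfolding norm_vec_def by (rule L2_set_le_sum) simp
    also have "\<dots> = norm u + norm v" unfolding UNIV_eq using i_neq_j by (simp add: V_def)
    also have "\<dots> < r" using that by (simp add: s_def)
    finally show ?thesis by simp
  qed
  have "continuous_on (ball 0 s \<times> ball 0 s) (\<lambda>q. V (fst q) (snd q))"
    unfolding V_def
  proof (rule continuous_on_vec_lambda)
    fix k
    show "continuous_on (ball 0 s \<times> ball 0 s) (\<lambda>q. if k = i then fst q else snd q :: complex)"
      by (cases "k = i") (auto intro!: continuous_intros)
  qed
  then have "continuous_on (ball 0 s \<times> ball 0 s) (\<lambda>q. f (V (fst q) (snd q)))"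
    by (rule continuous_on_compose2[OF mholomorphic_on_imp_continuous_on[OF f(2)]]) (use VB in auto)
  moreover have "(\<lambda>u. F u v) holomorphic_on ball 0 s" if v: "v \<in> ball 0 s" for v
  proof -
    have eq: "V u v = V 0 v + u *s axis i 1" for u
      by (auto simp: V_def vec_eq_iff axis_def)
    have "(\<lambda>u. f (V 0 v + u *s axis i 1)) holomorphic_on ball 0 s"
      by (rule holomorphic_on_line[OF f(2)]) (use VB v eq in metis)
    then show ?thesis unfolding F_def eq[symmetric] .
  qed
  moreover have "F u holomorphic_on ball 0 s" if u: "u \<in> ball 0 s" for u
  proof -
    have eq: "V u v = V u 0 + v *s axis j 1" for v
      using i_neq_j UNIV_eq by (auto simp: V_def vec_eq_iff axis_def)
    have "(\<lambda>v. f (V u 0 + v *s axis j 1)) holomorphic_on ball 0 s"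
      by (rule holomorphic_on_line[OF f(2)]) (use VB u eq in metis)
    then show ?thesis unfolding F_def[abs_def] eq[symmetric] .
  qed
  ultimately have "holomorphic_on_bidisc s F"
    unfolding holomorphic_on_bidisc_def case_prod_unfold F_def by blast
  moreover have "V (z $ i) (z $ j) = z" for z
    using UNIV_eq by (auto simp: V_def vec_eq_iff)
  then have "a = germ2 i j F" unfolding germ2_def F_def f(3) by simp
  ultimately show ?thesis using that[of s F] f(1) by (simp add: s_def)
qed

lemma eventually_bidisc:
  assumes "0 < r" "\<And>u v. u \<in> ball 0 r \<Longrightarrow> v \<in> ball 0 r \<Longrightarrow> P u v"
  shows "\<forall>\<^sub>F z :: complex ^ 'n in nhds 0. P (z $ i) (z $ j)"
proof -
  have "\<forall>\<^sub>F z :: complex ^ 'n in nhds 0. z \<in> ball 0 r" using assms(1) by (intro eventually_nhds_in_open) auto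
  then show ?thesis
  proof (rule eventually_mono)
    fix z :: "complex ^ 'n"
    assume "z \<in> ball 0 r"
    then have "norm (z $ k) < r" for k using Finite_Cartesian_Product.norm_nth_le[of z k] by simp
    then show "P (z $ i) (z $ j)" using assms(2) by simp
  qed
qed

lemma germ2_eqI:
  assumes "holomorphic_on_bidisc r F" "holomorphic_on_bidisc s G" "0 < r" "0 < s" "0 < t"
    and "\<And>u v. u \<in> ball 0 t \<Longrightarrow> v \<in> ball 0 t \<Longrightarrow> F u v = G u v"
  shows "germ2 i j F = germ2 i j G"
proof -
  have "\<forall>\<^sub>F z :: complex ^ 'n in nhds 0. F (z $ i) (z $ j) = G (z $ i) (z $ j)"
    using assms(5,6) by (rule eventually_bidisc)
  then show ?thesis
    unfolding germ2_def
    using abs_germ_eq_iff[OF germ2_holomorphic[OF assms(1,3)] germ2_holomorphic[OF assms(2,4)]] by simp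
qed

lemma germ2_eqD:
  assumes F: "holomorphic_on_bidisc r F" and G: "holomorphic_on_bidisc s G" and "0 < r" "0 < s"
    and "germ2 i j F = germ2 i j G"
  obtains t where "0 < t" "\<And>u v. u \<in> ball 0 t \<Longrightarrow> v \<in> ball 0 t \<Longrightarrow> F u v = G u v"
proof -
  have "\<forall>\<^sub>F z in nhds 0. F (z $ i) (z $ j) = G (z $ i) (z $ j)"
    using assms(5) germ2_holomorphic[OF F \<open>0 < r\<close>] germ2_holomorphic[OF G \<open>0 < s\<close>]
    unfolding germ2_def by (simp add: abs_germ_eq_iff)
  then obtain t where t: "0 < t" "\<And>z. z \<in> ball 0 t \<Longrightarrow> F (z $ i) (z $ j) = G (z $ i) (z $ j)"
    unfolding eventually_nhds_metric by (auto simp: dist_commute)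
  have "F u v = G u v" if "u \<in> ball 0 (t / 2)" "v \<in> ball 0 (t / 2)" for u v
  proof -
    define z :: "complex ^ 'n" where "z = (\<chi> k. if k = i then u else v)"
    have "norm z \<le> (\<Sum>k\<in>UNIV. norm (z $ k))"
      unfolding norm_vec_def by (rule L2_set_le_sum) simp
    also have "\<dots> = norm u + norm v" unfolding UNIV_eq using i_neq_j by (simp add: z_def)
    also have "\<dots> < t" using that by simp
    finally have "F (z $ i) (z $ j) = G (z $ i) (z $ j)" by (intro t(2)) simp
    then show ?thesis using i_neq_j by (simp add: z_def)
  qed
  then show ?thesis using that[of "t / 2"] t(1) by simp
qed

lemma germ2_mult:
  "holomorphic_on_bidisc r F \<Longrightarrow> holomorphic_on_bidisc s G \<Longrightarrow> 0 < r \<Longrightarrow> 0 < s \<Longrightarrow>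
   germ2 i j F * germ2 i j G = germ2 i j (\<lambda>u v. F u v * G u v)"
  unfolding germ2_def by (rule abs_germ_times) (rule germ2_holomorphic; assumption)+

lemma germ2_add:
  "holomorphic_on_bidisc r F \<Longrightarrow> holomorphic_on_bidisc s G \<Longrightarrow> 0 < r \<Longrightarrow> 0 < s \<Longrightarrow>
   germ2 i j F + germ2 i j G = germ2 i j (\<lambda>u v. F u v + G u v)"
  unfolding germ2_def by (rule abs_germ_plus) (rule germ2_holomorphic; assumption)+

lemma coordinate_eq_germ2: "coordinate i = germ2 i j (\<lambda>u v. u)" "coordinate j = germ2 i j (\<lambda>u v. v)"
  by (simp_all add: coordinate_def germ2_def)

lemma holomorphic_on_bidisc_add:
  "holomorphic_on_bidisc r F \<Longrightarrow> holomorphic_on_bidisc r G \<Longrightarrow>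
   holomorphic_on_bidisc r (\<lambda>u v. F u v + G u v)"
  unfolding holomorphic_on_bidisc_def case_prod_unfold
  by (auto intro!: continuous_intros holomorphic_intros)

lemma bidisc_coordinates:
  "holomorphic_on_bidisc r (\<lambda>u v. u)" "holomorphic_on_bidisc r (\<lambda>u v. v)"
  unfolding holomorphic_on_bidisc_def case_prod_unfold
  by (auto intro!: continuous_intros holomorphic_intros)

lemma bidisc_power: "holomorphic_on_bidisc r F \<Longrightarrow> holomorphic_on_bidisc r (\<lambda>u v. F u v ^ k)"
  unfolding holomorphic_on_bidisc_def case_prod_unfold
  by (auto intro!: continuous_intros holomorphic_intros)

lemma germ2_coordinate_power: "coordinate i ^ k = germ2 i j (\<lambda>u v. u ^ k)"
proof (induction k)
  case 0
  show ?case by (simp add: germ2_def one_germ_def)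
next
  case (Suc k)
  then show ?case
    using germ2_mult[OF bidisc_coordinates(1)[of 1] bidisc_power[OF bidisc_coordinates(1)[of 1]], of k]
    by (simp add: coordinate_eq_germ2)
qed

lemma line_series_germ2_expansion:
  assumes "holomorphic_on_bidisc r F" "0 < r"
  shows "(\<lambda>w. F w 0) has_fps_expansion line_series (axis i 1) (germ2 i j F)"
    "(\<lambda>w. F 0 w) has_fps_expansion line_series (axis j 1) (germ2 i j F)"
  using line_series_expansion[OF germ2_holomorphic[OF assms], of "axis i 1"]
    line_series_expansion[OF germ2_holomorphic[OF assms], of "axis j 1"] i_neq_j
  by (simp_all add: germ2_def axis_def)

lemma coordinate_j_dvd:
  assumes "line_series (axis i 1) a = 0"
  shows "coordinate j dvd a"
proof -
  obtain F r where F: "0 < r" "holomorphic_on_bidisc r F" "a = germ2 i j F" by (rule germ2_cases)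
  have "(\<lambda>w. F w 0) has_fps_expansion 0"
    using line_series_germ2_expansion(1)[OF F(2,1)] assms F(3) by simp
  then have "\<forall>\<^sub>F w in nhds 0. F w 0 = 0"
    by (auto simp: has_fps_expansion_def elim: eventually_mono)
  then obtain s where s: "0 < s" "\<And>u. u \<in> ball 0 s \<Longrightarrow> F u 0 = 0"
    unfolding eventually_nhds_metric by (auto simp: dist_commute)
  define t where "t = min r s"
  have t: "0 < t" "holomorphic_on_bidisc t F"
    using F s by (auto simp: t_def intro: holomorphic_on_bidisc_mono)
  have "\<exists>Q. holomorphic_on_bidisc (t / 2) Q \<and> (\<forall>u\<in>ball 0 (t/2). \<forall>v\<in>ball 0 (t/2). F u v = v * Q u v)"
    by (rule bidisc_division[OF t(2,1)]) (use s in \<open>auto simp: t_def\<close>)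
  then obtain Q where Q: "holomorphic_on_bidisc (t / 2) Q"
    "\<And>u v. u \<in> ball 0 (t/2) \<Longrightarrow> v \<in> ball 0 (t/2) \<Longrightarrow> F u v = v * Q u v" by blast
  have t2: "0 < t / 2" using t by simp
  have "a = germ2 i j (\<lambda>u v. v * Q u v)"
    unfolding F(3)
    by (rule germ2_eqI[OF t(2) holomorphic_on_bidisc_mult[OF bidisc_coordinates(2) Q(1)] t(1) t2 t2])
       (rule Q(2))
  also have "\<dots> = coordinate j * germ2 i j Q"
    unfolding coordinate_eq_germ2 using germ2_mult[OF bidisc_coordinates(2)[of 1] Q(1) _ t2] by simp
  finally show ?thesis by simp
qed

lemma coordinate_i_dvd_iff: "coordinate i dvd a \<longleftrightarrow> line_series (axis j 1) a = 0"
proof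
  interpret swap: two_coordinates j i by (rule two_coordinates_swap)
  show "line_series (axis j 1) a = 0 \<Longrightarrow> coordinate i dvd a" by (rule swap.coordinate_j_dvd)
  assume "coordinate i dvd a"
  then obtain b where "a = coordinate i * b" by (auto simp: dvd_def)
  then show "line_series (axis j 1) a = 0"
    using i_neq_j by (simp add: line_series_mult line_series_coordinate axis_def)
qed

lemma coordinate_j_line: "line_series (axis j 1) (coordinate j) = fps_X"
  by (simp add: line_series_coordinate axis_def)

lemma coordinate_i_prime: "prime_elem (coordinate i)"
proof (rule prime_elemI)
  show "coordinate i \<noteq> 0"
  proof
    assume "coordinate i = 0"
    then have "line_series (axis i 1) (coordinate i) = 0" by (simp add: line_series_0)
    then show False by (simp add: line_series_coordinate axis_def)
  qed
  show "\<not> coordinate i dvd 1"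
    using germ_dvd_1_iff[of "coordinate i" "axis j 1"] i_neq_j by (simp add: line_series_coordinate axis_def)
qed (auto simp: coordinate_i_dvd_iff line_series_mult)

text \<open>A germ vanishing at the origin differs from its restriction to the second axis, regarded as a germ
  in two variables, by a multiple of the first coordinate; the restriction itself is a multiple of the
  second coordinate.\<close>

lemma maximal_ideal: "\<not> a dvd 1 \<longleftrightarrow> (\<exists>b c. a = coordinate i * b + coordinate j * c)"
proof
  assume "\<not> a dvd 1"
  then have a0: "fps_nth (line_series (axis i 1) a) 0 = 0" using germ_dvd_1_iff by blast
  obtain F r where F: "0 < r" "holomorphic_on_bidisc r F" "a = germ2 i j F" by (rule germ2_cases)
  have F0: "F 0 0 = 0"
    using has_fps_expansion_imp_0_eq_fps_nth_0[OF line_series_germ2_expansion(1)[OF F(2,1)]] a0 F(3) by simp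
  have G: "holomorphic_on_bidisc r (\<lambda>u v. F 0 v)"
  proof -
    have "continuous_on (ball 0 r \<times> ball 0 r) (\<lambda>(u, v). F u v)"
      using F(2) by (simp add: holomorphic_on_bidisc_def)
    then have "continuous_on (ball 0 r \<times> ball 0 r) (\<lambda>q. F 0 (snd q))"
      by (rule continuous_on_compose_pair) (use F(1) in \<open>auto intro!: continuous_intros\<close>)
    then show ?thesis
      using F(1,2) by (simp add: holomorphic_on_bidisc_def case_prod_unfold)
  qed
  define b where "b = germ2 i j (\<lambda>u v. F 0 v)"
  have "line_series (axis i 1) b = 0"
    using line_series_germ2_expansion(1)[OF G F(1)] unfolding F0 b_def
    by (rule fps_expansion_unique_complex) simp
  then have "coordinate j dvd b" by (rule coordinate_j_dvd)
  then obtain c where c: "b = coordinate j * c" by (auto simp: dvd_def)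
  have "line_series (axis j 1) a = line_series (axis j 1) b"
    using line_series_germ2_expansion(2)[OF F(2,1)] line_series_germ2_expansion(2)[OF G F(1)]
    unfolding b_def F(3) by (rule fps_expansion_unique_complex)
  then have "coordinate i dvd a - b" unfolding coordinate_i_dvd_iff line_series_diff by simp
  then obtain d where "a - b = coordinate i * d" by (auto simp: dvd_def)
  then have "a = coordinate i * d + coordinate j * c" using c by (simp add: algebra_simps)
  then show "\<exists>b c. a = coordinate i * b + coordinate j * c" by blast
next
  assume "\<exists>b c. a = coordinate i * b + coordinate j * c"
  then obtain b c where "a = coordinate i * b + coordinate j * c" by blast
  then have "fps_nth (line_series (axis i 1) a) 0 = 0"
    by (simp add: line_series_add line_series_mult line_series_coordinate)
  then show "\<not> a dvd 1" using germ_dvd_1_iff by blast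
qed

text \<open>Induction on the order of \<open>a\<close> along the second axis: if \<open>a\<close> is not a unit, it is a combination of
  the coordinates, and the coefficient of the second one has smaller order.\<close>

lemma coordinate_leading_term:
  assumes "\<not> coordinate i dvd a"
  shows "\<exists>u m b. u dvd 1 \<and> a = u * coordinate j ^ m + coordinate i * b"
  using assms
proof (induction "subdegree (line_series (axis j 1) a)" arbitrary: a)
  case 0
  then have "line_series (axis j 1) a \<noteq> 0" by (simp add: coordinate_i_dvd_iff)
  then have "fps_nth (line_series (axis j 1) a) 0 \<noteq> 0" using 0(1) by (simp add: subdegree_eq_0_iff)
  then have "a dvd 1" using germ_dvd_1_iff by blast
  then show ?case by (intro exI[of _ a] exI[of _ 0]) simp
next
  case (Suc n)
  then have nz: "line_series (axis j 1) a \<noteq> 0" by (simp add: coordinate_i_dvd_iff)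
  have "fps_nth (line_series (axis j 1) a) 0 = 0" using Suc(2) by (intro nth_less_subdegree_zero) simp
  then have "\<not> a dvd 1" using germ_dvd_1_iff by blast
  then obtain b c where a: "a = coordinate i * b + coordinate j * c" using maximal_ideal by blast
  have line: "line_series (axis j 1) a = fps_X * line_series (axis j 1) c"
    unfolding a using i_neq_j
    by (simp add: line_series_add line_series_mult coordinate_j_line line_series_coordinate axis_def)
  then have "line_series (axis j 1) c \<noteq> 0" "subdegree (line_series (axis j 1) c) = n"
    using nz Suc(2) by auto
  then obtain u m d where "u dvd 1" "c = u * coordinate j ^ m + coordinate i * d"
    using Suc(1)[of c] by (auto simp: coordinate_i_dvd_iff)
  then have "u dvd 1 \<and> a = u * coordinate j ^ Suc m + coordinate i * (b + coordinate j * d)"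
    unfolding a by (simp add: algebra_simps)
  then show ?case by blast
qed

text \<open>The remainder of \<open>h\<close> in the division by \<open>g\<close> is divisible by every power of the first coordinate,
  so it vanishes by the bound on factorizations.\<close>

lemma coordinate_adically_closed:
  assumes g: "\<not> coordinate i dvd g" and approx: "\<And>k. \<exists>u v. h = g * u + coordinate i ^ k * v"
  shows "g dvd h"
proof -
  obtain G r where G: "0 < r" "holomorphic_on_bidisc r G" "g = germ2 i j G" by (rule germ2_cases)
  obtain H r' where H: "0 < r'" "holomorphic_on_bidisc r' H" "h = germ2 i j H" by (rule germ2_cases)
  have exp: "(\<lambda>w. G 0 w) has_fps_expansion line_series (axis j 1) g"
    using line_series_germ2_expansion(2)[OF G(2,1)] G(3) by simp
  have "line_series (axis j 1) g \<noteq> 0" using g by (simp add: coordinate_i_dvd_iff)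
  then have "\<not> (\<lambda>w. G 0 w) has_fps_expansion 0"
    using fps_expansion_unique_complex[OF exp] by blast
  moreover have "(\<lambda>w. G 0 w) has_fps_expansion 0" if "\<And>w. w \<in> ball 0 r \<Longrightarrow> G 0 w = 0"
  proof -
    have "\<forall>\<^sub>F w in nhds 0. w \<in> ball (0 :: complex) r" using G(1) by (intro eventually_nhds_in_open) auto
    then have "\<forall>\<^sub>F w in nhds 0. G 0 w = (\<lambda>_. 0) w" by (rule eventually_mono) (simp add: that)
    then show ?thesis using has_fps_expansion_0 by (simp add: has_fps_expansion_cong)
  qed
  ultimately obtain w0 where w0: "w0 \<in> ball 0 r" "G 0 w0 \<noteq> 0" by blast
  have "G 0 holomorphic_on ball 0 r" using G(1,2) by (simp add: holomorphic_on_bidisc_def)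
  then have "\<forall>\<^sub>F w in at 0. G 0 w \<noteq> 0 \<and> w \<in> ball 0 r"
    by (rule non_zero_neighbour_alt) (use w0 G(1) in auto)
  then have "\<forall>\<^sub>F w in at 0. G 0 w \<noteq> 0" by (rule eventually_mono) simp
  then obtain q where q: "0 < q" "\<And>w. w \<noteq> 0 \<Longrightarrow> w \<in> ball 0 q \<Longrightarrow> G 0 w \<noteq> 0"
    unfolding eventually_at by (auto simp: dist_commute)
  define s where "s = min q (min r r')"
  have s: "0 < s" "holomorphic_on_bidisc s G" "holomorphic_on_bidisc s H"
    using q G H by (auto simp: s_def intro: holomorphic_on_bidisc_mono)
  have nz: "G 0 w \<noteq> 0" if "w \<noteq> 0" "w \<in> ball 0 s" for w using q(2) that by (simp add: s_def)
  obtain Q t where Q: "0 < t" "t \<le> s" "holomorphic_on_bidisc t Q"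
    and rem: "\<forall>k U V t. 0 < t \<longrightarrow> holomorphic_on_bidisc t U \<longrightarrow> holomorphic_on_bidisc t V \<longrightarrow>
       (\<forall>u\<in>ball 0 t. \<forall>v\<in>ball 0 t. H u v = G u v * U u v + u ^ k * V u v) \<longrightarrow>
       (\<exists>d>0. \<exists>W. holomorphic_on_bidisc d W \<and>
         (\<forall>u\<in>ball 0 d. \<forall>v\<in>ball 0 d. H u v - G u v * Q u v = u ^ k * W u v))"
    using weierstrass_remainder[OF s(2,3,1) nz] by blast
  have GQ: "holomorphic_on_bidisc t (\<lambda>u v. G u v * Q u v)"
    by (intro holomorphic_on_bidisc_mult holomorphic_on_bidisc_mono[OF s(2) Q(2)] Q(3))
  have E: "holomorphic_on_bidisc t (\<lambda>u v. H u v - G u v * Q u v)"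
    by (intro holomorphic_on_bidisc_diff GQ holomorphic_on_bidisc_mono[OF s(3) Q(2)])
  define e where "e = germ2 i j (\<lambda>u v. H u v - G u v * Q u v)"
  have "e + g * germ2 i j Q = germ2 i j (\<lambda>u v. H u v - G u v * Q u v + G u v * Q u v)"
    unfolding e_def G(3) germ2_mult[OF s(2) Q(3) s(1) Q(1)] by (rule germ2_add[OF E GQ Q(1) Q(1)])
  also have "\<dots> = h" by (simp add: H(3))
  finally have h: "h = e + g * germ2 i j Q" ..
  have "coordinate i ^ k dvd e" for k
  proof -
    obtain u v where uv: "h = g * u + coordinate i ^ k * v" using approx by blast
    obtain U r1 where U: "0 < r1" "holomorphic_on_bidisc r1 U" "u = germ2 i j U" by (rule germ2_cases)
    obtain V r2 where V: "0 < r2" "holomorphic_on_bidisc r2 V" "v = germ2 i j V" by (rule germ2_cases)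
    define p where "p = min s (min r1 r2)"
    have p: "0 < p" "holomorphic_on_bidisc p U" "holomorphic_on_bidisc p V" "holomorphic_on_bidisc p G"
      using U V s by (auto simp: p_def intro: holomorphic_on_bidisc_mono)
    have xV: "holomorphic_on_bidisc p (\<lambda>u v. u ^ k * V u v)"
      and GU: "holomorphic_on_bidisc p (\<lambda>u v. G u v * U u v)"
      by (intro holomorphic_on_bidisc_mult bidisc_power bidisc_coordinates p)+
    have sum: "holomorphic_on_bidisc p (\<lambda>u v. G u v * U u v + u ^ k * V u v)"
      by (rule holomorphic_on_bidisc_add[OF GU xV])
    have "germ2 i j H = germ2 i j (\<lambda>u v. G u v * U u v + u ^ k * V u v)"
      using uv unfolding H(3) G(3) U(3) V(3) germ2_coordinate_power
        germ2_mult[OF p(4,2,1,1)] germ2_mult[OF bidisc_power[OF bidisc_coordinates(1)] p(3,1,1)]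
        germ2_add[OF GU xV p(1,1)] .
    then obtain t' where t': "0 < t'" "\<And>u v. u \<in> ball 0 t' \<Longrightarrow> v \<in> ball 0 t' \<Longrightarrow>
        H u v = G u v * U u v + u ^ k * V u v"
      using germ2_eqD[OF s(3) sum s(1) p(1)] by metis
    define t'' where "t'' = min t' p"
    have t'': "0 < t''" "holomorphic_on_bidisc t'' U" "holomorphic_on_bidisc t'' V"
      using p t' by (auto simp: t''_def intro: holomorphic_on_bidisc_mono)
    have "\<forall>u\<in>ball 0 t''. \<forall>v\<in>ball 0 t''. H u v = G u v * U u v + u ^ k * V u v"
      using t'(2) by (simp add: t''_def)
    then have "\<exists>d>0. \<exists>W. holomorphic_on_bidisc d W \<and>
         (\<forall>u\<in>ball 0 d. \<forall>v\<in>ball 0 d. H u v - G u v * Q u v = u ^ k * W u v)"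
      using rem t'' by blast
    then obtain d W where W: "0 < d" "holomorphic_on_bidisc d W"
      "\<And>u v. u \<in> ball 0 d \<Longrightarrow> v \<in> ball 0 d \<Longrightarrow> H u v - G u v * Q u v = u ^ k * W u v" by blast
    have "e = germ2 i j (\<lambda>u v. u ^ k * W u v)"
      unfolding e_def
      by (rule germ2_eqI[OF E holomorphic_on_bidisc_mult[OF bidisc_power[OF bidisc_coordinates(1)] W(2)] Q(1) W(1) W(1)])
         (rule W(3))
    also have "\<dots> = coordinate i ^ k * germ2 i j W"
      unfolding germ2_coordinate_power
      by (rule germ2_mult[OF bidisc_power[OF bidisc_coordinates(1)] W(2) W(1,1), symmetric])
    finally show ?thesis by simp
  qed
  have "e = 0"
  proof (rule ccontr)
    assume "e \<noteq> 0"
    then obtain n where n: "\<And>ps. (\<forall>p\<in>set ps. \<not> p dvd 1) \<Longrightarrow> prod_list ps dvd e \<Longrightarrow> length ps < n"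
      using germ_bounded_factorization by blast
    show False
      using n[of "replicate n (coordinate i)"] \<open>\<And>k. coordinate i ^ k dvd e\<close> prime_elem_not_unit[OF coordinate_i_prime]
      by (auto simp: prod_list_replicate)
  qed
  then have "h = g * germ2 i j Q" using h by simp
  then show ?thesis by (rule dvdI)
qed

sublocale plane_local_ring "coordinate i" "coordinate j"
  by unfold_locales
     (rule coordinate_i_prime maximal_ideal coordinate_leading_term coordinate_adically_closed
       germ_bounded_factorization; assumption?)+

end

section \<open>Evaluation of polynomials\<close>

text \<open>Both the map to the Rees algebra and the specialisation of the variables are instances. Proving
  multiplicativity once for a general coefficient map \<open>h\<close> shows that they are ring homomorphisms.\<close>

definition meval :: "('a::comm_ring_1 \<Rightarrow> 'b::comm_ring_1) \<Rightarrow> ('v \<Rightarrow> 'b) \<Rightarrow> ('v, 'a) mpoly \<Rightarrow> 'b" where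
  "meval h g F = (\<Sum>m\<in>Poly_Mapping.keys F.
     h (Poly_Mapping.lookup F m) * (\<Prod>v\<in>Poly_Mapping.keys m. g v ^ Poly_Mapping.lookup m v))"

lemma mpoly_eq_sum_single:
  "(F :: 'm \<Rightarrow>\<^sub>0 'a::comm_monoid_add) =
     (\<Sum>m\<in>Poly_Mapping.keys F. Poly_Mapping.single m (Poly_Mapping.lookup F m))"
proof (rule poly_mapping_eqI)
  fix k
  have "(\<Sum>m\<in>Poly_Mapping.keys F. Poly_Mapping.lookup (Poly_Mapping.single m (Poly_Mapping.lookup F m)) k)
      = (\<Sum>m\<in>Poly_Mapping.keys F. if m = k then Poly_Mapping.lookup F k else 0)"
    by (intro sum.cong) (auto simp: lookup_single when_def)
  also have "\<dots> = Poly_Mapping.lookup F k" by (auto simp: in_keys_iff)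
  finally show "Poly_Mapping.lookup F k = Poly_Mapping.lookup
      (\<Sum>m\<in>Poly_Mapping.keys F. Poly_Mapping.single m (Poly_Mapping.lookup F m)) k"
    by (simp add: lookup_sum)
qed

lemma mpoly_induct [case_names zero single add]:
  assumes "P 0" "\<And>m c. P (Poly_Mapping.single m c)" "\<And>F G. P F \<Longrightarrow> P G \<Longrightarrow> P (F + G)"
  shows "P (F :: 'm \<Rightarrow>\<^sub>0 'a::comm_monoid_add)"
proof -
  have "P (\<Sum>m\<in>A. Poly_Mapping.single m (Poly_Mapping.lookup F m))" if "finite A" for A
    using that by (induction A) (auto intro: assms)
  then show ?thesis using mpoly_eq_sum_single[of F] by (metis finite_keys)
qed

locale coefficient_hom =
  fixes h :: "'a::comm_ring_1 \<Rightarrow> 'b::comm_ring_1"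
  assumes h_one: "h 1 = 1" and h_add: "h (a + b) = h a + h b" and h_mult: "h (a * b) = h a * h b"
begin

lemma h_zero: "h 0 = 0" using h_add[of 0 0] by simp

lemma meval_superset:
  assumes "finite S" "Poly_Mapping.keys F \<subseteq> S"
  shows "meval h g F = (\<Sum>m\<in>S. h (Poly_Mapping.lookup F m) *
           (\<Prod>v\<in>Poly_Mapping.keys m. g v ^ Poly_Mapping.lookup m v))"
  unfolding meval_def by (intro sum.mono_neutral_left) (use assms in \<open>auto simp: in_keys_iff h_zero\<close>)

lemma meval_add: "meval h g (F + G) = meval h g F + meval h g G"
proof -
  let ?S = "Poly_Mapping.keys F \<union> Poly_Mapping.keys G"
  have "finite ?S" "Poly_Mapping.keys (F + G) \<subseteq> ?S" by (simp, rule keys_add)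
  then have "meval h g F = (\<Sum>m\<in>?S. h (Poly_Mapping.lookup F m) *
           (\<Prod>v\<in>Poly_Mapping.keys m. g v ^ Poly_Mapping.lookup m v))"
    "meval h g G = (\<Sum>m\<in>?S. h (Poly_Mapping.lookup G m) *
           (\<Prod>v\<in>Poly_Mapping.keys m. g v ^ Poly_Mapping.lookup m v))"
    "meval h g (F + G) = (\<Sum>m\<in>?S. h (Poly_Mapping.lookup (F + G) m) *
           (\<Prod>v\<in>Poly_Mapping.keys m. g v ^ Poly_Mapping.lookup m v))"
    by (intro meval_superset; blast)+
  then show ?thesis by (simp only: lookup_add h_add distrib_right sum.distrib)
qed

lemma meval_zero [simp]: "meval h g 0 = 0" by (simp add: meval_def)

lemma meval_sum: "meval h g (\<Sum>i\<in>A. F i) = (\<Sum>i\<in>A. meval h g (F i))"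
  by (induction A rule: infinite_finite_induct) (auto simp: meval_add)

lemma meval_single: "meval h g (Poly_Mapping.single m c) =
    h c * (\<Prod>v\<in>Poly_Mapping.keys m. g v ^ Poly_Mapping.lookup m v)"
  by (subst meval_superset[of "{m}"]) (auto simp: h_zero)

lemma monomial_value_superset:
  assumes "finite S" "Poly_Mapping.keys m \<subseteq> S"
  shows "(\<Prod>v\<in>Poly_Mapping.keys m. (g :: 'v \<Rightarrow> 'c::comm_monoid_mult) v ^ Poly_Mapping.lookup m v) =
    (\<Prod>v\<in>S. g v ^ Poly_Mapping.lookup m v)"
  by (intro prod.mono_neutral_left) (use assms in \<open>auto simp: in_keys_iff\<close>)

lemma monomial_value_add:
  "(\<Prod>v\<in>Poly_Mapping.keys (m + n). (g :: 'v \<Rightarrow> 'c::comm_monoid_mult) v ^ Poly_Mapping.lookup (m + n) v) =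
   (\<Prod>v\<in>Poly_Mapping.keys m. g v ^ Poly_Mapping.lookup m v) *
   (\<Prod>v\<in>Poly_Mapping.keys n. g v ^ Poly_Mapping.lookup n v)"
proof -
  let ?S = "Poly_Mapping.keys m \<union> Poly_Mapping.keys n"
  have "finite ?S" "Poly_Mapping.keys (m + n) \<subseteq> ?S" by (simp, rule keys_add)
  then have "(\<Prod>v\<in>Poly_Mapping.keys m. g v ^ Poly_Mapping.lookup m v) = (\<Prod>v\<in>?S. g v ^ Poly_Mapping.lookup m v)"
    "(\<Prod>v\<in>Poly_Mapping.keys n. g v ^ Poly_Mapping.lookup n v) = (\<Prod>v\<in>?S. g v ^ Poly_Mapping.lookup n v)"
    "(\<Prod>v\<in>Poly_Mapping.keys (m + n). g v ^ Poly_Mapping.lookup (m + n) v) =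
       (\<Prod>v\<in>?S. g v ^ Poly_Mapping.lookup (m + n) v)"
    by (intro monomial_value_superset; blast)+
  then show ?thesis by (simp only: lookup_add power_add prod.distrib)
qed

lemma meval_mult: "meval h g (F * G) = meval h g F * meval h g G"
proof (induction F rule: mpoly_induct)
  case (single m c)
  show ?case
  proof (induction G rule: mpoly_induct)
    case (single n d)
    show ?case unfolding mult_single meval_single h_mult monomial_value_add by (simp only: mult_ac)
  next
    case (add F G)
    then show ?case by (simp only: distrib_left meval_add)
  qed simp
next
  case (add F G)
  then show ?case by (simp only: distrib_right meval_add)
qed simp

lemma meval_one [simp]: "meval h g 1 = 1"
  using meval_single[of g 0 1] by (simp add: h_one)

lemma meval_uminus: "meval h g (- F) = - meval h g F"
  using meval_add[of g F "- F"] by (simp add: add_eq_0_iff)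

lemma meval_diff: "meval h g (F - G) = meval h g F - meval h g G"
  using meval_add[of g F "- G"] by (simp add: meval_uminus)

lemma meval_power: "meval h g (F ^ n) = meval h g F ^ n"
  by (induction n) (auto simp: meval_mult)

lemma meval_mconst [simp]: "meval h g (mconst c) = h c"
  by (simp add: mconst_def meval_single)

lemma meval_mvar [simp]: "meval h g (mvar v) = g v"
  by (simp add: mvar_def meval_single h_one)

end

interpretation id_hom: coefficient_hom "\<lambda>c :: 'a::comm_ring_1. c"
  by unfold_locales auto

interpretation const_hom: coefficient_hom "\<lambda>c :: 'a::comm_ring_1. [:c:]"
  by unfold_locales auto

lemma rees_map_eq_meval: "rees_map g = meval (\<lambda>c. [:c:]) (\<lambda>v. monom (g v) 1)"
proof
  fix F
  have "monom (Poly_Mapping.lookup F m * (\<Prod>v\<in>Poly_Mapping.keys m. g v ^ Poly_Mapping.lookup m v)) (mdeg m)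
     = [:Poly_Mapping.lookup F m:] * (\<Prod>v\<in>Poly_Mapping.keys m. monom (g v) 1 ^ Poly_Mapping.lookup m v)" for m
  proof -
    have "(\<Prod>v\<in>A. monom (g v) 1 ^ e v) = monom (\<Prod>v\<in>A. g v ^ e v) (\<Sum>v\<in>A. e v)" for A and e :: "'a \<Rightarrow> nat"
      by (induction A rule: infinite_finite_induct) (auto simp: monom_power mult_monom)
    then show ?thesis by (simp add: mdeg_def smult_monom)
  qed
  then show "rees_map g F = meval (\<lambda>c. [:c:]) (\<lambda>v. monom (g v) 1) F"
    by (simp add: rees_map_def meval_def)
qed

lemma mconst_hom: "mconst (c + d) = mconst c + mconst d" "mconst (c * d) = mconst c * mconst d"
  "mconst 0 = 0" "mconst 1 = 1"
  by (simp_all add: mconst_def single_add mult_single)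

section \<open>Ideals of subrings\<close>

lemma ring_on_simps [simp]:
  "carrier (ring_on S) = S" "mult (ring_on S) = (*)" "one (ring_on S) = 1"
  "zero (ring_on S) = 0" "add (ring_on S) = (+)"
  by (simp_all add: ring_on_def)

lemma cring_ring_on:
  assumes "0 \<in> S" "1 \<in> S" "\<And>a b. a \<in> S \<Longrightarrow> b \<in> S \<Longrightarrow> a + b \<in> S"
    "\<And>a b. a \<in> S \<Longrightarrow> b \<in> S \<Longrightarrow> a * b \<in> S" "\<And>a. a \<in> S \<Longrightarrow> - a \<in> S"
  shows "cring (ring_on (S :: 'a::comm_ring_1 set))"
proof -
  have "\<exists>y\<in>S. y + x = 0" if "x \<in> S" for x using assms(5)[OF that] by (intro bexI[of _ "- x"]) auto
  then show ?thesis
    by (intro cringI abelian_groupI comm_monoidI) (simp_all add: assms algebra_simps)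
qed

lemma ideal_ring_onI:
  assumes cring: "cring (ring_on (S :: 'a::comm_ring_1 set))" and "I \<subseteq> S" "0 \<in> I"
    "\<And>a b. a \<in> I \<Longrightarrow> b \<in> I \<Longrightarrow> a + b \<in> I" "\<And>s a. s \<in> S \<Longrightarrow> a \<in> I \<Longrightarrow> s * a \<in> I"
  shows "ideal I (ring_on S)"
proof -
  interpret cring "ring_on S" by (rule cring)
  have "\<ominus>\<^bsub>ring_on S\<^esub> 1 + 1 = 0" using l_neg[of 1] one_closed by simp
  then have "\<ominus>\<^bsub>ring_on S\<^esub> 1 = - 1" by (simp only: eq_neg_iff_add_eq_0)
  then have "- 1 \<in> S" using a_inv_closed[of 1] one_closed by simp
  then have neg: "- a \<in> I" if "a \<in> I" for a using assms(5)[of "- 1" a] that by simp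
  have inv: "inv\<^bsub>add_monoid (ring_on S)\<^esub> a = - a" if "a \<in> I" for a
    using add.inv_equality[of "- a" a] that neg assms(2) by (auto simp: a_inv_def)
  then have inv': "\<ominus>\<^bsub>ring_on S\<^esub> a = - a" if "a \<in> I" for a
    using that by (simp add: a_inv_def)
  show ?thesis
  proof (rule idealI)
    show "ring (ring_on S)" by (rule ring_axioms)
    show "subgroup I (add_monoid (ring_on S))"
      by (rule add.subgroupI) (use assms(2-4) neg inv' in auto)
    fix a s
    assume "a \<in> I" "s \<in> carrier (ring_on S)"
    then show "s \<otimes>\<^bsub>ring_on S\<^esub> a \<in> I" "a \<otimes>\<^bsub>ring_on S\<^esub> s \<in> I"
      using assms(5)[of s a] by (simp_all add: mult.commute)
  qed
qed

lemma ideal_ring_onD: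
  assumes "ideal I (ring_on (S :: 'a::comm_ring_1 set))"
  shows "I \<subseteq> S" "0 \<in> I" "a \<in> I \<Longrightarrow> b \<in> I \<Longrightarrow> a + b \<in> I" "s \<in> S \<Longrightarrow> a \<in> I \<Longrightarrow> s * a \<in> I"
proof -
  interpret ideal I "ring_on S" by (rule assms)
  show "I \<subseteq> S" using a_subset by simp
  show "0 \<in> I" using additive_subgroup.zero_closed[OF ideal.axioms(1)[OF assms]] by simp
  show "a \<in> I \<Longrightarrow> b \<in> I \<Longrightarrow> a + b \<in> I"
    using additive_subgroup.a_closed[OF ideal.axioms(1)[OF assms], of a b] by simp
  show "s \<in> S \<Longrightarrow> a \<in> I \<Longrightarrow> s * a \<in> I" using I_l_closed by simp
qed

lemma ideal_gen_ideal: "ideal (ideal_gen S) (ring_on UNIV)"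
proof -
  interpret cring "ring_on UNIV :: 'a ring" by (rule cring_ring_on_UNIV)
  show ?thesis by (rule genideal_ideal) simp
qed

lemma ideal_gen_minimal:
  assumes "S \<subseteq> I" "0 \<in> I" "\<And>a b. a \<in> I \<Longrightarrow> b \<in> I \<Longrightarrow> a + b \<in> I" "\<And>s a. a \<in> I \<Longrightarrow> s * a \<in> I"
  shows "ideal_gen S \<subseteq> I"
proof -
  interpret cring "ring_on UNIV :: 'a ring" by (rule cring_ring_on_UNIV)
  have "ideal I (ring_on UNIV)" by (rule ideal_ring_onI) (use assms cring_ring_on_UNIV in auto)
  then show ?thesis using assms(1) by (rule genideal_minimal)
qed

lemma ideal_gen_superset: "S \<subseteq> ideal_gen S"
proof -
  interpret cring "ring_on UNIV :: 'a ring" by (rule cring_ring_on_UNIV)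
  show ?thesis by (rule genideal_self) simp
qed

section \<open>Ideals of linear type\<close>

lemma ideal_power_ideal:
  assumes "ideal I (ring_on UNIV)"
  shows "ideal (ideal_power I d) (ring_on UNIV)"
proof -
  interpret cring "ring_on UNIV :: 'a ring" by (rule cring_ring_on_UNIV)
  show ?thesis
  proof (induction d)
    case 0
    show ?case using oneideal by simp
  qed (use assms in \<open>simp add: ideal_prod_is_ideal\<close>)
qed

lemma ideal_power_mult:
  assumes I: "ideal I (ring_on UNIV)" and "a \<in> ideal_power I m" "b \<in> ideal_power I n"
  shows "a * b \<in> ideal_power I (m + n)"
  using assms(2)
proof (induction m arbitrary: a)
  case 0
  then show ?case using ideal_ring_onD(4)[OF ideal_power_ideal[OF I]] assms(3) by simp
next
  case (Suc m)
  from Suc.prems have "a \<in> ideal_prod (ring_on UNIV) I (ideal_power I m)" by simp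
  then show ?case
  proof (induction a rule: ideal_prod.induct)
    case (prod i j)
    have "i * (j * b) \<in> ideal_prod (ring_on UNIV) I (ideal_power I (m + n))"
      using ideal_prod.prod[of i I "j * b" "ideal_power I (m + n)" "ring_on UNIV"] prod Suc.IH by simp
    then show ?case by (simp add: mult.assoc)
  next
    case (sum s1 s2)
    then show ?case
      using ideal_ring_onD(3)[OF ideal_power_ideal[OF I], of "s1 * b" "Suc m + n" "s2 * b"]
      by (simp add: distrib_right)
  qed
qed

lemma rees_algebra_cring:
  assumes I: "ideal I (ring_on UNIV)"
  shows "cring (rees_algebra I)"
proof -
  note D = ideal_ring_onD[OF ideal_power_ideal[OF I]]
  have sum: "(\<Sum>i\<in>A. f i) \<in> ideal_power I d" if "\<And>i. i \<in> A \<Longrightarrow> f i \<in> ideal_power I d" for f :: "nat \<Rightarrow> 'a" and A d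
    using that by (induction A rule: infinite_finite_induct) (auto simp: D)
  show ?thesis
    unfolding rees_algebra_def
  proof (rule cring_ring_on)
    fix P Q :: "'a poly"
    assume PQ: "P \<in> {P. \<forall>d. coeff P d \<in> ideal_power I d}" "Q \<in> {P. \<forall>d. coeff P d \<in> ideal_power I d}"
    have "coeff P i * coeff Q (d - i) \<in> ideal_power I d" if "i \<le> d" for i d
      using ideal_power_mult[OF I, of "coeff P i" i "coeff Q (d - i)" "d - i"] PQ that by simp
    then show "P * Q \<in> {P. \<forall>d. coeff P d \<in> ideal_power I d}"
      by (auto simp: coeff_mult intro!: sum)
  next
    fix P :: "'a poly"
    assume "P \<in> {P. \<forall>d. coeff P d \<in> ideal_power I d}"
    then have "- 1 * coeff P d \<in> ideal_power I d" for d by (intro D(4)) auto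
    then show "- P \<in> {P. \<forall>d. coeff P d \<in> ideal_power I d}" by simp
  next
    show "1 \<in> {P. \<forall>d. coeff P d \<in> ideal_power I d}" by (auto simp: one_pCons coeff_pCons D simp del: ideal_power.simps(2) split: nat.splits)
  qed (auto simp: D)
qed

definition sym_free_carrier :: "'a::comm_ring_1 set \<Rightarrow> ('a, 'a) mpoly set" where
  "sym_free_carrier I = {F. \<forall>m\<in>Poly_Mapping.keys F. Poly_Mapping.keys m \<subseteq> I}"

lemma sym_free_carrier_closed:
  "0 \<in> sym_free_carrier I" "1 \<in> sym_free_carrier I"
  "F \<in> sym_free_carrier I \<Longrightarrow> G \<in> sym_free_carrier I \<Longrightarrow> F + G \<in> sym_free_carrier I"
  "F \<in> sym_free_carrier I \<Longrightarrow> G \<in> sym_free_carrier I \<Longrightarrow> F * G \<in> sym_free_carrier I"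
  "F \<in> sym_free_carrier I \<Longrightarrow> - F \<in> sym_free_carrier I"
  "mconst c \<in> sym_free_carrier I" "a \<in> I \<Longrightarrow> mvar a \<in> sym_free_carrier I"
proof -
  show "F \<in> sym_free_carrier I \<Longrightarrow> G \<in> sym_free_carrier I \<Longrightarrow> F + G \<in> sym_free_carrier I"
    using keys_add[of F G] unfolding sym_free_carrier_def by blast
  show "F * G \<in> sym_free_carrier I" if F: "F \<in> sym_free_carrier I" and G: "G \<in> sym_free_carrier I"
    unfolding sym_free_carrier_def
  proof safe
    fix m v
    assume "m \<in> Poly_Mapping.keys (F * G)" and v: "v \<in> Poly_Mapping.keys m"
    then obtain a b where ab: "m = a + b" "a \<in> Poly_Mapping.keys F" "b \<in> Poly_Mapping.keys G"
      using keys_mult[of F G] by blast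
    then show "v \<in> I" using keys_add[of a b] v F G unfolding sym_free_carrier_def by blast
  qed
qed (auto simp: sym_free_carrier_def mconst_def mvar_def keys_one)

lemma sym_free_eq: "sym_free I = ring_on (sym_free_carrier I)"
  by (simp add: sym_free_def sym_free_carrier_def)

lemma sym_free_cring: "cring (sym_free I)"
  unfolding sym_free_eq by (rule cring_ring_on) (auto intro: sym_free_carrier_closed)

lemma sym_relations_subset:
  assumes "ideal I (ring_on UNIV)"
  shows "sym_relations I \<subseteq> sym_free_carrier I"
proof -
  note D = ideal_ring_onD[OF assms]
  have diff: "F - G \<in> sym_free_carrier I" if "F \<in> sym_free_carrier I" "G \<in> sym_free_carrier I" for F G
    using sym_free_carrier_closed(3)[OF that(1) sym_free_carrier_closed(5)[OF that(2)]] by simp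
  show ?thesis
    by (auto simp: sym_relations_def intro!: diff sym_free_carrier_closed D)
qed

lemma rees_map_relation:
  assumes "F \<in> sym_relations I"
  shows "rees_map (\<lambda>a. a) F = 0"
  using assms
  by (auto simp: sym_relations_def rees_map_eq_meval const_hom.meval_diff const_hom.meval_mult
        add_monom[symmetric] smult_monom)

text \<open>The canonical map from the symmetric algebra to the Rees algebra is always surjective: by induction
  on \<open>d\<close>, each monomial with coefficient in the \<open>d\<close>-th power of \<open>I\<close> is a sum of products of images of
  variables. So only its kernel matters.\<close>

theorem linear_typeI:
  assumes I: "ideal I (ring_on UNIV)"
    and ker: "\<And>F. F \<in> sym_free_carrier I \<Longrightarrow> rees_map (\<lambda>a. a) F = 0 \<Longrightarrow>
                F \<in> Idl\<^bsub>sym_free I\<^esub> (sym_relations I)"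
  shows "linear_type I"
proof -
  let ?R = "sym_free I" and ?S = "rees_algebra I" and ?h = "rees_map (\<lambda>a :: 'a. a)"
  interpret R: cring ?R by (rule sym_free_cring)
  interpret S: cring ?S by (rule rees_algebra_cring[OF I])
  note D = ideal_ring_onD[OF ideal_power_ideal[OF I]]
  have carrS: "carrier ?S = {P. \<forall>d. coeff P d \<in> ideal_power I d}" by (simp add: rees_algebra_def)
  have opsS: "mult ?S = (*)" "one ?S = 1" "add ?S = (+)" "zero ?S = 0" by (simp_all add: rees_algebra_def)
  have I1: "a \<in> ideal_power I 1" if "a \<in> I" for a
    using ideal_prod.prod[of a I 1 UNIV "ring_on UNIV"] that by simp
  have constS: "[:c:] \<in> carrier ?S" for c by (auto simp: carrS coeff_pCons D simp del: ideal_power.simps(2) split: nat.splits)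
  have varS: "monom a 1 \<in> carrier ?S" if "a \<in> I" for a
    using I1[OF that] D by (auto simp: carrS coeff_monom)
  have powS: "P ^ n \<in> carrier ?S" if "P \<in> carrier ?S" for P n
    using that S.m_closed[unfolded opsS] S.one_closed[unfolded opsS] by (induction n) auto
  have prodS: "(\<Prod>v\<in>A. P v) \<in> carrier ?S" if "\<And>v. v \<in> A \<Longrightarrow> P v \<in> carrier ?S" for A and P :: "'a \<Rightarrow> 'a poly"
    using that S.m_closed[unfolded opsS] S.one_closed[unfolded opsS]
    by (induction A rule: infinite_finite_induct) auto
  have sumS: "(\<Sum>v\<in>A. P v) \<in> carrier ?S" if "\<And>v. v \<in> A \<Longrightarrow> P v \<in> carrier ?S"
    for A and P :: "('a \<Rightarrow>\<^sub>0 nat) \<Rightarrow> 'a poly"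
    using that S.a_closed[unfolded opsS] S.zero_closed[unfolded opsS]
    by (induction A rule: infinite_finite_induct) auto
  have carr: "?h F \<in> carrier ?S" if "F \<in> sym_free_carrier I" for F
    unfolding rees_map_eq_meval meval_def
    by (intro sumS S.m_closed[unfolded opsS] constS prodS powS varS)
       (use that in \<open>auto simp: sym_free_carrier_def\<close>)
  have hom: "ring_hom_ring ?R ?S ?h"
  proof (rule ring_hom_ringI)
    show "ring ?R" "ring ?S" by (rule R.ring_axioms S.ring_axioms)+
    show "?h F \<in> carrier ?S" if "F \<in> carrier ?R" for F using that carr by (simp add: sym_free_eq)
    show "?h (F \<otimes>\<^bsub>?R\<^esub> G) = ?h F \<otimes>\<^bsub>?S\<^esub> ?h G" "?h (F \<oplus>\<^bsub>?R\<^esub> G) = ?h F \<oplus>\<^bsub>?S\<^esub> ?h G" for F G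
      by (simp_all add: sym_free_eq opsS rees_map_eq_meval const_hom.meval_mult const_hom.meval_add)
    show "?h \<one>\<^bsub>?R\<^esub> = \<one>\<^bsub>?S\<^esub>" by (simp add: sym_free_eq opsS rees_map_eq_meval)
  qed
  interpret h: ring_hom_ring ?R ?S ?h by (rule hom)
  have surj_monom: "\<exists>F\<in>sym_free_carrier I. ?h F = monom p d" if "p \<in> ideal_power I d" for p d
    using that
  proof (induction d arbitrary: p)
    case 0
    show ?case
      by (rule bexI[of _ "mconst p"]) (simp_all add: rees_map_eq_meval sym_free_carrier_closed monom_0)
  next
    case (Suc d)
    from Suc.prems have "p \<in> ideal_prod (ring_on UNIV) I (ideal_power I d)" by simp
    then show ?case
    proof (induction p rule: ideal_prod.induct)
      case (prod i j)
      obtain F where F: "F \<in> sym_free_carrier I" "?h F = monom j d" using Suc.IH prod by blast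
      show ?case
        by (rule bexI[of _ "mvar i * F"])
           (use F prod in \<open>auto simp: rees_map_eq_meval const_hom.meval_mult mult_monom
              intro!: sym_free_carrier_closed\<close>)
    next
      case (sum s1 s2)
      then obtain F G where "F \<in> sym_free_carrier I" "?h F = monom s1 (Suc d)"
        "G \<in> sym_free_carrier I" "?h G = monom s2 (Suc d)" by blast
      then show ?case
        by (intro bexI[of _ "F + G"])
           (auto simp: rees_map_eq_meval const_hom.meval_add add_monom intro!: sym_free_carrier_closed)
    qed
  qed
  have surj: "\<exists>F\<in>sym_free_carrier I. ?h F = P" if P: "P \<in> carrier ?S" for P
  proof -
    have "\<exists>F\<in>sym_free_carrier I. ?h F = (\<Sum>d<n. monom (coeff P d) d)" for n
    proof (induction n)
      case 0
      show ?case by (rule bexI[of _ 0]) (simp_all add: rees_map_eq_meval sym_free_carrier_closed)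
    next
      case (Suc n)
      obtain F where F: "F \<in> sym_free_carrier I" "?h F = monom (coeff P n) n"
        using surj_monom[of "coeff P n" n] P unfolding carrS by blast
      obtain G where G: "G \<in> sym_free_carrier I" "?h G = (\<Sum>d<n. monom (coeff P d) d)" using Suc by blast
      show ?case
        by (rule bexI[of _ "G + F"])
           (use F G in \<open>auto simp: rees_map_eq_meval const_hom.meval_add intro!: sym_free_carrier_closed\<close>)
    qed
    from this[of "Suc (degree P)"] show ?thesis
      unfolding lessThan_Suc_atMost poly_as_sum_of_monoms .
  qed
  have image: "?h ` carrier ?R = carrier ?S"
  proof
    show "?h ` carrier ?R \<subseteq> carrier ?S" using carr by (auto simp: sym_free_eq)
    show "carrier ?S \<subseteq> ?h ` carrier ?R"
    proof
      fix P
      assume "P \<in> carrier ?S"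
      then obtain F where "F \<in> sym_free_carrier I" "?h F = P" using surj by blast
      then show "P \<in> ?h ` carrier ?R" by (auto simp: sym_free_eq)
    qed
  qed
  have kernel: "a_kernel ?R ?S ?h = {F \<in> sym_free_carrier I. ?h F = 0}"
    unfolding a_kernel_def' opsS by (simp only: sym_free_eq ring_on_simps)
  have "Idl\<^bsub>?R\<^esub> (sym_relations I) = a_kernel ?R ?S ?h"
  proof
    have "sym_relations I \<subseteq> a_kernel ?R ?S ?h"
      unfolding kernel using sym_relations_subset[OF I] rees_map_relation by blast
    then show "Idl\<^bsub>?R\<^esub> (sym_relations I) \<subseteq> a_kernel ?R ?S ?h"
      by (rule R.genideal_minimal[OF h.kernel_is_ideal])
    show "a_kernel ?R ?S ?h \<subseteq> Idl\<^bsub>?R\<^esub> (sym_relations I)"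
      unfolding kernel using ker by blast
  qed
  moreover have "sym_to_rees = (\<lambda>X. the_elem (?h ` X))" by (rule ext) (simp add: sym_to_rees_def)
  ultimately show ?thesis
    unfolding linear_type_def sym_algebra_def using h.FactRing_iso_set[OF image] by simp
qed

text \<open>Modulo the relations, every variable is a combination of the variables of \<open>a\<close> and \<open>b\<close>. So every
  monomial of degree \<open>d\<close> is congruent to a form of degree \<open>d\<close> in these two, and an element of the
  kernel is, degree by degree, congruent to forms vanishing at \<open>(a, b)\<close>. Such forms lie in the ideal
  of linear relations by \<open>form_in_linear_ideal\<close>.\<close>

theorem linear_type_two_generated:
  fixes a b a' b' l :: "'a::idom"
  assumes I: "I = {u * a + v * b | u v. True}"
    and l: "a = l * a'" "b = l * b'" and "b \<noteq> 0" and reg: "regular_pair a' b'"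
  shows "linear_type I"
proof (rule linear_typeI)
  show I_ideal: "ideal I (ring_on UNIV)"
  proof (rule ideal_ring_onI[OF cring_ring_on_UNIV])
    show "0 \<in> I" unfolding I by (auto intro!: exI[of _ 0])
    fix r s
    assume "s \<in> I"
    then obtain u v where s: "s = u * a + v * b" by (auto simp: I)
    show "r * s \<in> I"
      unfolding I mem_Collect_eq
      by (rule exI[of _ "r * u"], rule exI[of _ "r * v"]) (simp add: s algebra_simps)
    assume "r \<in> I"
    then obtain u' v' where r: "r = u' * a + v' * b" by (auto simp: I)
    show "r + s \<in> I"
      unfolding I mem_Collect_eq
      by (rule exI[of _ "u' + u"], rule exI[of _ "v' + v"]) (simp add: r s algebra_simps)
  qed simp
  note ID = ideal_ring_onD[OF I_ideal]
  have "1 * a + 0 * b \<in> I" "0 * a + 1 * b \<in> I" unfolding I by blast+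
  then have ab: "a \<in> I" "b \<in> I" by simp_all
  let ?T = "sym_free_carrier I" and ?h = "rees_map (\<lambda>a :: 'a. a)"
  define K where "K = Idl\<^bsub>sym_free I\<^esub> (sym_relations I)"
  interpret R: cring "sym_free I" by (rule sym_free_cring)
  have subset: "sym_relations I \<subseteq> carrier (sym_free I)"
    using sym_relations_subset[OF I_ideal] by (simp add: sym_free_eq)
  have "ideal K (ring_on ?T)"
    unfolding K_def sym_free_eq[symmetric] by (rule R.genideal_ideal[OF subset])
  note KD = ideal_ring_onD[OF this]
  have rel: "F \<in> K" if "F \<in> sym_relations I" for F
    using R.genideal_self[OF subset] that unfolding K_def by blast
  have K_minus: "- F \<in> K" if "F \<in> K" for F
    using KD(4)[OF sym_free_carrier_closed(5)[OF sym_free_carrier_closed(2)] that] by simp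
  have K_diff: "F - G \<in> K" if "F \<in> K" "G \<in> K" for F G
    using KD(3)[OF that(1) K_minus[OF that(2)]] by simp
  have hK: "?h F = 0" if "F \<in> K" for F
  proof -
    have "ideal {F \<in> ?T. ?h F = 0} (sym_free I)"
      unfolding sym_free_eq
      by (rule ideal_ring_onI[OF sym_free_cring[unfolded sym_free_eq]])
         (auto simp: rees_map_eq_meval const_hom.meval_add const_hom.meval_mult intro: sym_free_carrier_closed)
    moreover have "sym_relations I \<subseteq> {F \<in> ?T. ?h F = 0}"
      using sym_relations_subset[OF I_ideal] rees_map_relation by blast
    ultimately have "K \<subseteq> {F \<in> ?T. ?h F = 0}" unfolding K_def by (rule R.genideal_minimal)
    then show ?thesis using that by blast
  qed
  let ?U = "mvar a :: ('a, 'a) mpoly" and ?V = "mvar b :: ('a, 'a) mpoly"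
  have UVT: "?U \<in> ?T" "?V \<in> ?T" using ab by (auto intro: sym_free_carrier_closed)
  \<comment> \<open>modulo the relations, the variables depend linearly on their indices\<close>
  have linear: "mvar (c * a + d * b) - (mconst c * ?U + mconst d * ?V) \<in> K" for c d
  proof -
    have "mvar (c * a + d * b) - mvar (c * a) - mvar (d * b) \<in> K"
      by (rule rel) (unfold sym_relations_def, use ab ID(4) in blast)
    moreover have "mvar (c * a) - mconst c * ?U \<in> K" "mvar (d * b) - mconst d * ?V \<in> K"
      by (rule rel, unfold sym_relations_def, use ab in blast)+
    ultimately have "(mvar (c * a + d * b) - mvar (c * a) - mvar (d * b)) +
        ((mvar (c * a) - mconst c * ?U) + (mvar (d * b) - mconst d * ?V)) \<in> K"
      by (intro KD(3))
    then show ?thesis by (simp add: algebra_simps)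
  qed
  have "mvar (0 * 0) - mconst 0 * mvar (0 :: 'a) \<in> K"
    by (rule rel) (unfold sym_relations_def, use ID(2) in blast)
  then have mvar0: "mvar 0 \<in> K" by (simp add: mconst_hom)
  have syz: "mconst c * ?U + mconst d * ?V \<in> K" if "c * a + d * b = 0" for c d
    using K_diff[OF mvar0 linear[of c d, unfolded that]] by (simp add: algebra_simps)
  define form where "form d c = (\<Sum>i\<le>d. mconst (c i) * ?U ^ i * ?V ^ (d - i))" for d and c :: "nat \<Rightarrow> 'a"
  \<comment> \<open>the elements that are congruent to a form of degree \<open>d\<close> in the variables of \<open>a\<close> and \<open>b\<close>\<close>
  define H where "H d = {form d c + k | c k. k \<in> K}" for d
  have T_pow: "F ^ n \<in> ?T" if "F \<in> ?T" for F n
    using that by (induction n) (auto intro: sym_free_carrier_closed)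
  have T_sum: "(\<Sum>i\<in>A. f i) \<in> ?T" if "\<And>i. i \<in> A \<Longrightarrow> f i \<in> ?T" for A and f :: "nat \<Rightarrow> ('a, 'a) mpoly"
    using that by (induction A rule: infinite_finite_induct) (auto intro: sym_free_carrier_closed)
  have formT: "form d c \<in> ?T" for d c
    unfolding form_def by (intro T_sum sym_free_carrier_closed(4,6) T_pow UVT)
  have H_T: "F \<in> ?T" if "F \<in> H d" for F d
    using that formT KD(1) unfolding H_def by (auto intro!: sym_free_carrier_closed(3))
  have H_add: "F + G \<in> H d" if F: "F \<in> H d" and G: "G \<in> H d" for F G d
  proof -
    obtain c k where 1: "F = form d c + k" "k \<in> K" using F unfolding H_def by blast
    obtain c' k' where 2: "G = form d c' + k'" "k' \<in> K" using G unfolding H_def by blast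
    have "F + G = form d (\<lambda>i. c i + c' i) + (k + k')"
      unfolding 1 2 form_def by (simp add: mconst_hom algebra_simps sum.distrib)
    then show ?thesis unfolding H_def using 1 2 KD(3) by blast
  qed
  have H_const: "mconst r * F \<in> H d" if F: "F \<in> H d" for F d r
  proof -
    obtain c k where 1: "F = form d c + k" "k \<in> K" using F unfolding H_def by blast
    have "mconst r * F = form d (\<lambda>i. r * c i) + mconst r * k"
      unfolding 1 form_def by (simp add: mconst_hom algebra_simps sum_distrib_left)
    then show ?thesis unfolding H_def using 1 KD(4) sym_free_carrier_closed(6) by blast
  qed
  have H_U: "?U * F \<in> H (Suc d)" if F: "F \<in> H d" for F d
  proof -
    obtain c k where 1: "F = form d c + k" "k \<in> K" using F unfolding H_def by blast
    have "form (Suc d) (case_nat 0 c) = ?U * form d c"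
      unfolding form_def sum.atMost_Suc_shift by (simp add: mconst_hom sum_distrib_left algebra_simps)
    then have "?U * F = form (Suc d) (case_nat 0 c) + ?U * k" unfolding 1 by (simp add: algebra_simps)
    then show ?thesis unfolding H_def using 1 KD(4) UVT by blast
  qed
  have H_V: "?V * F \<in> H (Suc d)" if F: "F \<in> H d" for F d
  proof -
    obtain c k where 1: "F = form d c + k" "k \<in> K" using F unfolding H_def by blast
    have "form (Suc d) (c(Suc d := 0)) = (\<Sum>i\<le>d. mconst (c i) * ?U ^ i * ?V ^ (Suc d - i))"
      unfolding form_def by (simp add: mconst_hom)
    also have "\<dots> = ?V * form d c"
      unfolding form_def sum_distrib_left
      by (intro sum.cong) (auto simp: Suc_diff_le algebra_simps)
    finally have "?V * F = form (Suc d) (c(Suc d := 0)) + ?V * k" unfolding 1 by (simp add: algebra_simps)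
    then show ?thesis unfolding H_def using 1 KD(4) UVT by blast
  qed
  have H_K: "k + F \<in> H d" if k: "k \<in> K" and F: "F \<in> H d" for k F d
  proof -
    obtain c k' where 1: "F = form d c + k'" "k' \<in> K" using F unfolding H_def by blast
    have "k + F = form d c + (k + k')" unfolding 1 by simp
    then show ?thesis unfolding H_def using 1 KD(3) k by blast
  qed
  have H_mvar: "mvar e * F \<in> H (Suc d)" if e: "e \<in> I" and F: "F \<in> H d" for e F d
  proof -
    obtain u v where uv: "e = u * a + v * b" using e by (auto simp: I)
    let ?k = "mvar e - (mconst u * ?U + mconst v * ?V)"
    have "F * ?k \<in> K" using linear[of u v] H_T[OF F] KD(4) unfolding uv by blast
    moreover have "mconst u * (?U * F) + mconst v * (?V * F) \<in> H (Suc d)"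
      by (intro H_add H_const H_U H_V F)
    ultimately have "F * ?k + (mconst u * (?U * F) + mconst v * (?V * F)) \<in> H (Suc d)" by (rule H_K)
    then show ?thesis by (simp add: algebra_simps)
  qed
  have H_mvar_pow: "mvar e ^ n * F \<in> H (n + d)" if "e \<in> I" "F \<in> H d" for e F d n
    using that by (induction n) (auto simp: mult.assoc intro: H_mvar)
  have one_H: "1 \<in> H 0"
    unfolding H_def mem_Collect_eq
    by (rule exI[of _ "\<lambda>_. 1"], rule exI[of _ 0]) (simp add: form_def mconst_hom KD)
  have H_monomial: "(\<Prod>v\<in>A. mvar v ^ e v) \<in> H (\<Sum>v\<in>A. e v)" if "finite A" "A \<subseteq> I" for A e
    using that by (induction A) (auto intro: H_mvar_pow one_H)
  have H_single: "Poly_Mapping.single m c \<in> H (mdeg m)" if m: "Poly_Mapping.keys m \<subseteq> I" for m c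
  proof -
    have power: "mvar v ^ n = (Poly_Mapping.single (Poly_Mapping.single v n) 1 :: ('a, 'a) mpoly)" for v n
      by (induction n) (auto simp: mvar_def mult_single single_add[symmetric] add.commute)
    have "(\<Prod>v\<in>A. mvar v ^ e v) =
        (Poly_Mapping.single (\<Sum>v\<in>A. Poly_Mapping.single v (e v)) 1 :: ('a, 'a) mpoly)" for A e
      by (induction A rule: infinite_finite_induct) (auto simp: power mult_single)
    then have "mconst c * (\<Prod>v\<in>Poly_Mapping.keys m. mvar v ^ Poly_Mapping.lookup m v) = Poly_Mapping.single m c"
      using mpoly_eq_sum_single[of m] by (simp add: mconst_def mult_single)
    moreover have "mconst c * (\<Prod>v\<in>Poly_Mapping.keys m. mvar v ^ Poly_Mapping.lookup m v) \<in> H (mdeg m)"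
      unfolding mdeg_def by (intro H_const H_monomial m) simp
    ultimately show ?thesis by simp
  qed
  have h_form: "?h (form d c) = monom (\<Sum>i\<le>d. c i * a ^ i * b ^ (d - i)) d" for d c
  proof -
    have "?h (form d c) = (\<Sum>i\<le>d. [:c i:] * monom a 1 ^ i * monom b 1 ^ (d - i))"
      unfolding form_def rees_map_eq_meval
      by (simp add: const_hom.meval_sum const_hom.meval_mult const_hom.meval_power)
    also have "\<dots> = (\<Sum>i\<le>d. monom (c i * a ^ i * b ^ (d - i)) d)"
      by (intro sum.cong) (auto simp: monom_power smult_monom mult_monom)
    finally show ?thesis by (simp add: monom_sum)
  qed
  fix F :: "('a, 'a) mpoly"
  assume F: "F \<in> ?T" "?h F = 0"
  define D where "D = mdeg ` Poly_Mapping.keys F"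
  define part where "part d = (\<Sum>m\<in>{m\<in>Poly_Mapping.keys F. mdeg m = d}.
      Poly_Mapping.single m (Poly_Mapping.lookup F m))" for d
  have F_eq: "F = (\<Sum>d\<in>D. part d)"
    unfolding part_def D_def using mpoly_eq_sum_single[of F]
    by (rule trans) (rule sum.image_gen, simp)
  have H0: "0 \<in> H d" for d
    unfolding H_def mem_Collect_eq
    by (rule exI[of _ "\<lambda>_. 0"], rule exI[of _ 0]) (simp add: form_def mconst_hom KD)
  have sum_H: "(\<Sum>m\<in>A. f m) \<in> H d" if "\<And>m. m \<in> A \<Longrightarrow> f m \<in> H d" for A d and f :: "('a \<Rightarrow>\<^sub>0 nat) \<Rightarrow> ('a, 'a) mpoly"
    using that by (induction A rule: infinite_finite_induct) (auto intro: H_add H0)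
  have part_H: "part d \<in> H d" for d
    unfolding part_def using F(1) H_single by (intro sum_H) (auto simp: sym_free_carrier_def)
  have part_monom: "\<exists>r. ?h (part d) = monom r d" for d
    using part_H[of d] hK h_form unfolding H_def
    by (auto simp: rees_map_eq_meval const_hom.meval_add)
  have part_K: "part d \<in> K" if "d \<in> D" for d
  proof -
    have "0 = coeff (?h F) d" using F(2) by simp
    also have "\<dots> = (\<Sum>d'\<in>D. coeff (?h (part d')) d)"
      by (subst F_eq) (simp add: rees_map_eq_meval const_hom.meval_sum coeff_sum)
    also have "\<dots> = (\<Sum>d'\<in>D. if d' = d then coeff (?h (part d)) d else 0)"
    proof (intro sum.cong refl)
      fix d'
      obtain r where "?h (part d') = monom r d'" using part_monom by blast
      then show "coeff (?h (part d')) d = (if d' = d then coeff (?h (part d)) d else 0)"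
        by (auto simp: coeff_monom)
    qed
    also have "\<dots> = coeff (?h (part d)) d" using that by (simp add: D_def)
    finally have coeff0: "coeff (?h (part d)) d = 0" by simp
    obtain c k where ck: "part d = form d c + k" "k \<in> K" using part_H[of d] unfolding H_def by blast
    have "?h (part d) = ?h (form d c)"
      unfolding ck(1) using hK[OF ck(2)] by (simp add: rees_map_eq_meval const_hom.meval_add)
    then have "(\<Sum>i\<le>d. c i * a ^ i * b ^ (d - i)) = 0" using coeff0 by (simp add: h_form)
    also have "(\<Sum>i\<le>d. c i * a ^ i * b ^ (d - i)) = l ^ d * (\<Sum>i\<le>d. c i * a' ^ i * b' ^ (d - i))"
        unfolding sum_distrib_left
    proof (intro sum.cong refl)
      fix i
      assume "i \<in> {..d}"
      then have "l ^ d = l ^ i * l ^ (d - i)" by (simp add: power_add[symmetric])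
      then show "c i * a ^ i * b ^ (d - i) = l ^ d * (c i * a' ^ i * b' ^ (d - i))"
        by (simp only: l power_mult_distrib mult_ac)
    qed
    finally have zero: "(\<Sum>i\<le>d. c i * a' ^ i * b' ^ (d - i)) = 0" using l \<open>b \<noteq> 0\<close> by auto
    have "form d c \<in> K"
      unfolding form_def
    proof (rule form_in_linear_ideal[OF reg _ _ _ _ UVT _ _ KD(3) KD(4) _ zero])
      show "b' \<noteq> 0" using l \<open>b \<noteq> 0\<close> by auto
      show "mconst c * ?U + mconst d * ?V \<in> K" if "c * a' + d * b' = 0" for c d
      proof (rule syz)
        have "c * a + d * b = l * (c * a' + d * b')" unfolding l by (simp add: algebra_simps)
        then show "c * a + d * b = 0" using that by simp
      qed
    qed (auto simp: mconst_hom intro: sym_free_carrier_closed)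
    then show ?thesis unfolding ck(1) using ck(2) by (rule KD(3))
  qed
  have "(\<Sum>d\<in>A. part d) \<in> K" if "A \<subseteq> D" for A
    using that by (induction A rule: infinite_finite_induct) (auto intro: KD part_K)
  then show "F \<in> Idl\<^bsub>sym_free I\<^esub> (sym_relations I)" using F_eq K_def by auto
qed

section \<open>Linear type of the Jacobian ideal\<close>

definition linear_form :: "'v \<Rightarrow> 'v \<Rightarrow> 'v \<Rightarrow> 'a \<times> 'a \<times> 'a \<Rightarrow> ('v, 'a::comm_ring_1) mpoly" where
  "linear_form v1 v2 v3 = (\<lambda>(a, b, c). mconst a * mvar v1 + mconst b * mvar v2 + mconst c * mvar v3)"

lemma mdeg_1_imp_single:
  assumes "mdeg m = 1"
  shows "\<exists>v. m = Poly_Mapping.single v 1"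
proof -
  have sum: "(\<Sum>v\<in>Poly_Mapping.keys m. Poly_Mapping.lookup m v) = 1" using assms by (simp add: mdeg_def)
  have "Poly_Mapping.keys m \<noteq> {}"
  proof
    assume "Poly_Mapping.keys m = {}"
    then show False using sum by simp
  qed
  then obtain v where v: "v \<in> Poly_Mapping.keys m" by blast
  then have "Poly_Mapping.lookup m v + (\<Sum>w\<in>Poly_Mapping.keys m - {v}. Poly_Mapping.lookup m w) = 1"
    using sum sum.remove[OF finite_keys v, of "Poly_Mapping.lookup m"] by simp
  moreover have "Poly_Mapping.lookup m v \<ge> 1" using v by (simp add: in_keys_iff Suc_le_eq)
  ultimately have 1: "Poly_Mapping.lookup m v = 1"
    and "(\<Sum>w\<in>Poly_Mapping.keys m - {v}. Poly_Mapping.lookup m w) = 0" by linarith+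
  then have rest: "\<forall>w\<in>Poly_Mapping.keys m - {v}. Poly_Mapping.lookup m w = 0"
    using sum_eq_0_iff[of "Poly_Mapping.keys m - {v}" "Poly_Mapping.lookup m"] by simp
  have "m = Poly_Mapping.single v 1"
  proof (rule poly_mapping_eqI)
    fix w
    show "Poly_Mapping.lookup m w = Poly_Mapping.lookup (Poly_Mapping.single v 1) w"
    proof (cases "w = v")
      case True
      then show ?thesis using 1 by simp
    next
      case False
      then have "Poly_Mapping.lookup m w = 0"
        using rest by (cases "w \<in> Poly_Mapping.keys m") (simp_all add: not_in_keys_iff_lookup_eq_zero)
      then show ?thesis using False by (simp add: lookup_single)
    qed
  qed
  then show ?thesis ..
qed

lemma homogeneous_1_linear_form:
  fixes F :: "('v, 'a::comm_ring_1) mpoly"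
  assumes F: "homogeneous 1 F" and U: "UNIV = {v1, v2, v3}" and d: "v1 \<noteq> v2" "v1 \<noteq> v3" "v2 \<noteq> v3"
  shows "\<exists>z. F = linear_form v1 v2 v3 z"
proof -
  define c where "c v = Poly_Mapping.lookup F (Poly_Mapping.single v 1)" for v
  have single_inj: "Poly_Mapping.single v (1::nat) = Poly_Mapping.single w 1 \<longleftrightarrow> v = w" for v w :: 'v
  proof
    assume "Poly_Mapping.single v (1::nat) = Poly_Mapping.single w 1"
    then have "Poly_Mapping.keys (Poly_Mapping.single v (1::nat)) = Poly_Mapping.keys (Poly_Mapping.single w (1::nat))"
      by (rule arg_cong)
    then show "v = w" by simp
  qed simp
  have "F = (\<Sum>v\<in>UNIV. Poly_Mapping.single (Poly_Mapping.single v 1) (c v))"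
  proof (rule poly_mapping_eqI)
    fix m
    have fin: "finite (UNIV :: 'v set)" using U by (metis finite.emptyI finite_insert)
    show "Poly_Mapping.lookup F m =
        Poly_Mapping.lookup (\<Sum>v\<in>UNIV. Poly_Mapping.single (Poly_Mapping.single v 1) (c v)) m"
    proof (cases "\<exists>w. m = Poly_Mapping.single w 1")
      case True
      then obtain w where w: "m = Poly_Mapping.single w 1" by blast
      have "(\<Sum>v\<in>UNIV. Poly_Mapping.lookup (Poly_Mapping.single (Poly_Mapping.single v 1) (c v)) m) =
          (\<Sum>v\<in>UNIV. if v = w then c w else 0)"
        by (intro sum.cong refl) (simp only: w lookup_single when_def single_inj c_def, auto)
      then show ?thesis using fin by (simp add: lookup_sum w c_def)
    next
      case False
      then have "m \<notin> Poly_Mapping.keys F" using F mdeg_1_imp_single unfolding homogeneous_def by blast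
      moreover have "(\<Sum>v\<in>UNIV. Poly_Mapping.lookup (Poly_Mapping.single (Poly_Mapping.single v 1) (c v)) m) = 0"
        by (rule sum.neutral) (use False in \<open>auto simp: lookup_single when_def\<close>)
      ultimately show ?thesis by (simp add: lookup_sum in_keys_iff)
    qed
  qed
  also have "\<dots> = linear_form v1 v2 v3 (c v1, c v2, c v3)"
    unfolding U using d by (simp add: linear_form_def mconst_def mvar_def mult_single add.assoc)
  finally show ?thesis by blast
qed

lemma rees_map_linear_form:
  "rees_map g (linear_form v1 v2 v3 z) = monom (dot3 z (g v1, g v2, g v3)) 1"
  by (cases z) (simp add: linear_form_def rees_map_eq_meval const_hom.meval_add const_hom.meval_mult
      smult_monom add_monom)

lemma meval_linear_form:
  "meval (\<lambda>c. c) \<xi> (linear_form v1 v2 v3 z) = dot3 z (\<xi> v1, \<xi> v2, \<xi> v3)"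
  by (cases z) (simp add: linear_form_def id_hom.meval_add id_hom.meval_mult)

definition ideal3 :: "'a::comm_ring_1 \<Rightarrow> 'a \<Rightarrow> 'a \<Rightarrow> 'a set" where
  "ideal3 g1 g2 g3 = {u * g1 + v * g2 + w * g3 | u v w. True}"

lemma ideal_gen_eq_ideal3: "ideal_gen {g1, g2, g3} = ideal3 g1 g2 g3"
proof
  show "ideal_gen {g1, g2, g3} \<subseteq> ideal3 g1 g2 g3"
  proof (rule ideal_gen_minimal)
    show "{g1, g2, g3} \<subseteq> ideal3 g1 g2 g3"
    proof -
      have "1 * g1 + 0 * g2 + 0 * g3 \<in> ideal3 g1 g2 g3" "0 * g1 + 1 * g2 + 0 * g3 \<in> ideal3 g1 g2 g3"
        "0 * g1 + 0 * g2 + 1 * g3 \<in> ideal3 g1 g2 g3" unfolding ideal3_def by blast+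
      then have "g1 \<in> ideal3 g1 g2 g3" "g2 \<in> ideal3 g1 g2 g3" "g3 \<in> ideal3 g1 g2 g3"
        by (simp_all only: mult_1 mult_zero_left add_0_left add_0_right)
      then show ?thesis by blast
    qed
    have "0 * g1 + 0 * g2 + 0 * g3 \<in> ideal3 g1 g2 g3" unfolding ideal3_def by blast
    then show "0 \<in> ideal3 g1 g2 g3" by (simp only: mult_zero_left add_0_left)
    fix r s
    assume "s \<in> ideal3 g1 g2 g3"
    then obtain u v w where s: "s = u * g1 + v * g2 + w * g3" unfolding ideal3_def by blast
    have "r * s = (r * u) * g1 + (r * v) * g2 + (r * w) * g3" unfolding s by (simp add: algebra_simps)
    then show "r * s \<in> ideal3 g1 g2 g3" unfolding ideal3_def by blast
    assume "r \<in> ideal3 g1 g2 g3"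
    then obtain u' v' w' where r: "r = u' * g1 + v' * g2 + w' * g3" unfolding ideal3_def by blast
    have "r + s = (u' + u) * g1 + (v' + v) * g2 + (w' + w) * g3" unfolding r s by (simp add: algebra_simps)
    then show "r + s \<in> ideal3 g1 g2 g3" unfolding ideal3_def by blast
  qed
  note D = ideal_ring_onD[OF ideal_gen_ideal[of "{g1, g2, g3}"]]
  have g: "g1 \<in> ideal_gen {g1, g2, g3}" "g2 \<in> ideal_gen {g1, g2, g3}" "g3 \<in> ideal_gen {g1, g2, g3}"
    using ideal_gen_superset[of "{g1, g2, g3}"] by blast+
  show "ideal3 g1 g2 g3 \<subseteq> ideal_gen {g1, g2, g3}"
  proof
    fix s
    assume "s \<in> ideal3 g1 g2 g3"
    then obtain u v w where "s = u * g1 + v * g2 + w * g3" unfolding ideal3_def by blast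
    then show "s \<in> ideal_gen {g1, g2, g3}"
      by (simp only:) (intro D(3) D(4)[OF UNIV_I] g)
  qed
qed

lemma ideal3_permute: "ideal3 g1 g2 g3 = ideal3 g2 g1 g3" "ideal3 g1 g2 g3 = ideal3 g3 g1 g2"
proof -
  have swap: "ideal3 a b c \<subseteq> ideal3 b a c" "ideal3 a b c \<subseteq> ideal3 a c b" for a b c :: 'a
  proof -
    have "s \<in> ideal3 b a c \<and> s \<in> ideal3 a c b" if "s \<in> ideal3 a b c" for s
    proof -
      from that obtain u v w where s: "s = u * a + v * b + w * c" unfolding ideal3_def by blast
      then have "s = v * b + u * a + w * c" "s = u * a + w * c + v * b" by (simp_all add: add_ac)
      then show ?thesis unfolding ideal3_def by blast
    qed
    then show "ideal3 a b c \<subseteq> ideal3 b a c" "ideal3 a b c \<subseteq> ideal3 a c b" by blast+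
  qed
  show "ideal3 g1 g2 g3 = ideal3 g2 g1 g3" by (rule antisym) (rule swap)+
  have "ideal3 g1 g2 g3 = ideal3 g1 g3 g2" "ideal3 g1 g3 g2 = ideal3 g3 g1 g2"
    by (rule antisym; rule swap)+
  then show "ideal3 g1 g2 g3 = ideal3 g3 g1 g2" by (rule trans)
qed

lemma ideal3_eliminate:
  assumes "a dvd 1" "a * g1 + b * g2 + c * g3 = 0"
  shows "ideal3 g1 g2 g3 = {v * g2 + w * g3 | v w. True}"
proof
  obtain i where i: "a * i = 1" using assms(1) by (auto simp: dvd_def)
  have "(a * i) * g1 + ((i * b) * g2 + (i * c) * g3) = i * (a * g1 + b * g2 + c * g3)"
    by (simp add: algebra_simps)
  then have "g1 + ((i * b) * g2 + (i * c) * g3) = 0" unfolding i assms(2) by simp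
  then have g1: "g1 = - ((i * b) * g2 + (i * c) * g3)" by (simp only: eq_neg_iff_add_eq_0)
  show "ideal3 g1 g2 g3 \<subseteq> {v * g2 + w * g3 | v w. True}"
  proof
    fix s
    assume "s \<in> ideal3 g1 g2 g3"
    then obtain u v w where "s = u * g1 + v * g2 + w * g3" unfolding ideal3_def by blast
    then have "s = u * - ((i * b) * g2 + (i * c) * g3) + v * g2 + w * g3" by (simp only: g1[symmetric])
    then have "s = (v - u * (i * b)) * g2 + (w - u * (i * c)) * g3" by (simp add: algebra_simps)
    then show "s \<in> {v * g2 + w * g3 | v w. True}" by blast
  qed
  show "{v * g2 + w * g3 | v w. True} \<subseteq> ideal3 g1 g2 g3"
  proof
    fix s
    assume "s \<in> {v * g2 + w * g3 | v w. True}"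
    then obtain v w where "s = 0 * g1 + v * g2 + w * g3" by auto
    then show "s \<in> ideal3 g1 g2 g3" unfolding ideal3_def by blast
  qed
qed

context plane_local_ring
begin

lemma two_generated_linear_type:
  fixes a b :: 'a
  assumes "a \<noteq> 0 \<or> b \<noteq> 0"
  shows "linear_type {u * a + v * b | u v. True}"
proof (cases "b = 0")
  case False
  then obtain l a' b' where "a = l * a'" "b = l * b'" "regular_pair a' b'"
    using gcd_decomposition[of a b] by blast
  then show ?thesis using False by (intro linear_type_two_generated[OF refl])
next
  case True
  then have "a \<noteq> 0" using assms by simp
  then obtain l a' b' where "b = l * b'" "a = l * a'" "regular_pair b' a'"
    using gcd_decomposition[of b a] by blast
  then have "linear_type {u * b + v * a | u v. True}"
    using \<open>a \<noteq> 0\<close> by (intro linear_type_two_generated[OF refl])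
  moreover have "{u * b + v * a | u v. True} = {u * a + v * b | u v. True}"
  proof -
    have "\<exists>u' v'. u * r + v * s = u' * s + v' * r" for u v r s :: 'a
      by (intro exI[of _ v] exI[of _ u]) (rule add.commute)
    then show ?thesis by blast
  qed
  ultimately show ?thesis by simp
qed

lemma unit_syzygy_imp_linear_type:
  fixes g1 g2 g3 :: 'a
  assumes nz: "g1 \<noteq> 0" and z: "(a, b, c) \<in> syzygies g1 g2 g3" and unit: "a dvd 1 \<or> b dvd 1 \<or> c dvd 1"
  shows "linear_type (ideal3 g1 g2 g3)"
proof -
  have g1: "g1 \<in> ideal3 g1 g2 g3" using ideal_gen_superset ideal_gen_eq_ideal3 by blast
  have two: "linear_type (ideal3 g1 g2 g3)" if "ideal3 g1 g2 g3 = {u * r + v * s | u v. True}" for r s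
  proof -
    have "r \<noteq> 0 \<or> s \<noteq> 0" using g1 nz unfolding that by auto
    then show ?thesis unfolding that by (rule two_generated_linear_type)
  qed
  from unit show ?thesis
  proof (elim disjE)
    assume "a dvd 1"
    then have "ideal3 g1 g2 g3 = {v * g2 + w * g3 | v w. True}"
      by (rule ideal3_eliminate[of a _ b _ c]) (use z in simp)
    then show ?thesis by (rule two)
  next
    assume "b dvd 1"
    then have "ideal3 g2 g1 g3 = {v * g1 + w * g3 | v w. True}"
      by (rule ideal3_eliminate[of b _ a _ c]) (use z in \<open>simp add: add_ac\<close>)
    then show ?thesis by (intro two) (simp only: ideal3_permute(1)[of g1 g2 g3])
  next
    assume "c dvd 1"
    then have "ideal3 g3 g1 g2 = {v * g1 + w * g2 | v w. True}"
      by (rule ideal3_eliminate[of c _ a _ b]) (use z in \<open>simp add: add_ac\<close>)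
    then show ?thesis by (intro two) (simp only: ideal3_permute(2)[of g1 g2 g3])
  qed
qed

text \<open>If no syzygy has a unit entry, \<open>quadratic_relation_outside_linear\<close> provides a quadratic form \<open>F\<close> in
  the kernel. All elements of the ideal generated by the linear part of the kernel take values
  \<open>dot3 z (1, \<xi>2, \<xi>3)\<close> with \<open>z\<close> a syzygy at the chosen point, and these values form an ideal. The value
  of \<open>F\<close> is not among them, and it does not change when \<open>F\<close> is multiplied by a power of the variable
  that is specialised to 1.\<close>

lemma torsion_kernel_imp_unit_syzygy:
  fixes g :: "'v \<Rightarrow> 'a"
  assumes U: "UNIV = {v1, v2, v3}" and d: "v1 \<noteq> v2" "v1 \<noteq> v3" "v2 \<noteq> v3" and nz: "g v1 \<noteq> 0"
    and torsion: "\<And>F. rees_map g F = 0 \<Longrightarrow>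
      mvar v1 ^ N * F \<in> ideal_gen {F. rees_map g F = 0 \<and> homogeneous 1 F}"
  shows "\<exists>a b c. (a, b, c) \<in> syzygies (g v1) (g v2) (g v3) \<and> (a dvd 1 \<or> b dvd 1 \<or> c dvd 1)"
proof (rule ccontr)
  assume contra: "\<not> ?thesis"
  let ?Z = "syzygies (g v1) (g v2) (g v3)" and ?L = "linear_form v1 v2 v3"
  let ?g = "(g v1, g v2, g v3)"
  have nonunits: "\<not> a dvd 1 \<and> \<not> b dvd 1 \<and> \<not> c dvd 1" if "(a, b, c) \<in> ?Z" for a b c
    using contra that by blast
  obtain p q p' q' \<xi>2 \<xi>3 where rel: "dot3 p ?g * dot3 q' ?g = dot3 p' ?g * dot3 q ?g"
    and out: "\<And>z. z \<in> ?Z \<Longrightarrow> dot3 p (1, \<xi>2, \<xi>3) * dot3 q' (1, \<xi>2, \<xi>3)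
      - dot3 p' (1, \<xi>2, \<xi>3) * dot3 q (1, \<xi>2, \<xi>3) \<noteq> dot3 z (1, \<xi>2, \<xi>3)"
    by (rule quadratic_relation_outside_linear[OF nz nonunits]) (assumption, rule that, assumption+)
  define F where "F = ?L p * ?L q' - ?L p' * ?L q"
  have "rees_map g F = monom (dot3 p ?g * dot3 q' ?g) 2 - monom (dot3 p' ?g * dot3 q ?g) 2"
    unfolding F_def using rees_map_linear_form[of g v1 v2 v3]
    by (simp add: rees_map_eq_meval const_hom.meval_diff const_hom.meval_mult mult_monom numeral_2_eq_2)
  then have "rees_map g F = 0" unfolding rel by simp
  then have mem: "mvar v1 ^ N * F \<in> ideal_gen {F. rees_map g F = 0 \<and> homogeneous 1 F}" by (rule torsion)
  define \<xi> where "\<xi> v = (if v = v1 then 1 else if v = v2 then \<xi>2 else \<xi>3)" for v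
  have \<xi>: "\<xi> v1 = 1" "\<xi> v2 = \<xi>2" "\<xi> v3 = \<xi>3" using d by (auto simp: \<xi>_def)
  let ?ev = "meval (\<lambda>c. c) \<xi>"
  let ?I = "{F. \<exists>z\<in>?Z. ?ev F = dot3 z (1, \<xi>2, \<xi>3)}"
  have "ideal_gen {F. rees_map g F = 0 \<and> homogeneous 1 F} \<subseteq> ?I"
  proof (rule ideal_gen_minimal)
    show "{F. rees_map g F = 0 \<and> homogeneous 1 F} \<subseteq> ?I"
    proof safe
      fix G
      assume G: "rees_map g G = 0" "homogeneous 1 G"
      obtain z where z: "G = ?L z" using homogeneous_1_linear_form[OF G(2) U d] by blast
      have "dot3 z ?g = 0" using G(1) unfolding z rees_map_linear_form by simp
      then have "z \<in> ?Z" by (cases z) simp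
      then show "\<exists>z\<in>?Z. ?ev G = dot3 z (1, \<xi>2, \<xi>3)" unfolding z meval_linear_form \<xi> by blast
    qed
    have "(0, 0, 0) \<in> ?Z" by simp
    moreover have "?ev 0 = dot3 (0, 0, 0) (1, \<xi>2, \<xi>3)" by simp
    ultimately show "0 \<in> ?I" by blast
    fix G H
    assume "H \<in> ?I"
    then obtain a b c where abc: "(a, b, c) \<in> ?Z" "?ev H = dot3 (a, b, c) (1, \<xi>2, \<xi>3)" by auto
    have "?ev G * a * g v1 + ?ev G * b * g v2 + ?ev G * c * g v3 = ?ev G * (a * g v1 + b * g v2 + c * g v3)"
      by (simp add: algebra_simps)
    then have "(?ev G * a, ?ev G * b, ?ev G * c) \<in> ?Z" using abc(1) by simp
    moreover have "?ev (G * H) = dot3 (?ev G * a, ?ev G * b, ?ev G * c) (1, \<xi>2, \<xi>3)"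
      using abc(2) by (simp add: id_hom.meval_mult algebra_simps)
    ultimately show "G * H \<in> ?I" by blast
    assume "G \<in> ?I"
    then obtain a' b' c' where abc': "(a', b', c') \<in> ?Z" "?ev G = dot3 (a', b', c') (1, \<xi>2, \<xi>3)" by auto
    have "(a' + a) * g v1 + (b' + b) * g v2 + (c' + c) * g v3 =
        (a' * g v1 + b' * g v2 + c' * g v3) + (a * g v1 + b * g v2 + c * g v3)"
      by (simp add: algebra_simps)
    then have "(a' + a, b' + b, c' + c) \<in> ?Z" using abc(1) abc'(1) by simp
    moreover have "?ev (G + H) = dot3 (a' + a, b' + b, c' + c) (1, \<xi>2, \<xi>3)"
      using abc(2) abc'(2) by (simp add: id_hom.meval_add algebra_simps)
    ultimately show "G + H \<in> ?I" by blast
  qed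
  then obtain z where z: "z \<in> ?Z" "?ev (mvar v1 ^ N * F) = dot3 z (1, \<xi>2, \<xi>3)" using mem by blast
  have "?ev (mvar v1 ^ N * F) = ?ev F"
    by (simp add: id_hom.meval_mult id_hom.meval_power \<xi>)
  also have "\<dots> = dot3 p (1, \<xi>2, \<xi>3) * dot3 q' (1, \<xi>2, \<xi>3) - dot3 p' (1, \<xi>2, \<xi>3) * dot3 q (1, \<xi>2, \<xi>3)"
    unfolding F_def by (simp add: id_hom.meval_diff id_hom.meval_mult meval_linear_form \<xi>)
  finally show False using out[OF z(1)] z(2) by simp
qed

end

theorem mainTheorem6:
  fixes X D :: "(complex ^ 'n::finite) set" and f :: "complex ^ 'n \<Rightarrow> complex"
  assumes "open X"
    and "reduced_equation X D f"
    and "CARD('n) = 2"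
    and "GCL X f"
  shows "commutative_linear_type D f"
  unfolding commutative_linear_type_def
proof
  fix p
  assume p: "p \<in> D"
  obtain i j :: 'n where ij: "UNIV = {i, j}" "i \<noteq> j" using assms(3) unfolding card_2_iff by blast
  interpret two_coordinates i j using ij by unfold_locales
  let ?g = "jac_gen f p"
  have "p \<in> X" and nz: "?g SVar \<noteq> 0" using assms(2) p by (auto simp: reduced_equation_def)
  obtain N where N: "\<And>F. F \<in> ker_phi f p \<Longrightarrow> mvar SVar ^ N * F \<in> ker1_phi f p"
    using assms(4) \<open>p \<in> X\<close> unfolding GCL_def by blast
  have vars: "(UNIV :: 'n jvar set) = {SVar, XiVar i, XiVar j}"
  proof -
    have "v \<in> {SVar, XiVar i, XiVar j}" for v :: "'n jvar" using ij(1) by (cases v) auto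
    then show ?thesis by blast
  qed
  have "\<exists>a b c. (a, b, c) \<in> syzygies (?g SVar) (?g (XiVar i)) (?g (XiVar j)) \<and> (a dvd 1 \<or> b dvd 1 \<or> c dvd 1)"
    by (rule torsion_kernel_imp_unit_syzygy[OF vars])
       (use N nz ij(2) in \<open>simp_all add: ker_phi_def ker1_phi_def\<close>)
  then have "linear_type (ideal3 (?g SVar) (?g (XiVar i)) (?g (XiVar j)))"
    using unit_syzygy_imp_linear_type[OF nz] by blast
  then show "linear_type (jacobian_ideal f p)"
    unfolding jacobian_ideal_def vars by (simp only: image_insert image_empty ideal_gen_eq_ideal3)
qed

end
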